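(* Let $\Omega=\{z\in\mathbb{C}^n : r(z)<0\}$ be a domain in $\mathbb{C}^n$, let $k\ge 1$ be an integer, let $\tilde\Omega=\{(z,w)\in\mathbb{C}^n\times\mathbb{C}^k : r(z)+|w|^2<0\}$ be its lift in $\mathbb{C}^{n+k}$, and let $0<p<\infty$. Then: (1) If $F\in H^p(\tilde\Omega)$, then $f(z):=F(z,0)$ belongs to $A^p_{k-1}(\Omega)$ and $\|f\|_{A^p_{k-1}(\Omega)}\lesssim\|F\|_{H^p(\tilde\Omega)}$. (2) If $F\in\mathcal{N}(\tilde\Omega)$, then $f(z):=F(z,0)$ belongs to $\mathcal{N}_{k-1}(\Omega)$ and $\|f\|_{\mathcal{N}_{k-1}(\Omega)}\lesssim\|F\|_{\mathcal{N}(\tilde\Omega)}$. (3) A function $f$ holomorphic in $\Omega$ belongs to $A^p_{k-1}(\Omega)$ (resp. to $\mathcal{N}_{k-1}(\Omega)$) if and only if the function $F(z,w):=f(z)$ on $\tilde\Omega$ belongs to $H^p(\tilde\Omega)$ (resp. to $\mathcal{N}(\tilde\Omega)$), and in that case $\|f\|_{A^p_{k-1}(\Omega)}\simeq\|F\|_{H^p(\tilde\Omega)}$ (resp. $\|f\|_{\mathcal{N}_{k-1}(\Omega)}\simeq\|F\|_{\mathcal{N}(\tilde\Omega)}$).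
   Context: A domain is a bounded connected open set $\Omega=\{z\in\mathbb{C}^n: r(z)<0\}$ with $r\in\mathcal{C}^\infty(\mathbb{C}^n)$ real valued, $\mathrm{grad}\, r\ne 0$ on $\partial\Omega$, and $-r(z)\simeq d(z,\Omega^c)$ uniformly on $\bar\Omega$. The lift $\tilde\Omega$ has defining function $\tilde r(z,w)=r(z)+|w|^2$. $dm$ is Lebesgue measure on $\mathbb{C}^n$; $v_j$ is the volume of the unit ball of $\mathbb{C}^j$; $dm_0:=dm$ and, for $j\ge1$, $dm_j(z):=(j+1)v_{j+1}(-r(z))^j\,dm(z)$ on $\Omega$. For $f$ holomorphic in $\Omega$ and an integer $j\ge0$: $\|f\|_{A^p_j(\Omega)}^p:=\int_\Omega|f|^p\,dm_j$ and $\|f\|_{\mathcal{N}_j(\Omega)}:=\int_\Omega\log^+|f|\,dm_j$; the spaces $A^p_j(\Omega)$ and $\mathcal{N}_j(\Omega)$ consist of those $f$ for which the respective quantity is finite. For a domain $D$ with defining function $s$ (here $D=\tilde\Omega$, $s=\tilde r$) and $F$ holomorphic in $D$: $\|F\|_{H^p(D)}^p:=\sup_{\epsilon}\int_{\{s=-\epsilon\}}|F|^p\,d\sigma$ and $\|F\|_{\mathcal{N}(D)}:=\sup_{\epsilon}\int_{\{s=-\epsilon\}}\log^+|F|\,d\sigma$, the suprema being over small $\epsilon>0$ (so small that the level sets are smooth hypersurfaces near $\partial D$), where $d\sigma$ is surface (Lebesgue) measure; $H^p(D)$ and $\mathcal{N}(D)$ consist of those $F$ for which the respective quantity is finite. $A\lesssim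 B$ means $A\le CB$ with $C$ independent of the functions; $A\simeq B$ means $A\lesssim B$ and $B\lesssim A$. *)

theory Defs
  imports "HOL-Analysis.Analysis"
begin

text \<open>
  The space of \<open>m\<close> complex variables is \<open>complex ^ 'm\<close>, a real Euclidean space of dimension
  \<open>2 * CARD('m)\<close>.  The product of the spaces of \<open>n\<close> and \<open>k\<close> complex variables is
  \<open>complex ^ ('n + 'k)\<close>, indexed by the disjoint sum, so that everything below applies
  verbatim both to a domain and to its lift.
\<close>

section \<open>Smooth functions and domains\<close>

primrec iterated_deriv :: "'a::euclidean_space list \<Rightarrow> ('a \<Rightarrow> real) \<Rightarrow> 'a \<Rightarrow> real" where
  "iterated_deriv [] f = f"
| "iterated_deriv (v # vs) f = iterated_deriv vs (\<lambda>x. frechet_derivative f (at x) v)"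

text \<open>Infinitely differentiable on the whole space: every iterated directional derivative is
  (Frechet) differentiable, hence also continuous.\<close>
definition smooth :: "('a::euclidean_space \<Rightarrow> real) \<Rightarrow> bool" where
  "smooth f \<longleftrightarrow> (\<forall>vs x. iterated_deriv vs f differentiable at x)"

definition grad_nonzero :: "('a::euclidean_space \<Rightarrow> real) \<Rightarrow> 'a \<Rightarrow> bool" where
  "grad_nonzero s x \<longleftrightarrow> (\<exists>D. GDERIV s x :> D \<and> D \<noteq> 0)"

definition sublevel :: "('a::euclidean_space \<Rightarrow> real) \<Rightarrow> 'a set" where
  "sublevel s = {x. s x < 0}"

definition is_domain :: "(complex ^ 'm::finite \<Rightarrow> real) \<Rightarrow> bool" where
  "is_domain r \<longleftrightarrow>
     smooth r \<and> bounded (sublevel r) \<and> connected (sublevel r) \<and> open (sublevel r) \<and>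
     (\<forall>z\<in>frontier (sublevel r). grad_nonzero r z) \<and>
     (\<exists>c>0. \<exists>C>0. \<forall>z\<in>closure (sublevel r).
        c * infdist z (- sublevel r) \<le> - r z \<and> - r z \<le> C * infdist z (- sublevel r))"

section \<open>The lift\<close>

definition zpart :: "complex ^ ('n::finite + 'k::finite) \<Rightarrow> complex ^ 'n" where
  "zpart \<zeta> = (\<chi> i. \<zeta> $ Inl i)"

definition wpart :: "complex ^ ('n::finite + 'k::finite) \<Rightarrow> complex ^ 'k" where
  "wpart \<zeta> = (\<chi> j. \<zeta> $ Inr j)"

definition join :: "complex ^ 'n::finite \<Rightarrow> complex ^ 'k::finite \<Rightarrow> complex ^ ('n + 'k)" where
  "join z w = (\<chi> i. case i of Inl a \<Rightarrow> z $ a | Inr b \<Rightarrow> w $ b)"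

definition lift :: "(complex ^ 'n::finite \<Rightarrow> real) \<Rightarrow> complex ^ ('n + 'k::finite) \<Rightarrow> real" where
  "lift r \<zeta> = r (zpart \<zeta>) + (norm (wpart \<zeta>))\<^sup>2"

section \<open>Holomorphic functions of several variables\<close>

text \<open>Used on open sets \<open>D\<close>: the real derivative exists and is complex linear.\<close>
definition holomorphic :: "(complex ^ 'm::finite \<Rightarrow> complex) \<Rightarrow> (complex ^ 'm) set \<Rightarrow> bool" where
  "holomorphic f D \<longleftrightarrow>
     (\<forall>z\<in>D. \<exists>L. (f has_derivative L) (at z) \<and> (\<forall>c v. L (c *s v) = c * L v))"

text \<open>At a zero of \<open>f\<close> the value is \<open>0\<close>, because \<open>ln 0 = 0\<close>.\<close>
definition log_plus :: "complex \<Rightarrow> real" where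
  "log_plus u = max 0 (ln (norm u))"

section \<open>Weighted Bergman and Nevanlinna spaces\<close>

definition dm :: "(complex ^ 'm::finite \<Rightarrow> real) \<Rightarrow> nat \<Rightarrow> (complex ^ 'm) measure" where
  "dm r j = density (restrict_space lborel (sublevel r))
     (\<lambda>z. ennreal (if j = 0 then 1
                   else real (j + 1) * unit_ball_vol (real (2 * (j + 1))) * (- r z) ^ j))"
  \<comment> \<open>\<open>unit_ball_vol\<close> takes the real dimension, which is \<open>2 * (j + 1)\<close> for \<open>j + 1\<close> complex variables\<close>

definition bergman_int ::
  "(complex ^ 'm::finite \<Rightarrow> real) \<Rightarrow> nat \<Rightarrow> real \<Rightarrow> (complex ^ 'm \<Rightarrow> complex) \<Rightarrow> ennreal" where
  "bergman_int r j p f = (\<integral>\<^sup>+z. ennreal (norm (f z) powr p) \<partial>dm r j)"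

definition bergman_space ::
  "(complex ^ 'm::finite \<Rightarrow> real) \<Rightarrow> nat \<Rightarrow> real \<Rightarrow> (complex ^ 'm \<Rightarrow> complex) set" where
  "bergman_space r j p = {f. holomorphic f (sublevel r) \<and> bergman_int r j p f < \<infinity>}"

text \<open>Here and below, the real-valued norms are meaningful only for members of the
  corresponding space (\<open>enn2real \<infinity> = 0\<close>).\<close>
definition bergman_norm ::
  "(complex ^ 'm::finite \<Rightarrow> real) \<Rightarrow> nat \<Rightarrow> real \<Rightarrow> (complex ^ 'm \<Rightarrow> complex) \<Rightarrow> real" where
  "bergman_norm r j p f = enn2real (bergman_int r j p f) powr (1 / p)"

definition nev_wt_int ::
  "(complex ^ 'm::finite \<Rightarrow> real) \<Rightarrow> nat \<Rightarrow> (complex ^ 'm \<Rightarrow> complex) \<Rightarrow> ennreal" where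
  "nev_wt_int r j f = (\<integral>\<^sup>+z. ennreal (log_plus (f z)) \<partial>dm r j)"

definition nev_wt_space ::
  "(complex ^ 'm::finite \<Rightarrow> real) \<Rightarrow> nat \<Rightarrow> (complex ^ 'm \<Rightarrow> complex) set" where
  "nev_wt_space r j = {f. holomorphic f (sublevel r) \<and> nev_wt_int r j f < \<infinity>}"

definition nev_wt_norm ::
  "(complex ^ 'm::finite \<Rightarrow> real) \<Rightarrow> nat \<Rightarrow> (complex ^ 'm \<Rightarrow> complex) \<Rightarrow> real" where
  "nev_wt_norm r j f = enn2real (nev_wt_int r j f)"

section \<open>Surface measure\<close>

text \<open>Surface measure is the Hausdorff measure of codimension one, normalised so that it agrees
  with Lebesgue measure on hyperplanes.  The dimension \<open>d\<close> must be positive (\<open>0 ^ 0 = 1\<close> would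
  spoil \<open>d = 0\<close>).  \<open>bounded\<close> is required because \<open>diameter\<close> is unspecified on unbounded sets.
  For \<open>d > 0\<close>, \<open>hausdorff_outer d\<close> is a metric outer measure, hence by Caratheodory's criterion
  countably additive on Borel sets, so that \<open>measure_of\<close> does not degenerate.\<close>

definition hausdorff_pre :: "nat \<Rightarrow> real \<Rightarrow> 'a::euclidean_space set \<Rightarrow> ennreal" where
  "hausdorff_pre d \<delta> A =
     (INF E\<in>{E :: nat \<Rightarrow> 'a set. A \<subseteq> (\<Union>i. E i) \<and> (\<forall>i. bounded (E i) \<and> diameter (E i) \<le> \<delta>)}.
        \<Sum>i. ennreal (unit_ball_vol (real d) * (diameter (E i) / 2) ^ d))"

definition hausdorff_outer :: "nat \<Rightarrow> 'a::euclidean_space set \<Rightarrow> ennreal" where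
  "hausdorff_outer d A = (SUP \<delta>\<in>{0<..}. hausdorff_pre d \<delta> A)"

definition hausdorff_measure :: "nat \<Rightarrow> 'a::euclidean_space measure" where
  "hausdorff_measure d = measure_of UNIV (sets borel) (hausdorff_outer d)"

definition surface_measure :: "'a::euclidean_space measure" where
  "surface_measure = hausdorff_measure (DIM('a) - 1)"

section \<open>Hardy and Nevanlinna spaces\<close>

text \<open>The suprema over small \<open>\<epsilon>\<close> are taken over \<open>0 < \<epsilon> \<le> e0\<close>, where \<open>e0\<close> is so small that all these
  level sets of the defining function \<open>s\<close> are smooth hypersurfaces.  Such \<open>e0\<close> exist for lifts of
  domains: see \<open>ex_small_enough\<close> below.\<close>

definition small_enough :: "('a::euclidean_space \<Rightarrow> real) \<Rightarrow> real \<Rightarrow> bool" where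
  "small_enough s e0 \<longleftrightarrow> 0 < e0 \<and> (\<forall>\<epsilon>. 0 < \<epsilon> \<and> \<epsilon> \<le> e0 \<longrightarrow> (\<forall>x. s x = - \<epsilon> \<longrightarrow> grad_nonzero s x))"

definition hardy_int ::
  "(complex ^ 'm::finite \<Rightarrow> real) \<Rightarrow> real \<Rightarrow> real \<Rightarrow> (complex ^ 'm \<Rightarrow> complex) \<Rightarrow> ennreal" where
  "hardy_int s e0 p F =
     (SUP \<epsilon>\<in>{0<..e0}. \<integral>\<^sup>+\<zeta>\<in>{\<zeta>. s \<zeta> = - \<epsilon>}. ennreal (norm (F \<zeta>) powr p) \<partial>surface_measure)"

definition hardy_space ::
  "(complex ^ 'm::finite \<Rightarrow> real) \<Rightarrow> real \<Rightarrow> real \<Rightarrow> (complex ^ 'm \<Rightarrow> complex) set" where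
  "hardy_space s e0 p = {F. holomorphic F (sublevel s) \<and> hardy_int s e0 p F < \<infinity>}"

definition hardy_norm ::
  "(complex ^ 'm::finite \<Rightarrow> real) \<Rightarrow> real \<Rightarrow> real \<Rightarrow> (complex ^ 'm \<Rightarrow> complex) \<Rightarrow> real" where
  "hardy_norm s e0 p F = enn2real (hardy_int s e0 p F) powr (1 / p)"

definition nev_int ::
  "(complex ^ 'm::finite \<Rightarrow> real) \<Rightarrow> real \<Rightarrow> (complex ^ 'm \<Rightarrow> complex) \<Rightarrow> ennreal" where
  "nev_int s e0 F =
     (SUP \<epsilon>\<in>{0<..e0}. \<integral>\<^sup>+\<zeta>\<in>{\<zeta>. s \<zeta> = - \<epsilon>}. ennreal (log_plus (F \<zeta>)) \<partial>surface_measure)"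

definition nev_space ::
  "(complex ^ 'm::finite \<Rightarrow> real) \<Rightarrow> real \<Rightarrow> (complex ^ 'm \<Rightarrow> complex) set" where
  "nev_space s e0 = {F. holomorphic F (sublevel s) \<and> nev_int s e0 F < \<infinity>}"

definition nev_norm ::
  "(complex ^ 'm::finite \<Rightarrow> real) \<Rightarrow> real \<Rightarrow> (complex ^ 'm \<Rightarrow> complex) \<Rightarrow> real" where
  "nev_norm s e0 F = enn2real (nev_int s e0 F)"

section \<open>Existence of small levels\<close>

lemma zpart_join [simp]: "zpart (join z w) = z"
  and wpart_join [simp]: "wpart (join z w) = w"
  by (simp_all add: zpart_def wpart_def join_def vec_eq_iff)

lemma bounded_linear_zpart: "bounded_linear zpart"
  unfolding zpart_def
  by (intro linear_conv_bounded_linear[THEN iffD1] linearI) (simp_all add: vec_eq_iff)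

lemma bounded_linear_wpart: "bounded_linear wpart"
  unfolding wpart_def
  by (intro linear_conv_bounded_linear[THEN iffD1] linearI) (simp_all add: vec_eq_iff)

lemma not_grad_nonzero:
  fixes s :: "'a::euclidean_space \<Rightarrow> real"
  assumes "(s has_derivative s') (at x)" and "\<not> grad_nonzero s x"
  shows "s' v = 0"
proof -
  define D where "D = (\<Sum>b\<in>Basis. s' b *\<^sub>R b)"
  have lin: "linear s'"
    using assms(1) has_derivative_linear by blast
  have eq: "s' h = h \<bullet> D" for h
  proof -
    have "s' h = s' (\<Sum>b\<in>Basis. (h \<bullet> b) *\<^sub>R b)"
      by (simp add: euclidean_representation)
    also have "\<dots> = (\<Sum>b\<in>Basis. (h \<bullet> b) *\<^sub>R s' b)"
      using lin by (simp add: linear_sum linear_scale)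
    also have "\<dots> = h \<bullet> D"
      by (simp add: D_def inner_sum_right mult.commute)
    finally show ?thesis .
  qed
  have "s' = (\<lambda>h. h \<bullet> D)"
    using eq by auto
  then have "GDERIV s x :> D"
    using assms(1) by (simp add: gderiv_def)
  then have "D = 0"
    using assms(2) by (auto simp: grad_nonzero_def)
  then show ?thesis
    by (simp add: eq)
qed

lemma ex_small_enough:
  fixes r :: "complex ^ 'n::finite \<Rightarrow> real"
  assumes "is_domain r"
  shows "\<exists>e0. small_enough (lift r :: complex ^ ('n + 'k::finite) \<Rightarrow> real) e0"
proof (rule ccontr)
  let ?s = "lift r :: complex ^ ('n + 'k) \<Rightarrow> real"
  let ?r' = "\<lambda>z. frechet_derivative r (at z)"
  assume contr: "\<not> ?thesis"
  have sm: "iterated_deriv vs r differentiable at x" for vs x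
    using assms by (simp add: is_domain_def smooth_def)
  have der: "(r has_derivative ?r' z) (at z)" for z
    using sm[of "[]"] by (simp add: frechet_derivative_works)
  have cont': "isCont (\<lambda>z. ?r' z v) z" for v z
    using sm[of "[v]" z] by (simp add: differentiable_imp_continuous_within)
  have cont: "isCont r z" for z
    using der has_derivative_continuous by blast
  have "\<exists>z. - inverse (real (Suc i)) \<le> r z \<and> r z < 0 \<and> (\<forall>v. ?r' z v = 0)" for i
  proof -
    have "\<not> small_enough ?s (inverse (real (Suc i)))"
      using contr by blast
    then obtain \<zeta> \<epsilon> where z: "0 < \<epsilon>" "\<epsilon> \<le> inverse (real (Suc i))" "?s \<zeta> = - \<epsilon>" "\<not> grad_nonzero ?s \<zeta>"
      by (auto simp: small_enough_def)
    have sder: "(?s has_derivative (\<lambda>h. ?r' (zpart \<zeta>) (zpart h) + 2 * (wpart \<zeta> \<bullet> wpart h))) (at \<zeta>)"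
    proof -
      have 1: "((\<lambda>\<zeta>. r (zpart \<zeta>)) has_derivative (\<lambda>h. ?r' (zpart \<zeta>) (zpart h))) (at \<zeta>)"
        by (rule has_derivative_compose[OF bounded_linear.has_derivative[OF
              bounded_linear_zpart has_derivative_ident] der])
      have 2: "((\<lambda>\<zeta>. wpart \<zeta> \<bullet> wpart \<zeta>) has_derivative
                 (\<lambda>h. wpart \<zeta> \<bullet> wpart h + wpart h \<bullet> wpart \<zeta>)) (at \<zeta>)"
        by (intro has_derivative_inner bounded_linear.has_derivative[OF bounded_linear_wpart]
              has_derivative_ident)
      show ?thesis
        using has_derivative_add[OF 1 2]
        by (simp add: lift_def[abs_def] power2_norm_eq_inner inner_commute)
    qed
    have zero: "?r' (zpart \<zeta>) (zpart h) + 2 * (wpart \<zeta> \<bullet> wpart h) = 0" for h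
      using not_grad_nonzero[OF sder z(4)] .
    have w0: "wpart \<zeta> = 0"
      using zero[of "join 0 (wpart \<zeta>)"] linear_0[OF has_derivative_linear[OF der]] by simp
    have "?r' (zpart \<zeta>) v = 0" for v
      using zero[of "join v 0"] by simp
    moreover have "r (zpart \<zeta>) = - \<epsilon>"
      using z(3) w0 by (simp add: lift_def)
    ultimately show ?thesis
      using z by (intro exI[of _ "zpart \<zeta>"]) auto
  qed
  then obtain x where x: "\<And>i. - inverse (real (Suc i)) \<le> r (x i)" "\<And>i. r (x i) < 0"
      "\<And>i v. ?r' (x i) v = 0"
    by metis
  have "compact (closure (sublevel r))"
    using assms by (auto simp: is_domain_def compact_closure)
  moreover have "\<forall>i. x i \<in> closure (sublevel r)"
    using x(2) closure_subset by (fastforce simp: sublevel_def)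
  ultimately obtain z \<phi> where z: "z \<in> closure (sublevel r)" "strict_mono \<phi>" "(x \<circ> \<phi>) \<longlonglongrightarrow> z"
    unfolding compact_def by blast
  have "(\<lambda>i. r (x (\<phi> i))) \<longlonglongrightarrow> r z"
    using isCont_tendsto_compose[OF cont z(3)] by (simp add: o_def)
  moreover have "(\<lambda>i. r (x (\<phi> i))) \<longlonglongrightarrow> 0"
  proof (rule real_tendsto_sandwich[OF _ _ _ tendsto_const])
    have "(\<lambda>i. - inverse (real (Suc i))) \<longlonglongrightarrow> - 0"
      by (intro tendsto_minus LIMSEQ_inverse_real_of_nat)
    then show "(\<lambda>i. - inverse (real (Suc (\<phi> i)))) \<longlonglongrightarrow> 0"
      using LIMSEQ_subseq_LIMSEQ[OF _ z(2)] by (fastforce simp: o_def)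
  qed (use x in \<open>auto intro!: always_eventually less_imp_le simp del: of_nat_Suc\<close>)
  ultimately have "r z = 0"
    using LIMSEQ_unique by blast
  then have "z \<in> frontier (sublevel r)"
    using z(1) interior_subset[of "sublevel r"] by (auto simp: frontier_def sublevel_def)
  then obtain D where D: "GDERIV r z :> D" "D \<noteq> 0"
    using assms by (auto simp: is_domain_def grad_nonzero_def)
  have "(\<lambda>i. ?r' (x (\<phi> i)) v) \<longlonglongrightarrow> ?r' z v" for v
    using isCont_tendsto_compose[OF cont' z(3)] by (simp add: o_def)
  then have "?r' z v = 0" for v
    using x(3) by (simp add: LIMSEQ_const_iff)
  moreover have "?r' z = (\<lambda>h. h \<bullet> D)"
    using has_derivative_unique[OF der] D(1) by (simp add: gderiv_def)
  ultimately have "D \<bullet> D = 0"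
    by metis
  with D(2) show False
    by simp
qed

end

(* Write s for the defining function of the lift, S for the level set s = -eps, and consider the thin
   shell -eps < s < -eps + delta.  Since the gradient of s is bounded and bounded away from zero near
   the levels, the volume of the part of the shell near a piece of S is comparable to delta times the
   surface measure of the piece, up to constants uniform in eps: sweeping S along the coordinate axes
   covers the shell, and the shell contains a ball of radius comparable to delta near every point of a
   delta-packing of S.  By Fubini the shell over z is the spherical shell a < |w|^2 < a + delta with
   a = -eps - r z, whose volume is about k v_k a^(k - 1) delta: this is where the weight comes from.
   For functions of z this gives the norm equivalence; for general F one adds that |F|^p and log^+ |F|
   have the sub-mean value property along the circles z, exp(it) w. *)
theory Submission
  imports Defs "HOL-Complex_Analysis.Complex_Analysis" "HOL-Real_Asymp.Real_Asymp"
    "HOL-Computational_Algebra.Fundamental_Theorem_Algebra"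
begin

section \<open>Sub-mean value inequalities on the circle\<close>

text \<open>Surface measure enters only as a Hausdorff outer measure, so the comparison with shell
  volumes rests on covers alone: an efficient cover bounds volume by surface, a packing bounds
  surface by volume. Both lose fixed factors, which the claimed inequalities tolerate, and no
  parametrisation of the level sets occurs. The packing bound controls a set only through a
  neighbourhood of it. It therefore yields an inequality first for compact sets of \<open>z\<close>,
  to which their neighbourhoods shrink, and then for Borel sets by inner regularity. In the other
  direction a shell sees \<open>F\<close> at points off the level; uniform continuity on
  \<open>{lr \<le> - \<epsilon> / 2}\<close> repairs this at the price of a small multiple of the
  surface area, so that area has to be finite. The fibre volume at level \<epsilon> is bounded below
  only by the weight \<open>(- \<epsilon> - r z) ^ (k - 1)\<close>; the full weight is reached by
  Fatou's lemma as \<epsilon> tends to 0. The power and the positive logarithm are handled together,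
  as functions \<Phi> of the modulus for which \<Phi> o exp is convex.\<close>

definition unit_circle :: "real \<Rightarrow> complex" where
  "unit_circle t = exp (2 * of_real pi * \<i> * of_real t)"

lemma norm_unit_circle [simp]: "norm (unit_circle t) = 1"
  by (simp add: unit_circle_def)

lemma continuous_on_unit_circle [continuous_intros]: "continuous_on A unit_circle"
  unfolding unit_circle_def by (intro continuous_intros)

lemma circle_mean_value:
  assumes "h holomorphic_on ball 0 R" "1 < R"
  shows "((\<lambda>t. h (unit_circle t)) has_integral h 0) {0..1}"
proof -
  have "h holomorphic_on cball 0 1"
    using assms by (rule_tac holomorphic_on_subset[OF assms(1)]) auto
  then have "((\<lambda>u. h u / (u - 0)) has_contour_integral (2 * of_real pi * \<i>) * h 0) (circlepath 0 1)"
    by (intro Cauchy_integral_circlepath_simple) auto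
  then have "((\<lambda>t. h (unit_circle t) / unit_circle t * (2 * pi * \<i> * unit_circle t))
      has_integral (2 * of_real pi * \<i>) * h 0) {0..1}"
    unfolding has_contour_integral_def
    by (rule has_integral_eq[rotated])
       (subst vector_derivative_circlepath01, auto simp: unit_circle_def circlepath)
  then have "((\<lambda>t. (2 * of_real pi * \<i>) * h (unit_circle t)) has_integral (2 * of_real pi * \<i>) * h 0) {0..1}"
    by (rule has_integral_eq[rotated]) (simp add: unit_circle_def)
  from has_integral_mult_right[OF this, of "inverse (2 * of_real pi * \<i>)"]
  show ?thesis by (simp add: field_simps)
qed

text \<open>The last clause gives \<Phi> o exp a supporting line at every point, which is convexity
  in the form that Jensen's inequality uses. With monotonicity it makes
  \<open>\<Phi> (norm (h z))\<close> subharmonic for holomorphic \<open>h\<close>; continuity on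
  \<open>{0..}\<close> includes 0 and so covers the zeros of \<open>h\<close>.\<close>

definition submean_gauge :: "(real \<Rightarrow> real) \<Rightarrow> bool" where
  "submean_gauge \<Phi> \<longleftrightarrow> continuous_on {0..} \<Phi> \<and> mono_on {0..} \<Phi> \<and> (\<forall>x\<ge>0. 0 \<le> \<Phi> x) \<and>
     (\<forall>x0. \<exists>c. \<forall>x. \<Phi> (exp x0) + c * (x - x0) \<le> \<Phi> (exp x))"

lemma submean_gauge_powr:
  assumes "0 < p"
  shows "submean_gauge (\<lambda>x. x powr p)"
proof -
  \<comment> \<open>The supporting line is the tangent at \<open>x0\<close> of the convex function
    exp (p x).\<close>
  have "exp x0 powr p + (p * exp (p * x0)) * (x - x0) \<le> exp x powr p" for x0 x
  proof -
    have "exp (p * x0) * (1 + p * (x - x0)) \<le> exp (p * x0) * exp (p * (x - x0))"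
      by (intro mult_left_mono exp_ge_add_one_self) auto
    then show ?thesis by (simp add: powr_def algebra_simps flip: exp_add)
  qed
  then have "\<exists>c. \<forall>x. exp x0 powr p + c * (x - x0) \<le> exp x powr p" for x0
    by blast
  moreover have "continuous_on {0..} (\<lambda>x. x powr p)"
    using assms by (intro continuous_on_powr' continuous_intros) auto
  moreover have "mono_on {0..} (\<lambda>x. x powr p)"
    using assms by (auto intro!: mono_onI powr_mono2)
  ultimately show ?thesis
    unfolding submean_gauge_def by simp
qed

lemma submean_gauge_log_plus: "submean_gauge (\<lambda>x. max 0 (ln x))"
proof -
  have cont: "continuous_on {0..} (\<lambda>x::real. max 0 (ln x))"
  proof -
    \<comment> \<open>True also at \<open>x = 0\<close>, where \<open>ln 0 = 0\<close>; this is what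
      gives continuity up to 0.\<close>
    have "max 0 (ln x) = ln (max 1 x)" if "0 \<le> x" for x :: real
      using that by (cases "x = 0") (auto simp: max_def)
    moreover have "continuous_on {0..} (\<lambda>x::real. ln (max 1 x))"
      by (intro continuous_intros) auto
    ultimately show ?thesis by (subst continuous_on_cong) auto
  qed
  have mono: "mono_on {0..} (\<lambda>x::real. max 0 (ln x))"
  proof (rule mono_onI)
    fix x y :: real assume "x \<in> {0..}" "y \<in> {0..}" "x \<le> y"
    then show "max 0 (ln x) \<le> max 0 (ln y)"
      by (cases "x = 0") (auto simp: max_def)
  qed
  have "\<exists>c. \<forall>x. max 0 x0 + c * (x - x0) \<le> max 0 x" for x0 :: real
    by (rule exI[of _ "if x0 > 0 then 1 else 0"]) (auto simp: max_def)
  with cont mono show ?thesis by (simp add: submean_gauge_def)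
qed

lemma submean_gauge_nonneg: "submean_gauge \<Phi> \<Longrightarrow> 0 \<le> x \<Longrightarrow> 0 \<le> \<Phi> x"
  by (simp add: submean_gauge_def)

lemma submean_gauge_mono: "submean_gauge \<Phi> \<Longrightarrow> 0 \<le> x \<Longrightarrow> x \<le> y \<Longrightarrow> \<Phi> x \<le> \<Phi> y"
  unfolding submean_gauge_def mono_on_def by auto

lemma submean_gauge_continuous:
  assumes "submean_gauge \<Phi>" "continuous_on A f"
  shows "continuous_on A (\<lambda>x. \<Phi> (norm (f x :: 'b::real_normed_vector)))"
  by (rule continuous_on_compose2[where g = \<Phi> and t = "{0..}"])
     (use assms in \<open>auto simp: submean_gauge_def intro!: continuous_intros\<close>)

text \<open>Jensen's inequality: the supporting line of \<Phi> o exp at \<open>Re (L 0)\<close> is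
  integrated over the circle, where the harmonic function \<open>Re L\<close> has mean
  \<open>Re (L 0)\<close>.\<close>

lemma submean_exp:
  assumes \<Phi>: "submean_gauge \<Phi>" and L: "L holomorphic_on ball 0 R" "1 < R"
  shows "\<Phi> (norm (exp (L 0))) \<le> integral {0..1} (\<lambda>t. \<Phi> (norm (exp (L (unit_circle t)))))"
proof -
  obtain c where c: "\<And>x. \<Phi> (exp (Re (L 0))) + c * (x - Re (L 0)) \<le> \<Phi> (exp x)"
    using \<Phi> unfolding submean_gauge_def by metis
  have mean: "((\<lambda>t. L (unit_circle t)) has_integral L 0) {0..1}"
    by (rule circle_mean_value[OF L])
  have "((\<lambda>t. Re (L (unit_circle t))) has_integral Re (L 0)) {0..1}"
    using has_integral_linear[OF mean bounded_linear_Re] by (simp add: o_def)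
  from has_integral_add[OF has_integral_const_real[of "\<Phi> (exp (Re (L 0))) - c * Re (L 0)" 0 1]
      has_integral_mult_right[OF this, of c]]
  have 1: "((\<lambda>t. \<Phi> (exp (Re (L 0))) + c * (Re (L (unit_circle t)) - Re (L 0)))
     has_integral \<Phi> (exp (Re (L 0)))) {0..1}"
    by (simp add: algebra_simps)
  have "continuous_on {0..1} (\<lambda>t. L (unit_circle t))"
    by (rule continuous_on_compose2[OF holomorphic_on_imp_continuous_on[OF L(1)]])
       (use L(2) in \<open>auto intro!: continuous_intros\<close>)
  then have "continuous_on {0..1} (\<lambda>t. \<Phi> (norm (exp (L (unit_circle t)))))"
    by (intro submean_gauge_continuous[OF \<Phi>] continuous_intros)
  then have 2: "(\<lambda>t. \<Phi> (norm (exp (L (unit_circle t))))) integrable_on {0..1}"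
    by (rule integrable_continuous_real)
  show ?thesis
    using has_integral_le[OF 1 integrable_integral[OF 2]] c by simp
qed

text \<open>Zeros on the unit circle itself are possible, so a logarithm is available only for
  \<open>h (\<rho> * z)\<close> with \<open>\<rho> < 1\<close>, on a disc of radius
  \<open>1 / \<rho> > 1\<close>. The inequality passes to \<rho> = 1 because the integral depends
  continuously on \<rho>.\<close>

lemma submean_zero_free:
  assumes \<Phi>: "submean_gauge \<Phi>" and h: "h holomorphic_on UNIV"
    and nz: "\<And>z. norm z < 1 \<Longrightarrow> h z \<noteq> 0"
  shows "\<Phi> (norm (h 0)) \<le> integral {0..1} (\<lambda>t. \<Phi> (norm (h (unit_circle t))))"
proof -
  have le: "\<Phi> (norm (h 0)) \<le> integral {0..1} (\<lambda>t. \<Phi> (norm (h (of_real \<rho> * unit_circle t))))"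
    if \<rho>: "0 < \<rho>" "\<rho> < 1" for \<rho> :: real
  proof -
    have 1: "(\<lambda>z. h (of_real \<rho> * z)) holomorphic_on ball 0 (1 / \<rho>)"
      using holomorphic_on_compose_gen[OF _ h, of "\<lambda>z. of_real \<rho> * z" "ball 0 (1 / \<rho>)"]
      by (auto simp: o_def intro!: holomorphic_intros)
    have 2: "h (of_real \<rho> * z) \<noteq> 0" if "z \<in> ball 0 (1 / \<rho>)" for z
      using that \<rho> by (intro nz) (auto simp: norm_mult field_simps)
    obtain L where L: "L holomorphic_on ball 0 (1 / \<rho>)"
      "\<And>z. z \<in> ball 0 (1 / \<rho>) \<Longrightarrow> h (of_real \<rho> * z) = exp (L z)"
      using contractible_imp_holomorphic_log[OF 1 _ 2] convex_imp_contractible convex_ball by metis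
    have *: "1 < 1 / \<rho>" using \<rho> by simp
    have "integral {0..1} (\<lambda>t. \<Phi> (norm (h (of_real \<rho> * unit_circle t))))
      = integral {0..1} (\<lambda>t. \<Phi> (norm (exp (L (unit_circle t)))))"
      by (intro integral_cong) (use * in \<open>subst L(2), auto\<close>)
    with submean_exp[OF \<Phi> L(1) *] L(2)[of 0] \<rho> show ?thesis by simp
  qed
  have "continuous_on UNIV (\<lambda>\<rho>. integral (cbox 0 1) (\<lambda>t. \<Phi> (norm (h (of_real \<rho> * unit_circle t)))))"
  proof (rule integral_continuous_on_param)
    have "continuous_on (UNIV \<times> cbox 0 1) (\<lambda>x. h (of_real (fst x) * unit_circle (snd x)))"
      by (rule continuous_on_compose2[OF holomorphic_on_imp_continuous_on[OF h]])
         (auto intro!: continuous_intros continuous_on_compose2[OF continuous_on_unit_circle])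
    then show "continuous_on (UNIV \<times> cbox 0 1) (\<lambda>(\<rho>, t). \<Phi> (norm (h (of_real \<rho> * unit_circle t))))"
      unfolding split_beta by (rule submean_gauge_continuous[OF \<Phi>])
  qed
  then have "isCont (\<lambda>\<rho>. integral {0..1} (\<lambda>t. \<Phi> (norm (h (of_real \<rho> * unit_circle t))))) 1"
    by (simp add: continuous_on_eq_continuous_at)
  then have "((\<lambda>\<rho>. integral {0..1} (\<lambda>t. \<Phi> (norm (h (of_real \<rho> * unit_circle t)))))
     \<longlongrightarrow> integral {0..1} (\<lambda>t. \<Phi> (norm (h (of_real 1 * unit_circle t))))) (at_left 1)"
    unfolding isCont_def by (rule tendsto_mono[OF at_le, rotated]) simp
  then have "\<Phi> (norm (h 0)) \<le> integral {0..1} (\<lambda>t. \<Phi> (norm (h (of_real 1 * unit_circle t))))"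
    by (rule tendsto_lowerbound)
       (auto simp: eventually_at_left[of 0 "1::real"] intro!: exI[of _ 0] le)
  then show ?thesis by simp
qed

text \<open>Each factor \<open>z - a\<close> with \<open>|a| < 1\<close> is replaced by \<open>1 - cnj a * z\<close>.\<close>
lemma poly_remove_disc_zeros:
  fixes p :: "complex poly"
  assumes "p \<noteq> 0"
  shows "\<exists>q. (\<forall>z. norm z = 1 \<longrightarrow> norm (poly q z) = norm (poly p z)) \<and>
    (\<forall>z. norm z < 1 \<longrightarrow> poly q z \<noteq> 0) \<and> norm (poly p 0) \<le> norm (poly q 0)"
  using assms
proof (induction "degree p" arbitrary: p)
  case 0
  then obtain c where "p = [:c:]" "c \<noteq> 0" by (metis degree_0_id pCons_0_0)
  then show ?case by (intro exI[of _ p]) auto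
next
  case (Suc n)
  then have "\<not> constant (poly p)" by (simp add: constant_degree)
  then obtain a where "poly p a = 0" using fundamental_theorem_of_algebra by blast
  then obtain p' where p: "p = [:-a, 1:] * p'" using poly_eq_0_iff_dvd dvdE by metis
  with Suc have "p' \<noteq> 0" "n = degree p'" by (auto simp: degree_mult_eq simp del: mult_pCons_left)
  with Suc obtain q where q: "\<And>z. norm z = 1 \<Longrightarrow> norm (poly q z) = norm (poly p' z)"
    "\<And>z. norm z < 1 \<Longrightarrow> poly q z \<noteq> 0" "norm (poly p' 0) \<le> norm (poly q 0)" by blast
  show ?case
  proof (cases "norm a < 1")
    case False
    have "poly ([:-a, 1:] * q) z \<noteq> 0" if "norm z < 1" for z
      using q(2)[OF that] that False by auto
    then show ?thesis using q
      by (intro exI[of _ "[:-a, 1:] * q"]) (auto simp: p norm_mult intro!: mult_left_mono simp del: mult_pCons_left)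
  next
    case True
    have "norm (1 - cnj a * z) = norm (z - a)" if "norm z = 1" for z
    proof -
      have "cnj z * z = 1" using that by (simp add: complex_norm_square[symmetric] mult.commute)
      then have "1 - cnj a * z = z * cnj (z - a)" by (simp add: algebra_simps)
      then show ?thesis using that by (simp only: norm_mult complex_mod_cnj)
    qed
    moreover have "1 - cnj a * z \<noteq> 0" if "norm z < 1" for z
    proof
      assume "1 - cnj a * z = 0"
      then have "norm (cnj a * z) = 1" by (metis eq_iff_diff_eq_0 norm_one)
      moreover have "norm (cnj a * z) < 1"
        using mult_strict_mono[of "norm a" 1 "norm z" 1] True that by (simp add: norm_mult)
      ultimately show False by simp
    qed
    \<comment> \<open>At 0 a factor of modulus \<open>norm a < 1\<close> is traded for one of
      modulus 1, so the value at the centre can only grow.\<close>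
    moreover have "norm a * norm (poly p' 0) \<le> norm (poly q 0)"
      using mult_mono[of "norm a" 1 "norm (poly p' 0)" "norm (poly q 0)"] True q(3) by simp
    moreover have "poly ([:1, - cnj a:] * q) z = (1 - cnj a * z) * poly q z"
      "poly p z = (z - a) * poly p' z" for z
      by (simp_all add: p algebra_simps)
    ultimately show ?thesis using q
      by (intro exI[of _ "[:1, - cnj a:] * q"]) (simp add: norm_mult)
  qed
qed

text \<open>Removing the zeros in the disc keeps the mean over the circle and, \<Phi> being
  monotone, does not lower the left side; the zero-free case then applies.\<close>

lemma submean_poly:
  assumes \<Phi>: "submean_gauge \<Phi>"
  shows "\<Phi> (norm (poly p 0)) \<le> integral {0..1} (\<lambda>t. \<Phi> (norm (poly p (unit_circle t))))"
proof (cases "p = 0")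
  case False
  from poly_remove_disc_zeros[OF this] obtain q where
    q: "\<And>z. norm z = 1 \<Longrightarrow> norm (poly q z) = norm (poly p z)"
    "\<And>z. norm z < 1 \<Longrightarrow> poly q z \<noteq> 0" "norm (poly p 0) \<le> norm (poly q 0)" by blast
  have "\<Phi> (norm (poly p 0)) \<le> \<Phi> (norm (poly q 0))"
    using q(3) by (intro submean_gauge_mono[OF \<Phi>]) auto
  also have "\<dots> \<le> integral {0..1} (\<lambda>t. \<Phi> (norm (poly q (unit_circle t))))"
    using q(2) by (intro submean_zero_free[OF \<Phi>] poly_holomorphic_on holomorphic_intros)
  also have "\<dots> = integral {0..1} (\<lambda>t. \<Phi> (norm (poly p (unit_circle t))))"
    using q(1) by simp
  finally show ?thesis .
qed simp

text \<open>The Taylor polynomials converge on the closed unit disc since \<open>1 < R\<close>, and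
  the sum of all \<open>norm (c i)\<close> bounds them on the circle. Dominated convergence carries
  the inequality over from polynomials, so the zeros of \<open>h\<close> itself never have to be
  factored out.\<close>

theorem submean_holomorphic:
  assumes \<Phi>: "submean_gauge \<Phi>" and h: "h holomorphic_on ball 0 R" "1 < R"
  shows "\<Phi> (norm (h 0)) \<le> integral {0..1} (\<lambda>t. \<Phi> (norm (h (unit_circle t))))"
proof -
  define c where "c n = (deriv ^^ n) h 0 / fact n" for n
  define T where "T n z = (\<Sum>i<n. c i * z ^ i)" for n z
  have sums: "(\<lambda>n. c n * z ^ n) sums h z" if "norm z < R" for z
    using holomorphic_power_series[OF h(1), of z] that by (simp add: c_def)
  have c_summable: "summable (\<lambda>n. norm (c n))"
  proof -
    \<comment> \<open>The point (1 + R) / 2 lies strictly between 1 and \<open>R\<close>;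
      convergence there gives absolute convergence at 1.\<close>
    have "summable (\<lambda>n. c n * of_real ((1 + R) / 2) ^ n)"
      using sums[of "of_real ((1 + R) / 2)"] h(2) by (auto intro: sums_summable simp del: of_real_divide of_real_add)
    from powser_insidea[OF this, of 1] h(2) show ?thesis
      by (simp del: of_real_divide of_real_add)
  qed
  define p where "p n = (\<Sum>i<n. monom (c i) i)" for n
  have p: "poly (p n) z = T n z" for n z
    by (simp add: p_def T_def poly_sum poly_monom)
  have norm_T: "norm (T n z) \<le> (\<Sum>i. norm (c i))" if "norm z = 1" for n z
  proof -
    have "norm (T n z) \<le> (\<Sum>i<n. norm (c i))"
      unfolding T_def by (rule order_trans[OF norm_sum]) (simp add: norm_mult norm_power that)
    also have "\<dots> \<le> (\<Sum>i. norm (c i))"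
      by (rule sum_le_suminf[OF c_summable]) auto
    finally show ?thesis .
  qed
  have lim: "(\<lambda>n. \<Phi> (norm (T n z))) \<longlonglongrightarrow> \<Phi> (norm (h z))" if "norm z < R" for z
  proof -
    have "(\<lambda>n. norm (T n z)) \<longlonglongrightarrow> norm (h z)"
      using sums[OF that] unfolding sums_def T_def by (rule tendsto_norm)
    then show ?thesis using \<Phi>
      by (intro continuous_on_tendsto_compose[of "{0..}" \<Phi>]) (auto simp: submean_gauge_def)
  qed
  have "(\<lambda>n. integral {0..1} (\<lambda>t. \<Phi> (norm (T n (unit_circle t)))))
    \<longlonglongrightarrow> integral {0..1} (\<lambda>t. \<Phi> (norm (h (unit_circle t))))"
  proof (rule dominated_convergence)
    fix n
    have "continuous_on {0..1} (\<lambda>t. \<Phi> (norm (T n (unit_circle t))))"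
      unfolding T_def by (intro submean_gauge_continuous[OF \<Phi>] continuous_intros)
    then show "(\<lambda>t. \<Phi> (norm (T n (unit_circle t)))) integrable_on {0..1}"
      by (rule integrable_continuous_real)
    show "(\<lambda>t::real. \<Phi> (\<Sum>i. norm (c i))) integrable_on {0..1}"
      by (rule integrable_const_ivl)
    show "norm (\<Phi> (norm (T n (unit_circle t)))) \<le> \<Phi> (\<Sum>i. norm (c i))" for t
      using submean_gauge_mono[OF \<Phi> _ norm_T[of "unit_circle t" n]] submean_gauge_nonneg[OF \<Phi>] by simp
    show "(\<lambda>n. \<Phi> (norm (T n (unit_circle t)))) \<longlonglongrightarrow> \<Phi> (norm (h (unit_circle t)))" for t
      using lim h(2) by simp
  qed
  moreover have "(\<lambda>n. \<Phi> (norm (T n 0))) \<longlonglongrightarrow> \<Phi> (norm (h 0))"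
    using lim h(2) by simp
  ultimately show ?thesis
    using submean_poly[OF \<Phi>, of "p _"] by (intro LIMSEQ_le) (auto simp: p)
qed

section \<open>Hausdorff measure\<close>

lemma tendsto_suminf_tail_ennreal:
  fixes g :: "nat \<Rightarrow> ennreal"
  assumes "(\<Sum>i. g i) < \<infinity>"
  shows "(\<lambda>n. \<Sum>i. g (i + n)) \<longlonglongrightarrow> 0"
proof -
  have fin: "g i < \<infinity>" for i
    using assms ennreal_suminf_lessD by blast
  define h where "h i = enn2real (g i)" for i
  have g: "g i = ennreal (h i)" for i
    using fin by (simp add: h_def less_top)
  have h0: "0 \<le> h i" for i by (simp add: h_def)
  have h: "summable h"
    using assms h0 by (intro summable_suminf_not_top) (auto simp: g less_top)
  have "(\<lambda>n. suminf h - (\<Sum>i<n. h i)) \<longlonglongrightarrow> suminf h - suminf h"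
    using h by (intro tendsto_intros summable_LIMSEQ)
  then have "(\<lambda>n. \<Sum>i. h (i + n)) \<longlonglongrightarrow> 0"
    by (simp add: suminf_minus_initial_segment[OF h])
  then have "(\<lambda>n. ennreal (\<Sum>i. h (i + n))) \<longlonglongrightarrow> 0"
    using tendsto_ennrealI by force
  moreover have "ennreal (\<Sum>i. h (i + n)) = (\<Sum>i. g (i + n))" for n
    using h h0 by (simp add: g suminf_ennreal2 summable_iff_shift)
  ultimately show ?thesis by simp
qed

locale metric_outer_measure =
  fixes f :: "'a::metric_space set \<Rightarrow> ennreal"
  assumes empty: "f {} = 0"
    and mono: "A \<subseteq> B \<Longrightarrow> f A \<le> f B"
    and csub: "f (\<Union>i. E i) \<le> (\<Sum>i::nat. f (E i))"
    and separated: "0 < c \<Longrightarrow> (\<And>x y. x \<in> A \<Longrightarrow> y \<in> B \<Longrightarrow> c \<le> dist x y) \<Longrightarrow> f A + f B \<le> f (A \<union> B)"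
begin

lemma sub: "f (A \<union> B) \<le> f A + f B"
proof -
  define E where "E = (\<lambda>i::nat. if i = 0 then A else if i = 1 then B else {})"
  have "(\<Union>i. E i) = A \<union> B"
    by (auto simp: E_def split: if_splits)
  moreover have "(\<Sum>i. f (E i)) = (\<Sum>i\<in>{0,1}. f (E i))"
    by (rule suminf_finite) (auto simp: E_def empty)
  ultimately show ?thesis using csub[of E] by (simp add: E_def)
qed

text \<open>The part \<open>A n\<close> of \<open>X\<close> at distance at least 1 / (n + 1) from
  \<open>F\<close> is separated from \<open>X \<inter> F\<close>, so the inequality holds with
  \<open>A n\<close> in place of \<open>X - F\<close>. What is missing is a union of layers
  \<open>R i\<close>. Layers of equal parity are separated from each other, so their values sum to
  at most \<open>f X\<close>, and the tails of these two series tend to 0.\<close>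

lemma split_closed:
  assumes F: "closed F"
  shows "f (X \<inter> F) + f (X - F) \<le> f X"
proof (cases "F = {} \<or> f X = \<infinity>")
  case True
  then show ?thesis by (auto simp: empty)
next
  case False
  define A where "A n = {x \<in> X. infdist x F \<ge> 1 / (real n + 1)}" for n
  define R where "R n = A (Suc n) - A n" for n
  have sep: "f U + f V \<le> f (U \<union> V)"
    if U: "\<And>x. x \<in> U \<Longrightarrow> infdist x F \<ge> a" and V: "\<And>x. x \<in> V \<Longrightarrow> infdist x F \<le> b" and ab: "b < a"
    for U V a b
  proof (rule separated[of "a - b"])
    fix x y assume "x \<in> U" "y \<in> V"
    then show "a - b \<le> dist x y"
      using U[of x] V[of y] infdist_triangle[of x F y] by linarith
  qed (use ab in simp)
  have A_mono: "A i \<subseteq> A j" if "i \<le> j" for i j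
  proof -
    have "1 / (real j + 1) \<le> 1 / (real i + 1)" using that by (simp add: frac_le)
    then have "1 / (real j + 1) \<le> infdist x F" if "1 / (real i + 1) \<le> infdist x F" for x
      using that by linarith
    then show ?thesis by (auto simp: A_def)
  qed
  have A_R: "(\<Union>i<n. R (2 * i + k)) \<subseteq> A (2 * n + k - 1)" for n k
  proof -
    have "R (2 * i + k) \<subseteq> A (2 * n + k - 1)" if "i < n" for i
    proof -
      have "Suc (2 * i + k) \<le> 2 * n + k - 1" using that by linarith
      then show ?thesis using A_mono unfolding R_def by blast
    qed
    then show ?thesis by blast
  qed
  \<comment> \<open>The earlier layers of the same parity lie in \<open>A (2 * n + k - 1)\<close>,
    at distance at least 1 / (2n + k) from \<open>F\<close>, while the new layer is closer than 1 /
    (2n + k + 1); the skipped layer is the gap. The case \<open>n = 0\<close>, where the subtraction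
    may truncate, has no earlier layers.\<close>
  have part: "(\<Sum>i<n. f (R (2 * i + k))) \<le> f (\<Union>i<n. R (2 * i + k))" for n k
  proof (induction n)
    case (Suc n)
    show ?case
    proof (cases "n = 0")
      case False
      have "f (\<Union>i<n. R (2 * i + k)) + f (R (2 * n + k)) \<le> f ((\<Union>i<n. R (2 * i + k)) \<union> R (2 * n + k))"
      proof (rule sep)
        fix x assume "x \<in> (\<Union>i<n. R (2 * i + k))"
        then have "x \<in> A (2 * n + k - 1)" using A_R by blast
        then show "infdist x F \<ge> 1 / real (2 * n + k)"
          using False by (simp add: A_def of_nat_diff)
      next
        fix x assume "x \<in> R (2 * n + k)"
        then show "infdist x F \<le> 1 / real (2 * n + k + 1)"
          by (auto simp: R_def A_def add_ac)
      qed (use False in \<open>simp add: field_simps\<close>)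
      also have "(\<Union>i<n. R (2 * i + k)) \<union> R (2 * n + k) = (\<Union>i<Suc n. R (2 * i + k))"
        by (auto simp: less_Suc_eq)
      finally show ?thesis using Suc by (auto intro: order_trans add_right_mono)
    qed (simp add: lessThan_Suc)
  qed (simp add: empty)
  have fin: "(\<Sum>i. f (R (2 * i + k))) < \<infinity>" for k
  proof -
    have "(\<Sum>i. f (R (2 * i + k))) \<le> f X"
    proof (rule suminf_le_const)
      fix n
      have "(\<Union>i<n. R (2 * i + k)) \<subseteq> X" by (auto simp: R_def A_def)
      then show "(\<Sum>i<n. f (R (2 * i + k))) \<le> f X"
        using part mono order_trans by blast
    qed simp
    with False show ?thesis by (auto simp: less_top intro: le_less_trans)
  qed
  define T where "T k n = (\<Sum>i. f (R (2 * (i + n) + k)))" for k n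
  have T: "T k \<longlonglongrightarrow> 0" for k
    using tendsto_suminf_tail_ennreal[OF fin[of k]] by (simp add: T_def[abs_def])
  have "f (X \<inter> F) + f (X - F) \<le> f X + T 0 n + T 1 n" for n
  proof -
    have "X - F \<subseteq> A (2 * n) \<union> ((\<Union>i. R (2 * (i + n) + 0)) \<union> (\<Union>i. R (2 * (i + n) + 1)))"
    proof
      fix x assume x: "x \<in> X - F"
      then have "0 < infdist x F"
        using F False in_closed_iff_infdist_zero[of F x] infdist_nonneg[of x F] by force
      then obtain m where "inverse (real (Suc m)) < infdist x F"
        using reals_Archimedean by blast
      then have "x \<in> A m" using x by (simp add: A_def inverse_eq_divide add.commute)
      define m0 where "m0 = (LEAST m. x \<in> A m)"
      have m0: "x \<in> A m0" "\<And>j. j < m0 \<Longrightarrow> x \<notin> A j"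
        unfolding m0_def using \<open>x \<in> A m\<close> by (auto intro: LeastI dest: not_less_Least)
      show "x \<in> A (2 * n) \<union> ((\<Union>i. R (2 * (i + n) + 0)) \<union> (\<Union>i. R (2 * (i + n) + 1)))"
      proof (cases "m0 \<le> 2 * n")
        case True
        then show ?thesis using m0 A_mono by blast
      next
        case False
        then have R: "x \<in> R (m0 - 1)" using m0 by (auto simp: R_def)
        define i where "i = (m0 - 1) div 2 - n"
        have "m0 - 1 = 2 * (i + n) + 0 \<or> m0 - 1 = 2 * (i + n) + 1"
          using False by (auto simp: i_def)
        then show ?thesis using R by (metis UN_I UNIV_I UnCI)
      qed
    qed
    then have "f (X - F) \<le> f (A (2 * n) \<union> ((\<Union>i. R (2 * (i + n) + 0)) \<union> (\<Union>i. R (2 * (i + n) + 1))))"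
      by (rule mono)
    also have "\<dots> \<le> f (A (2 * n)) + f ((\<Union>i. R (2 * (i + n) + 0)) \<union> (\<Union>i. R (2 * (i + n) + 1)))"
      by (rule sub)
    also have "\<dots> \<le> f (A (2 * n)) + (f (\<Union>i. R (2 * (i + n) + 0)) + f (\<Union>i. R (2 * (i + n) + 1)))"
      by (intro add_left_mono sub)
    also have "\<dots> \<le> f (A (2 * n)) + (T 0 n + T 1 n)"
      unfolding T_def by (intro add_mono csub order_refl)
    finally have 1: "f (X - F) \<le> f (A (2 * n)) + (T 0 n + T 1 n)" .
    have "f (A (2 * n)) + f (X \<inter> F) \<le> f (A (2 * n) \<union> (X \<inter> F))"
      by (rule sep[of _ "1 / (real (2 * n) + 1)" _ 0]) (auto simp: A_def)
    also have "\<dots> \<le> f X" by (rule mono) (auto simp: A_def)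
    finally have 2: "f (A (2 * n)) + f (X \<inter> F) \<le> f X" .
    have "f (X \<inter> F) + f (X - F) \<le> f (X \<inter> F) + (f (A (2 * n)) + (T 0 n + T 1 n))"
      using 1 by (rule add_left_mono)
    also have "\<dots> = (f (A (2 * n)) + f (X \<inter> F)) + (T 0 n + T 1 n)" by (simp add: ac_simps)
    also have "\<dots> \<le> f X + (T 0 n + T 1 n)" using 2 by (rule add_right_mono)
    finally show ?thesis by (simp add: ac_simps)
  qed
  moreover have "(\<lambda>n. f X + T 0 n + T 1 n) \<longlonglongrightarrow> f X + 0 + 0"
    by (intro tendsto_intros T)
  ultimately show ?thesis
    using LIMSEQ_le_const by fastforce
qed

text \<open>The sets that split every \<open>X\<close> additively form a sigma-algebra on which
  \<open>f\<close> is a measure; it contains the closed sets by \<open>split_closed\<close>, hence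
  all Borel sets.\<close>

lemma measure_space_borel: "measure_space UNIV (sets borel) f"
proof -
  interpret P: sigma_algebra UNIV "UNIV :: 'a set set"
    using sigma_algebra_Pow[of UNIV] by simp
  have oms: "outer_measure_space UNIV f"
    using empty mono csub
    by (auto simp: outer_measure_space_def positive_def increasing_def countably_subadditive_def)
  let ?L = "lambda_system UNIV UNIV f"
  have L: "measure_space UNIV ?L f"
    by (rule P.caratheodory_lemma[OF oms])
  have "Collect closed \<subseteq> ?L"
  proof
    fix F :: "'a set" assume "F \<in> Collect closed"
    moreover have "f X \<le> f (X \<inter> F) + f (X - F)" for X
      using sub[of "X \<inter> F" "X - F"] by (simp add: Int_Diff_Un)
    ultimately show "F \<in> ?L"
      unfolding P.lambda_system_eq using split_closed by (auto intro: antisym)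
  qed
  moreover have "sigma_algebra UNIV ?L"
    using L by (simp add: measure_space_def)
  ultimately have "sets borel \<subseteq> ?L"
    unfolding borel_eq_closed by (simp add: sigma_algebra.sigma_sets_subset)
  with L show ?thesis
    by (auto simp: measure_space_def positive_def countably_additive_def
          sets.sigma_algebra_axioms[of borel, simplified] dest: subset_trans)
qed

end

section \<open>Hausdorff measure as a metric outer measure\<close>

lemma hausdorff_pre_leI:
  assumes "A \<subseteq> (\<Union>i. E i)" "\<And>i. bounded (E i)" "\<And>i. diameter (E i) \<le> \<delta>"
  shows "hausdorff_pre d \<delta> A \<le> (\<Sum>i. ennreal (unit_ball_vol (real d) * (diameter (E i) / 2) ^ d))"
  unfolding hausdorff_pre_def by (rule INF_lower2[of E]) (use assms in auto)

lemma hausdorff_pre_antimono: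
  assumes "\<delta> \<le> \<delta>'"
  shows "hausdorff_pre d \<delta>' A \<le> hausdorff_pre d \<delta> A"
  unfolding hausdorff_pre_def
  by (rule INF_superset_mono) (use assms in \<open>auto intro: order_trans\<close>)

lemma hausdorff_pre_mono:
  assumes "A \<subseteq> B"
  shows "hausdorff_pre d \<delta> A \<le> hausdorff_pre d \<delta> B"
  unfolding hausdorff_pre_def
  by (rule INF_superset_mono) (use assms in auto)

lemma hausdorff_pre_le_outer: "0 < \<delta> \<Longrightarrow> hausdorff_pre d \<delta> A \<le> hausdorff_outer d A"
  unfolding hausdorff_outer_def by (intro SUP_upper) auto

lemma hausdorff_pre_cover:
  assumes "hausdorff_pre d \<delta> A < x"
  obtains E where "A \<subseteq> (\<Union>i. E i)" "\<And>i. bounded (E i)" "\<And>i. diameter (E i) \<le> \<delta>"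
    "(\<Sum>i. ennreal (unit_ball_vol (real d) * (diameter (E i) / 2) ^ d)) < x"
  using assms unfolding hausdorff_pre_def INF_less_iff by auto

lemma hausdorff_pre_csub:
  "hausdorff_pre d \<delta> (\<Union>n. A n) \<le> (\<Sum>n::nat. hausdorff_pre d \<delta> (A n))"
proof (cases "(\<Sum>n. hausdorff_pre d \<delta> (A n)) = \<infinity>")
  case False
  let ?w = "\<lambda>E. ennreal (unit_ball_vol (real d) * (diameter E / 2) ^ d)"
  have fin: "hausdorff_pre d \<delta> (A n) < \<infinity>" for n
    using False ennreal_suminf_lessD[of "\<lambda>n. hausdorff_pre d \<delta> (A n)" \<infinity> n]
    by (simp add: less_top)
  show ?thesis
  proof (rule ennreal_le_epsilon)
    fix e :: real assume e: "0 < e"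
    have "\<exists>E. A n \<subseteq> (\<Union>i. E i) \<and> (\<forall>i. bounded (E i) \<and> diameter (E i) \<le> \<delta>) \<and>
      (\<Sum>i. ?w (E i)) \<le> hausdorff_pre d \<delta> (A n) + ennreal (e * (1/2) ^ Suc n)" for n
    proof -
      have "hausdorff_pre d \<delta> (A n) < hausdorff_pre d \<delta> (A n) + ennreal (e * (1/2) ^ Suc n)"
        using fin[of n] e by (simp add: ennreal_add_left_cancel_less[of _ 0, simplified])
      from hausdorff_pre_cover[OF this] show ?thesis by (metis less_imp_le)
    qed
    then obtain E where E: "\<And>n. A n \<subseteq> (\<Union>i. E n i)" "\<And>n i. bounded (E n i)" "\<And>n i. diameter (E n i) \<le> \<delta>"
      "\<And>n. (\<Sum>i. ?w (E n i)) \<le> hausdorff_pre d \<delta> (A n) + ennreal (e * (1/2) ^ Suc n)"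
      by metis
    define G where "G k = (case prod_decode k of (n, i) \<Rightarrow> E n i)" for k
    have "hausdorff_pre d \<delta> (\<Union>n. A n) \<le> (\<Sum>k. ?w (G k))"
    proof (rule hausdorff_pre_leI)
      show "(\<Union>n. A n) \<subseteq> (\<Union>k. G k)"
      proof
        fix x assume "x \<in> (\<Union>n. A n)"
        then obtain n i where "x \<in> E n i" using E(1) by blast
        then have "x \<in> G (prod_encode (n, i))" by (simp add: G_def)
        then show "x \<in> (\<Union>k. G k)" by blast
      qed
    qed (auto simp: G_def E split: prod.splits)
    also have "(\<Sum>k. ?w (G k)) = (\<Sum>n. \<Sum>i. ?w (E n i))"
      unfolding G_def
      by (subst suminf_ennreal_2dimen[where f = "\<lambda>(n, i). ?w (E n i)", symmetric])
         (auto simp: split_beta)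
    also have "\<dots> \<le> (\<Sum>n. hausdorff_pre d \<delta> (A n) + ennreal (e * (1/2) ^ Suc n))"
      by (intro suminf_le E summableI)
    also have "\<dots> = (\<Sum>n. hausdorff_pre d \<delta> (A n)) + (\<Sum>n. ennreal (e * (1/2) ^ Suc n))"
      by (intro suminf_add[symmetric] summableI)
    also have "(\<Sum>n. ennreal (e * (1/2) ^ Suc n)) = ennreal e"
      using e sums_mult[OF power_half_series, of e]
      by (subst suminf_ennreal2) (auto simp: sums_iff)
    finally show "hausdorff_pre d \<delta> (\<Union>n. A n) \<le> (\<Sum>n. hausdorff_pre d \<delta> (A n)) + ennreal e" .
  qed
qed auto

text \<open>A set of diameter at most \<open>\<delta> < c\<close> cannot meet both \<open>A\<close>
  and \<open>B\<close>, so every cover of the union splits into a cover of \<open>A\<close> and one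
  of \<open>B\<close> that share no member.\<close>

lemma hausdorff_pre_separated:
  assumes d: "0 < d" and c: "\<delta> < c"
    and AB: "\<And>x y. x \<in> A \<Longrightarrow> y \<in> B \<Longrightarrow> c \<le> dist x y"
  shows "hausdorff_pre d \<delta> A + hausdorff_pre d \<delta> B \<le> hausdorff_pre d \<delta> (A \<union> B)"
proof -
  let ?w = "\<lambda>E. ennreal (unit_ball_vol (real d) * (diameter E / 2) ^ d)"
  have "hausdorff_pre d \<delta> A + hausdorff_pre d \<delta> B \<le> (\<Sum>i. ?w (E i))"
    if E: "A \<union> B \<subseteq> (\<Union>i. E i)" "\<And>i. bounded (E i)" "\<And>i. diameter (E i) \<le> \<delta>" for E :: "nat \<Rightarrow> 'a set"
  proof (cases "0 \<le> \<delta>")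
    case False
    then show ?thesis
      using E(3)[of 0] diameter_ge_0[OF E(2)[of 0]] by linarith
  next
    case True
    \<comment> \<open>Discarded members become empty rather than being reindexed; they weigh 0
      because \<open>0 < d\<close>, whereas \<open>0 ^ 0\<close> would be 1.\<close>
    define EA where "EA i = (if E i \<inter> A = {} then {} else E i)" for i
    define EB where "EB i = (if E i \<inter> B = {} then {} else E i)" for i
    have disj: "E i \<inter> A = {} \<or> E i \<inter> B = {}" for i
    proof (rule ccontr)
      assume "\<not> ?thesis"
      then obtain x y where "x \<in> E i" "x \<in> A" "y \<in> E i" "y \<in> B" by auto
      then have "c \<le> diameter (E i)"
        using AB[of x y] diameter_bounded_bound[OF E(2)[of i], of x y] by linarith
      with E(3)[of i] c show False by linarith
    qed
    have "hausdorff_pre d \<delta> A \<le> (\<Sum>i. ?w (EA i))"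
      using E True by (intro hausdorff_pre_leI) (auto simp: EA_def split: if_splits, blast)
    moreover have "hausdorff_pre d \<delta> B \<le> (\<Sum>i. ?w (EB i))"
      using E True by (intro hausdorff_pre_leI) (auto simp: EB_def split: if_splits, blast)
    ultimately have "hausdorff_pre d \<delta> A + hausdorff_pre d \<delta> B \<le> (\<Sum>i. ?w (EA i)) + (\<Sum>i. ?w (EB i))"
      by (rule add_mono)
    also have "\<dots> = (\<Sum>i. ?w (EA i) + ?w (EB i))"
      by (intro suminf_add summableI)
    also have "\<dots> \<le> (\<Sum>i. ?w (E i))"
      using disj by (intro suminf_le summableI) (auto simp: EA_def EB_def zero_power[OF d])
    finally show ?thesis .
  qed
  then show ?thesis
    unfolding hausdorff_pre_def[of d \<delta> "A \<union> B"] by (intro INF_greatest) auto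
qed

lemma metric_outer_measure_hausdorff:
  assumes d: "0 < d"
  shows "metric_outer_measure (hausdorff_outer d :: 'a::euclidean_space set \<Rightarrow> ennreal)"
proof
  have "hausdorff_pre d \<delta> ({}::'a set) = 0" if "0 < \<delta>" for \<delta>
    using hausdorff_pre_leI[of "{}" "\<lambda>_. {}" \<delta> d] that by (simp add: zero_power[OF d])
  then show "hausdorff_outer d ({}::'a set) = 0"
    unfolding hausdorff_outer_def by (intro antisym SUP_least) auto
next
  fix A B :: "'a set" assume "A \<subseteq> B"
  then show "hausdorff_outer d A \<le> hausdorff_outer d B"
    unfolding hausdorff_outer_def by (intro SUP_subset_mono order_refl hausdorff_pre_mono)
next
  fix E :: "nat \<Rightarrow> 'a set"
  have "hausdorff_pre d \<delta> (\<Union>i. E i) \<le> (\<Sum>i. hausdorff_outer d (E i))" if "0 < \<delta>" for \<delta>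
    by (rule order_trans[OF hausdorff_pre_csub]) (intro suminf_le summableI hausdorff_pre_le_outer that)
  then show "hausdorff_outer d (\<Union>i. E i) \<le> (\<Sum>i. hausdorff_outer d (E i))"
    unfolding hausdorff_outer_def[of d "\<Union>i. E i"] by (intro SUP_least) auto
next
  fix A B :: "'a set" and c :: real
  assume c: "0 < c" and AB: "\<And>x y. x \<in> A \<Longrightarrow> y \<in> B \<Longrightarrow> c \<le> dist x y"
  \<comment> \<open>The two suprema are taken one after the other, so the mesh sizes for
    \<open>A\<close> and \<open>B\<close> are independent here; a common size below both of them and
    below \<open>c\<close> serves.\<close>
  have *: "hausdorff_pre d \<delta>1 A + hausdorff_pre d \<delta>2 B \<le> hausdorff_outer d (A \<union> B)"
    if "0 < \<delta>1" "0 < \<delta>2" for \<delta>1 \<delta>2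
  proof -
    define \<delta> where "\<delta> = min (min \<delta>1 \<delta>2) (c / 2)"
    have \<delta>: "0 < \<delta>" "\<delta> \<le> \<delta>1" "\<delta> \<le> \<delta>2" "\<delta> < c" using that c by (auto simp: \<delta>_def)
    have "hausdorff_pre d \<delta>1 A + hausdorff_pre d \<delta>2 B \<le> hausdorff_pre d \<delta> A + hausdorff_pre d \<delta> B"
      using \<delta> by (intro add_mono hausdorff_pre_antimono)
    also have "\<dots> \<le> hausdorff_pre d \<delta> (A \<union> B)"
      by (rule hausdorff_pre_separated[OF d \<delta>(4) AB])
    also have "\<dots> \<le> hausdorff_outer d (A \<union> B)"
      using \<delta> by (intro hausdorff_pre_le_outer)
    finally show ?thesis .
  qed
  have ne: "{0::real<..} \<noteq> {}" by (simp add: gt_ex)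
  have "hausdorff_outer d A + hausdorff_pre d \<delta>2 B \<le> hausdorff_outer d (A \<union> B)" if "0 < \<delta>2" for \<delta>2
    unfolding hausdorff_outer_def[of d A] ennreal_SUP_add_left[OF ne, symmetric]
    by (rule SUP_least) (use * that in simp)
  then show "hausdorff_outer d A + hausdorff_outer d B \<le> hausdorff_outer d (A \<union> B)"
    unfolding hausdorff_outer_def[of d B] ennreal_SUP_add_right[OF ne]
    by (intro SUP_least) simp
qed

lemma sets_surface_measure [simp, measurable_cong]: "sets (surface_measure :: 'a::euclidean_space measure) = sets borel"
  by (simp add: surface_measure_def hausdorff_measure_def sets.sigma_sets_eq[of borel, simplified])

lemma space_surface_measure [simp]: "space surface_measure = UNIV"
  by (simp add: surface_measure_def hausdorff_measure_def)

lemma emeasure_surface_measure: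
  fixes A :: "'a::euclidean_space set"
  assumes "2 \<le> DIM('a)" "A \<in> sets borel"
  shows "emeasure surface_measure A = hausdorff_outer (DIM('a) - 1) A"
proof -
  interpret metric_outer_measure "hausdorff_outer (DIM('a) - 1) :: 'a set \<Rightarrow> ennreal"
    using assms(1) by (intro metric_outer_measure_hausdorff) simp
  show ?thesis
    unfolding surface_measure_def hausdorff_measure_def
    using measure_space_borel assms(2)
    by (intro emeasure_measure_of_sigma) (auto simp: measure_space_def sets.sigma_sets_eq)
qed

text \<open>A set of diameter \<open>D\<close> swept along a segment of length \<open>2 * \<tau> \<ge> 2 * D\<close> parallel to a
  coordinate axis stays in a box of volume \<open>4 * \<tau> * (2 * D) ^ (n - 1)\<close>.\<close>
lemma sweep_bounded_set:
  fixes E :: "'a::euclidean_space set"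
  assumes b: "b \<in> Basis" and E: "bounded E" "diameter E \<le> \<tau>" and "0 < \<tau>" and dim: "2 \<le> DIM('a)"
  shows "\<exists>W\<in>sets borel. {y + t *\<^sub>R b |y t. y \<in> E \<and> \<bar>t\<bar> \<le> \<tau>} \<subseteq> W \<and>
    emeasure lborel W \<le> ennreal (4 * \<tau> * (2 * diameter E) ^ (DIM('a) - 1))"
proof (cases "E = {}")
  case False
  then obtain y0 where y0: "y0 \<in> E" by auto
  define D where "D = diameter E"
  have D: "0 \<le> D" using E(1) by (simp add: D_def diameter_ge_0)
  \<comment> \<open>Half-widths of the box: along \<open>b\<close> the diameter, at most \<tau>, is
    added to the sweep length \<tau>; in the other directions the diameter alone counts.\<close>
  define q where "q = (\<Sum>c\<in>Basis. (if c = b then 2 * \<tau> else D) *\<^sub>R c)"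
  have q: "q \<bullet> c = (if c = b then 2 * \<tau> else D)" if "c \<in> Basis" for c
    using that by (simp add: q_def)
  let ?W = "cbox (y0 - q) (y0 + q)"
  have "y + t *\<^sub>R b \<in> ?W" if y: "y \<in> E" and t: "\<bar>t\<bar> \<le> \<tau>" for y t
  proof -
    have "\<bar>(y - y0) \<bullet> c\<bar> \<le> D" if "c \<in> Basis" for c
      using Basis_le_norm[OF that, of "y - y0"] diameter_bounded_bound[OF E(1) y y0]
      by (simp add: D_def dist_norm)
    then have "\<bar>(y - y0) \<bullet> c + t * (b \<bullet> c)\<bar> \<le> q \<bullet> c" if "c \<in> Basis" for c
      using that b t E(2) by (fastforce simp: q inner_Basis D_def)
    then show ?thesis
      by (auto simp: mem_box inner_simps abs_le_iff) (smt (verit) inner_commute)+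
  qed
  moreover have "emeasure lborel ?W = ennreal (\<Prod>c\<in>Basis. (2 *\<^sub>R q) \<bullet> c)"
    using D \<open>0 < \<tau>\<close> by (subst emeasure_lborel_cbox) (auto simp: q inner_simps algebra_simps intro!: prod.cong arg_cong[where f = ennreal])
  moreover have "(\<Prod>c\<in>Basis. (2 *\<^sub>R q) \<bullet> c) = 4 * \<tau> * (2 * D) ^ (DIM('a) - 1)"
    by (subst prod.remove[OF _ b]) (auto simp: q b)
  ultimately show ?thesis by (intro bexI[of _ ?W]) (auto simp: D_def)
qed (auto intro!: bexI[of _ "{}"])

text \<open>With n the real dimension, the quotient of the box volume
  \<open>4 * \<tau> * (2 * D) ^ (n - 1)\<close> by \<tau> times the Hausdorff weight
  \<open>unit_ball_vol (n - 1) * (D / 2) ^ (n - 1)\<close>.\<close>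

definition sweep_const :: "'a::euclidean_space itself \<Rightarrow> real" where
  "sweep_const _ = 4 ^ DIM('a) / unit_ball_vol (real (DIM('a) - 1))"

lemma sweep_const_pos: "0 < sweep_const TYPE('a::euclidean_space)"
  by (simp add: sweep_const_def unit_ball_vol_pos)

text \<open>The set \<open>A\<close> is arbitrary and the swept set need not be Borel, hence the
  superset \<open>W\<close>. It comes from covers of \<open>A\<close> by sets of diameter at most
  \<tau> whose total weight exceeds the Hausdorff measure by less than \<open>1 / Suc n\<close>;
  each member is swept into a box.\<close>

lemma sweep_set:
  fixes A :: "'a::euclidean_space set"
  assumes b: "b \<in> Basis" and "0 < \<tau>" and dim: "2 \<le> DIM('a)"
  shows "\<exists>W\<in>sets borel. {y + t *\<^sub>R b |y t. y \<in> A \<and> \<bar>t\<bar> \<le> \<tau>} \<subseteq> W \<and>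
    emeasure lborel W \<le> ennreal (sweep_const TYPE('a) * \<tau>) * hausdorff_outer (DIM('a) - 1) A"
    (is "\<exists>W\<in>_. ?T A \<subseteq> W \<and> _ \<le> ?C * ?H")
proof (cases "?H = \<infinity>")
  case True
  then show ?thesis
    using sweep_const_pos[where 'a = 'a] \<open>0 < \<tau>\<close> by (intro bexI[of _ UNIV]) (auto simp: ennreal_mult_top)
next
  case False
  define d where "d = DIM('a) - 1"
  have d: "DIM('a) = Suc d" using dim by (simp add: d_def)
  have C: "4 * \<tau> * (2 * D) ^ d = (sweep_const TYPE('a) * \<tau>) * (unit_ball_vol (real d) * (D / 2) ^ d)" for D
  proof -
    have "2 ^ d * 2 ^ d = (4::real) ^ d" by (simp flip: power_mult_distrib)
    moreover have "unit_ball_vol (real d) \<noteq> 0" by (metis less_irrefl of_nat_0_le_iff unit_ball_vol_pos)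
    ultimately show ?thesis
      by (simp add: sweep_const_def d field_simps)
  qed
  have *: "\<exists>W\<in>sets borel. ?T A \<subseteq> W \<and> emeasure lborel W \<le> ?C * (?H + ennreal (1 / Suc n))" for n
  proof -
    have "hausdorff_pre d \<tau> A \<le> ?H"
      unfolding d_def by (rule hausdorff_pre_le_outer[OF \<open>0 < \<tau>\<close>])
    also have "\<dots> < ?H + ennreal (1 / Suc n)"
      using False by (simp add: ennreal_add_left_cancel_less[of _ 0, simplified] less_top)
    finally have "hausdorff_pre d \<tau> A < ?H + ennreal (1 / Suc n)" .
    from hausdorff_pre_cover[OF this] obtain E where E: "A \<subseteq> (\<Union>i. E i)" "\<And>i. bounded (E i)" "\<And>i. diameter (E i) \<le> \<tau>"
      "(\<Sum>i. ennreal (unit_ball_vol (real d) * (diameter (E i) / 2) ^ d)) < ?H + ennreal (1 / Suc n)"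
      by metis
    have "\<forall>i. \<exists>W. W \<in> sets borel \<and> ?T (E i) \<subseteq> W \<and>
        emeasure lborel W \<le> ennreal (4 * \<tau> * (2 * diameter (E i)) ^ (DIM('a) - 1))"
      using sweep_bounded_set[OF b E(2,3) \<open>0 < \<tau>\<close> dim] by (simp only: Bex_def) blast
    from choice[OF this] obtain W where W: "\<And>i. W i \<in> sets borel" "\<And>i. ?T (E i) \<subseteq> W i"
      "\<And>i. emeasure lborel (W i) \<le> ennreal (4 * \<tau> * (2 * diameter (E i)) ^ (DIM('a) - 1))"
      by blast
    have "?T A \<subseteq> (\<Union>i. W i)"
      using E(1) W(2) by blast
    moreover have "emeasure lborel (\<Union>i. W i) \<le> (\<Sum>i. emeasure lborel (W i))"
      using W(1) by (intro emeasure_subadditive_countably) auto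
    moreover have "\<dots> \<le> (\<Sum>i. ?C * ennreal (unit_ball_vol (real d) * (diameter (E i) / 2) ^ d))"
    proof (intro suminf_le summableI)
      fix i
      have "ennreal (4 * \<tau> * (2 * diameter (E i)) ^ (DIM('a) - 1)) =
          ?C * ennreal (unit_ball_vol (real d) * (diameter (E i) / 2) ^ d)"
        unfolding d_def[symmetric] C
        using sweep_const_pos[where 'a = 'a] \<open>0 < \<tau>\<close> unit_ball_vol_pos[of "real d"] diameter_ge_0[OF E(2)]
        by (intro ennreal_mult) auto
      with W(3)[of i] show "emeasure lborel (W i) \<le> ?C * ennreal (unit_ball_vol (real d) * (diameter (E i) / 2) ^ d)"
        by simp
    qed
    moreover have "\<dots> = ?C * (\<Sum>i. ennreal (unit_ball_vol (real d) * (diameter (E i) / 2) ^ d))"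
      by simp
    moreover have "\<dots> \<le> ?C * (?H + ennreal (1 / Suc n))"
      using E(4) by (intro mult_left_mono) auto
    ultimately show ?thesis
      using W(1) by (intro bexI[of _ "\<Union>i. W i"]) (auto intro: order_trans)
  qed
  have "\<forall>n::nat. \<exists>W. W \<in> sets borel \<and> ?T A \<subseteq> W \<and> emeasure lborel W \<le> ?C * (?H + ennreal (1 / Suc n))"
    using * by (simp only: Bex_def) blast
  from choice[OF this] obtain W where W: "\<And>n::nat. W n \<in> sets borel" "\<And>n. ?T A \<subseteq> W n"
    "\<And>n. emeasure lborel (W n) \<le> ?C * (?H + ennreal (1 / Suc n))" by blast
  \<comment> \<open>Intersecting the supersets over all \<open>n\<close> removes the slack
    \<open>1 / Suc n\<close>.\<close>
  have "emeasure lborel (\<Inter>n. W n) \<le> ?C * (?H + ennreal (1 / Suc n))" for n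
    using W by (intro order_trans[OF emeasure_mono W(3)]) auto
  moreover have "(\<lambda>n. ?C * (?H + ennreal (1 / Suc n))) \<longlonglongrightarrow> ?C * (?H + 0)"
    using tendsto_ennrealI[OF LIMSEQ_Suc[OF lim_1_over_n]]
    by (intro ennreal_tendsto_cmult tendsto_intros) auto
  ultimately have "emeasure lborel (\<Inter>n. W n) \<le> ?C * ?H"
    using LIMSEQ_le_const by fastforce
  moreover have "?T A \<subseteq> (\<Inter>n. W n)"
    using W(2) by (intro INT_greatest)
  ultimately show ?thesis using W(1) by (intro bexI[of _ "\<Inter>n. W n"]) auto
qed

section \<open>Level sets and shells\<close>

text \<open>A quantitative form of a nonvanishing gradient, with constants uniform over the layer
  \<open>- e0 \<le> s x < 0\<close> and hence over the levels in it. The direction \<open>v\<close>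
  is a coordinate axis up to sign because swept sets are enclosed in coordinate boxes; as there are
  finitely many axes, summing over them costs only the factor \<open>DIM('a)\<close>.\<close>

locale regular_levels =
  fixes s :: "'a::euclidean_space \<Rightarrow> real" and e0 m L \<rho> :: real
  assumes dim: "2 \<le> DIM('a)" and cont: "continuous_on UNIV s"
    and pos: "0 < m" "0 < L" "0 < \<rho>"
    and transversal: "- e0 \<le> s x \<Longrightarrow> s x < 0 \<Longrightarrow>
      \<exists>v. (v \<in> Basis \<or> - v \<in> Basis) \<and>
        (\<forall>t\<in>{0..\<rho>}. s x + m * t \<le> s (x + t *\<^sub>R v) \<and> s (x - t *\<^sub>R v) \<le> s x - m * t)"
    and lipschitz: "- e0 \<le> s x \<Longrightarrow> s x < 0 \<Longrightarrow> dist x y \<le> \<rho> \<Longrightarrow> \<bar>s y - s x\<bar> \<le> L * dist x y"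
begin

lemma level_borel: "{x. s x = c} \<in> sets borel"
  by (intro borel_closed closed_Collect_eq cont continuous_on_const)

text \<open>Moving back along \<open>v\<close> lowers \<open>s\<close> at rate at least
  \<open>m\<close>, so the level is reached by time
  \<open>(s x + \<epsilon>) / m < \<delta> / m\<close>; the bound
  \<open>\<delta> \<le> m * \<rho>\<close> keeps this within the range of transversality. The sign
  of \<open>t\<close> absorbs the choice between \<open>v\<close> and \<open>- v\<close>.\<close>

lemma shell_foot:
  assumes "0 < \<epsilon>" "\<epsilon> \<le> e0" "\<delta> \<le> \<epsilon>" "\<delta> \<le> m * \<rho>" and x: "- \<epsilon> < s x" "s x < - \<epsilon> + \<delta>"
  shows "\<exists>b\<in>Basis. \<exists>t. \<bar>t\<bar> \<le> \<delta> / m \<and> s (x - t *\<^sub>R b) = - \<epsilon>"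
proof -
  obtain v where v: "v \<in> Basis \<or> - v \<in> Basis"
    "\<And>t. 0 \<le> t \<Longrightarrow> t \<le> \<rho> \<Longrightarrow> s (x - t *\<^sub>R v) \<le> s x - m * t"
    using transversal[of x] assms by fastforce
  define T where "T = (s x + \<epsilon>) / m"
  have T: "0 \<le> T" "T \<le> \<delta> / m" using pos x by (auto simp: T_def divide_right_mono)
  have "\<delta> / m \<le> \<rho>" using pos assms by (simp add: field_simps)
  with T v(2)[of T] have "s (x - T *\<^sub>R v) \<le> - \<epsilon>"
    using pos by (simp add: T_def)
  moreover have "- \<epsilon> \<le> s (x - 0 *\<^sub>R v)" using x by simp
  moreover have "continuous_on {0..T} (\<lambda>t. s (x - t *\<^sub>R v))"
    by (rule continuous_on_compose2[OF cont]) (auto intro!: continuous_intros)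
  ultimately obtain t where t: "0 \<le> t" "t \<le> T" "s (x - t *\<^sub>R v) = - \<epsilon>"
    using IVT2'[of "\<lambda>t. s (x - t *\<^sub>R v)" T "- \<epsilon>" 0] T by auto
  from v(1) show ?thesis
  proof
    assume "v \<in> Basis" then show ?thesis using t T by (intro bexI[of _ v] exI[of _ t]) auto
  next
    assume "- v \<in> Basis" then show ?thesis using t T by (intro bexI[of _ "- v"] exI[of _ "- t"]) auto
  qed
qed

text \<open>The shell is swept out by the level set along the coordinate axes.  The level set is cut into
  pieces on which \<open>g\<close> is constant up to \<open>\<omega>\<close>.\<close>
lemma shell_integral_le:
  assumes eps: "0 < \<epsilon>" "\<epsilon> \<le> e0" and del: "0 < \<delta>" "\<delta> \<le> \<epsilon>" "\<delta> \<le> m * \<rho>"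
    and g: "\<And>x. 0 \<le> g x" "g \<in> borel_measurable borel" and "0 < \<omega>"
    and close: "\<And>x y. - \<epsilon> < s x \<Longrightarrow> s x < - \<epsilon> + \<delta> \<Longrightarrow> s y = - \<epsilon> \<Longrightarrow> dist x y \<le> \<delta> / m \<Longrightarrow> g x \<le> g y + \<omega>"
  shows "(\<integral>\<^sup>+x\<in>{x. - \<epsilon> < s x \<and> s x < - \<epsilon> + \<delta>}. ennreal (g x) \<partial>lborel)
    \<le> ennreal (DIM('a) * sweep_const TYPE('a) * (\<delta> / m)) *
      (\<integral>\<^sup>+x\<in>{x. s x = - \<epsilon>}. ennreal (g x + 2 * \<omega>) \<partial>surface_measure)"
proof -
  let ?S = "{x. s x = - \<epsilon>}" and ?Sh = "{x. - \<epsilon> < s x \<and> s x < - \<epsilon> + \<delta>}"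
  let ?K = "ennreal (sweep_const TYPE('a) * (\<delta> / m))"
  define A where "A j = {y \<in> ?S. real j * \<omega> \<le> g y \<and> g y < (real j + 1) * \<omega>}" for j :: nat
  have A_meas: "A j \<in> sets borel" for j
  proof -
    have "A j = ?S \<inter> {y. real j * \<omega> \<le> g y} \<inter> {y. g y < (real j + 1) * \<omega>}" by (auto simp: A_def)
    moreover have "{y. real j * \<omega> \<le> g y} \<in> sets borel" "{y. g y < (real j + 1) * \<omega>} \<in> sets borel"
      using g(2) by measurable
    ultimately show ?thesis using level_borel by auto
  qed
  have A_disj: "disjoint_family A"
    unfolding disjoint_family_on_def
  proof (intro ballI impI, rule ccontr)
    fix i j :: nat assume "i \<noteq> j" "A i \<inter> A j \<noteq> {}"
    then obtain y where "y \<in> A i" "y \<in> A j" by auto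
    then have "real i * \<omega> < (real j + 1) * \<omega>" "real j * \<omega> < (real i + 1) * \<omega>"
      by (auto simp: A_def)
    then have "real i < real j + 1" "real j < real i + 1" using \<open>0 < \<omega>\<close> by auto
    with \<open>i \<noteq> j\<close> show False by linarith
  qed
  have A_cover: "\<exists>j. y \<in> A j" if "s y = - \<epsilon>" for y
  proof -
    define j where "j = nat \<lfloor>g y / \<omega>\<rfloor>"
    have "real j = of_int \<lfloor>g y / \<omega>\<rfloor>" using g(1)[of y] \<open>0 < \<omega>\<close> by (simp add: j_def)
    then have "real j \<le> g y / \<omega>" "g y / \<omega> < real j + 1" by linarith+
    then show ?thesis using that \<open>0 < \<omega>\<close> by (intro exI[of _ j]) (auto simp: A_def field_simps)
  qed
  \<comment> \<open>Axis and piece are packed into one index \<open>q\<close>, so that a single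
    choice yields all the sets \<open>W b j\<close>.\<close>
  have "\<forall>q. \<exists>W. fst q \<in> Basis \<longrightarrow> W \<in> sets borel \<and> {y + t *\<^sub>R fst q |y t. y \<in> A (snd q) \<and> \<bar>t\<bar> \<le> \<delta> / m} \<subseteq> W \<and>
      emeasure lborel W \<le> ?K * hausdorff_outer (DIM('a) - 1) (A (snd q))"
    using sweep_set[of _ "\<delta> / m", OF _ _ dim] pos(1) del(1) by (auto simp del: One_nat_def simp: Bex_def)
  from choice[OF this] obtain W' where "\<forall>q. fst q \<in> Basis \<longrightarrow> W' q \<in> sets borel \<and>
      {y + t *\<^sub>R fst q |y t. y \<in> A (snd q) \<and> \<bar>t\<bar> \<le> \<delta> / m} \<subseteq> W' q \<and>
      emeasure lborel (W' q) \<le> ?K * hausdorff_outer (DIM('a) - 1) (A (snd q))" by blast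
  then obtain W where W: "\<And>b j. b \<in> Basis \<Longrightarrow> W b j \<in> sets borel"
    "\<And>b j y t. b \<in> Basis \<Longrightarrow> y \<in> A j \<Longrightarrow> \<bar>t\<bar> \<le> \<delta> / m \<Longrightarrow> y + t *\<^sub>R b \<in> W b j"
    "\<And>b j. b \<in> Basis \<Longrightarrow> emeasure lborel (W b j) \<le> ?K * emeasure surface_measure (A j)"
    by (atomize_elim, intro exI[of _ "\<lambda>b j. W' (b, j)"])
       (auto simp: emeasure_surface_measure[OF dim A_meas] simp del: One_nat_def, force)
  have "(\<integral>\<^sup>+x\<in>?Sh. ennreal (g x) \<partial>lborel)
    \<le> (\<integral>\<^sup>+x. (\<Sum>b\<in>Basis. \<Sum>j. ennreal ((real j + 2) * \<omega>) * indicator (W b j) x) \<partial>lborel)"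
  proof (rule nn_integral_mono)
    fix x
    show "ennreal (g x) * indicator ?Sh x \<le> (\<Sum>b\<in>Basis. \<Sum>j. ennreal ((real j + 2) * \<omega>) * indicator (W b j) x)"
    proof (cases "x \<in> ?Sh")
      case True
      then have "- \<epsilon> < s x" "s x < - \<epsilon> + \<delta>" by auto
      \<comment> \<open>If the foot of \<open>x\<close> lies in \<open>A j\<close>, then
        \<open>g x \<le> (j + 2) * \<omega>\<close>: one \<omega> for the width of the piece and one
        for moving from \<open>x\<close> to its foot. On \<open>A j\<close> this value is at most
        \<open>g + 2 * \<omega>\<close>, which is where the error term on the level comes
        from.\<close>
      from shell_foot[OF eps del(2,3) this] obtain b t
        where b: "b \<in> Basis" "\<bar>t\<bar> \<le> \<delta> / m" "s (x - t *\<^sub>R b) = - \<epsilon>"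
        by metis
      obtain j where j: "x - t *\<^sub>R b \<in> A j" using A_cover[OF b(3)] by blast
      have x: "x \<in> W b j" using W(2)[OF b(1) j b(2)] by simp
      have "g x \<le> g (x - t *\<^sub>R b) + \<omega>"
        using True b by (intro close) (auto simp: dist_norm)
      also have "\<dots> \<le> (real j + 2) * \<omega>" using j by (simp add: A_def algebra_simps)
      finally have "ennreal (g x) * indicator ?Sh x \<le> ennreal ((real j + 2) * \<omega>) * indicator (W b j) x"
        using x True by (simp add: ennreal_leI)
      also have "\<dots> \<le> (\<Sum>j. ennreal ((real j + 2) * \<omega>) * indicator (W b j) x)"
        using sum_le_suminf[of "\<lambda>j. ennreal ((real j + 2) * \<omega>) * indicator (W b j) x" "{j}"]
        by (simp del: sum_mult_indicator)
      also have "\<dots> \<le> (\<Sum>b\<in>Basis. \<Sum>j. ennreal ((real j + 2) * \<omega>) * indicator (W b j) x)"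
        using b(1) by (intro member_le_sum) auto
      finally show ?thesis .
    qed simp
  qed
  also have "\<dots> = (\<Sum>b\<in>Basis. \<Sum>j. ennreal ((real j + 2) * \<omega>) * emeasure lborel (W b j))"
    using W(1) by (subst nn_integral_sum) (auto simp: nn_integral_suminf nn_integral_cmult intro!: sum.cong)
  also have "\<dots> \<le> (\<Sum>b\<in>(Basis::'a set). \<Sum>j. ennreal ((real j + 2) * \<omega>) * (?K * emeasure surface_measure (A j)))"
    using W(3) by (intro sum_mono suminf_le summableI mult_left_mono) auto
  also have "\<dots> = of_nat DIM('a) * (?K * (\<Sum>j. ennreal ((real j + 2) * \<omega>) * emeasure surface_measure (A j)))"
    by (simp add: mult.left_commute)
  also have "(\<Sum>j. ennreal ((real j + 2) * \<omega>) * emeasure surface_measure (A j)) =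
      (\<integral>\<^sup>+x. (\<Sum>j. ennreal ((real j + 2) * \<omega>) * indicator (A j) x) \<partial>surface_measure)"
    using A_meas by (subst nn_integral_suminf) (auto simp: nn_integral_cmult)
  also have "\<dots> \<le> (\<integral>\<^sup>+x\<in>?S. ennreal (g x + 2 * \<omega>) \<partial>surface_measure)"
  proof (rule nn_integral_mono)
    fix x
    show "(\<Sum>j. ennreal ((real j + 2) * \<omega>) * indicator (A j) x) \<le> ennreal (g x + 2 * \<omega>) * indicator ?S x"
    proof (cases "s x = - \<epsilon>")
      case True
      then obtain j where j: "x \<in> A j" using A_cover by blast
      then have "indicator (A i) x = (if i = j then 1 else 0 :: ennreal)" for i
        using A_disj by (auto simp: disjoint_family_on_def indicator_def)
      then have "(\<Sum>i. ennreal ((real i + 2) * \<omega>) * indicator (A i) x) = ennreal ((real j + 2) * \<omega>)"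
        by (subst suminf_finite[of "{j}"]) auto
      also have "\<dots> \<le> ennreal (g x + 2 * \<omega>)"
        using j by (intro ennreal_leI) (auto simp: A_def algebra_simps)
      finally show ?thesis using True by simp
    next
      case False
      then have "indicator (A i) x = (0 :: ennreal)" for i by (auto simp: A_def)
      then show ?thesis by simp
    qed
  qed
  finally have *: "(\<integral>\<^sup>+x\<in>?Sh. ennreal (g x) \<partial>lborel)
      \<le> of_nat DIM('a) * (?K * (\<integral>\<^sup>+x\<in>?S. ennreal (g x + 2 * \<omega>) \<partial>surface_measure))"
    by (simp add: mult_left_mono)
  have "ennreal (DIM('a) * sweep_const TYPE('a) * (\<delta> / m)) = of_nat DIM('a) * ?K"
    unfolding mult.assoc ennreal_of_nat_eq_real_of_nat
    using pos(1) del(1) sweep_const_pos[where 'a = 'a] by (intro ennreal_mult) auto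
  with * show ?thesis by (simp only: mult.assoc)
qed

text \<open>With n the real dimension and \<kappa> = \<open>min (1/4) (m / (4 * L))\<close>, this is
  \<eta> times the quotient of the weight
  \<open>unit_ball_vol (n - 1) * (5 * \<eta>) ^ (n - 1)\<close> of an enlarged ball by the volume
  \<open>unit_ball_vol n * (\<kappa> * \<eta>) ^ n\<close> of the ball found in the shell.\<close>

definition packing_const :: real where
  "packing_const = unit_ball_vol (real (DIM('a) - 1)) * 5 ^ (DIM('a) - 1) /
     (unit_ball_vol (real DIM('a)) * min (1/4) (m / (4 * L)) ^ DIM('a))"

lemma packing_const_pos: "0 < packing_const"
  using pos by (simp add: packing_const_def unit_ball_vol_pos)

text \<open>Near each centre of a maximal packing of the level set by balls of radius \<open>\<eta>\<close>, the shell
  contains a ball of radius comparable to \<open>\<eta>\<close>.\<close>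
lemma hausdorff_pre_le_shell:
  assumes eps: "0 < \<epsilon>" "\<epsilon> \<le> e0" and eta: "0 < \<eta>" "\<eta> \<le> \<rho>" "L * \<eta> \<le> \<epsilon>"
    and A: "A \<subseteq> {x. s x = - \<epsilon>}"
    and U: "U \<in> sets borel"
      "\<And>x y. - \<epsilon> < s x \<Longrightarrow> s x < - \<epsilon> + L * \<eta> \<Longrightarrow> y \<in> A \<Longrightarrow> dist y x \<le> \<eta> \<Longrightarrow> x \<in> U"
  shows "hausdorff_pre (DIM('a) - 1) (10 * \<eta>) A \<le> ennreal (packing_const / \<eta>) * emeasure lborel U"
proof -
  \<comment> \<open>The ball of radius \<open>\<kappa> * \<eta>\<close> about
    \<open>y + (\<eta> / 2) *\<^sub>R v\<close> has to stay in the shell. Its centre is raised by at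
    least \<open>m * \<eta> / 2\<close>, and \<open>L * \<kappa> \<le> m / 4\<close> loses at most
    half of that; \<open>\<kappa> \<le> 1/4\<close> keeps the ball within
    \<open>3/4 * \<eta>\<close> of \<open>y\<close>, hence below
    \<open>- \<epsilon> + L * \<eta>\<close>.\<close>
  define \<kappa> where "\<kappa> = min (1/4) (m / (4 * L))"
  have \<kappa>: "0 < \<kappa>" "\<kappa> \<le> 1/4" "L * \<kappa> \<le> m / 4" using pos by (auto simp: \<kappa>_def min_def field_simps)
  have "\<exists>x. \<forall>x'. dist x x' \<le> \<kappa> * \<eta> \<longrightarrow> dist y x' \<le> \<eta> \<and> x' \<in> U" if y: "y \<in> A" for y
  proof -
    have sy: "s y = - \<epsilon>" using A y by auto
    obtain v where v: "v \<in> Basis \<or> - v \<in> Basis" "s y + m * (\<eta> / 2) \<le> s (y + (\<eta> / 2) *\<^sub>R v)"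
      using transversal[of y] sy eps eta by fastforce
    have nv: "norm v = 1" using v(1) norm_Basis[of v] norm_Basis[of "- v"] by auto
    define x where "x = y + (\<eta> / 2) *\<^sub>R v"
    have dx: "dist y x = \<eta> / 2" using nv eta by (simp add: x_def dist_norm)
    have "\<bar>s x - s y\<bar> \<le> L * (\<eta> / 2)"
      using lipschitz[of y x] sy eps eta dx by simp
    moreover have "0 < L * \<eta>" "0 < m * \<eta>" using pos eta by auto
    ultimately have sx: "- e0 \<le> s x" "s x < 0" "- \<epsilon> + m * (\<eta> / 2) \<le> s x"
      using sy eps eta v(2) by (auto simp: x_def)
    have "dist y x' \<le> \<eta> \<and> x' \<in> U" if x': "dist x x' \<le> \<kappa> * \<eta>" for x'
    proof -
      have k: "\<kappa> * \<eta> \<le> \<eta> / 4" using \<kappa>(2) eta mult_right_mono[of \<kappa> "1/4" \<eta>] by simp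
      then have d: "dist y x' \<le> 3/4 * \<eta>" using dist_triangle[of y x' x] dx x' by linarith
      have "\<bar>s x' - s x\<bar> \<le> L * dist x x'"
        by (rule lipschitz[OF sx(1,2)]) (use x' k eta in linarith)
      also have "\<dots> \<le> L * (\<kappa> * \<eta>)" using x' pos by (intro mult_left_mono) auto
      also have "\<dots> \<le> m / 4 * \<eta>" using \<kappa>(3) eta mult_right_mono[of "L * \<kappa>" "m / 4" \<eta>] by (simp add: mult.assoc)
      finally have "- \<epsilon> < s x'" using sx(3) \<open>0 < m * \<eta>\<close> by linarith
      moreover have "\<bar>s x' - s y\<bar> \<le> L * (3/4 * \<eta>)"
      proof -
        have "dist y x' \<le> \<rho>" using d eta by linarith
        then have "\<bar>s x' - s y\<bar> \<le> L * dist y x'" using sy eps by (intro lipschitz) auto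
        also have "\<dots> \<le> L * (3/4 * \<eta>)" using d pos by (intro mult_left_mono) auto
        finally show ?thesis .
      qed
      then have "s x' < - \<epsilon> + L * \<eta>" using sy \<open>0 < L * \<eta>\<close> by linarith
      ultimately show ?thesis using U(2)[OF _ _ y, of x'] d eta by auto
    qed
    then show ?thesis by blast
  qed
  then obtain c where c: "\<And>y x'. y \<in> A \<Longrightarrow> dist (c y) x' \<le> \<kappa> * \<eta> \<Longrightarrow> dist y x' \<le> \<eta> \<and> x' \<in> U"
    by metis
  \<comment> \<open>Vitali's lemma gives disjoint balls of radius \<eta> whose fivefold enlargements
    cover \<open>A\<close>; hence the mesh \<open>10 * \<eta>\<close> and the 5 in
    \<open>packing_const\<close>. The small balls about the points \<open>c y\<close> lie in these
    disjoint balls, so their volumes add up inside \<open>U\<close>.\<close>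
  have "A \<subseteq> (\<Union>y\<in>A. cball y \<eta>)" using eta by auto
  then obtain C where C: "countable C" "C \<subseteq> A"
     "pairwise (\<lambda>i j. disjnt (cball i \<eta>) (cball j \<eta>)) C" "A \<subseteq> (\<Union>y\<in>C. cball y (5 * \<eta>))"
    using Vitali_covering_lemma_cballs[of A "\<lambda>y. y" "\<lambda>_. \<eta>" A \<eta>] eta by blast
  \<comment> \<open>Covers are sequences, so the countable set \<open>C\<close> is indexed by
    natural numbers, with empty sets at the indices outside \<open>I\<close>.\<close>
  define I where "I = to_nat_on C ` C"
  define z where "z i = from_nat_into C i" for i
  have z: "z i \<in> C" if "i \<in> I" for i using that C(1) by (auto simp: I_def z_def)
  have z_inj: "z i \<noteq> z j" if "i \<in> I" "j \<in> I" "i \<noteq> j" for i j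
    using that C(1) by (auto simp: I_def z_def)
  have z_surj: "\<exists>i\<in>I. z i = y" if "y \<in> C" for y using that C(1) by (auto simp: I_def z_def)
  define E where "E i = (if i \<in> I then cball (z i) (5 * \<eta>) else {})" for i
  define B where "B i = (if i \<in> I then cball (c (z i)) (\<kappa> * \<eta>) else {})" for i
  define d where "d = DIM('a) - 1"
  have d: "DIM('a) = Suc d" "0 < d" using dim by (auto simp: d_def)
  have "hausdorff_pre d (10 * \<eta>) A \<le> (\<Sum>i. ennreal (unit_ball_vol (real d) * (diameter (E i) / 2) ^ d))"
  proof (rule hausdorff_pre_leI)
    show "A \<subseteq> (\<Union>i. E i)" using C(4) z_surj unfolding E_def by fastforce
  qed (use eta in \<open>auto simp: E_def\<close>)
  also have "\<dots> \<le> (\<Sum>i. ennreal (packing_const / \<eta>) * emeasure lborel (B i))"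
  proof (intro suminf_le summableI)
    fix i
    have "unit_ball_vol (real d) * (5 * \<eta>) ^ d =
        packing_const / \<eta> * (unit_ball_vol (real DIM('a)) * (\<kappa> * \<eta>) ^ DIM('a))"
    proof -
      have "unit_ball_vol (real (Suc d)) \<noteq> 0"
        by (metis less_irrefl of_nat_0_le_iff unit_ball_vol_pos)
      then show ?thesis
        using eta \<kappa>(1) unfolding packing_const_def \<kappa>_def[symmetric] d(1)
        by (simp add: field_simps power_mult_distrib del: of_nat_Suc)
    qed
    then show "ennreal (unit_ball_vol (real d) * (diameter (E i) / 2) ^ d)
      \<le> ennreal (packing_const / \<eta>) * emeasure lborel (B i)"
      using eta \<kappa>(1) packing_const_pos d(2)
      by (auto simp: E_def B_def emeasure_cball ennreal_mult[symmetric] zero_power unit_ball_vol_pos less_imp_le)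
  qed
  also have "\<dots> = ennreal (packing_const / \<eta>) * emeasure lborel (\<Union>i. B i)"
  proof -
    have "disjoint_family B"
      unfolding disjoint_family_on_def
    proof (intro ballI impI)
      fix i j :: nat assume "i \<noteq> j"
      show "B i \<inter> B j = {}"
      proof (rule ccontr)
        assume "B i \<inter> B j \<noteq> {}"
        then obtain x' where "i \<in> I" "j \<in> I" "dist (c (z i)) x' \<le> \<kappa> * \<eta>" "dist (c (z j)) x' \<le> \<kappa> * \<eta>"
          by (auto simp: B_def split: if_splits)
        moreover from this have "x' \<in> cball (z i) \<eta> \<inter> cball (z j) \<eta>"
          using c z C(2) by auto
        moreover have "cball (z i) \<eta> \<inter> cball (z j) \<eta> = {}" if "i \<in> I" "j \<in> I"
          using C(3) z[OF that(1)] z[OF that(2)] z_inj[OF that \<open>i \<noteq> j\<close>]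
          unfolding pairwise_def disjnt_def by blast
        ultimately show False by blast
      qed
    qed
    then show ?thesis by (subst suminf_emeasure[symmetric]) (auto simp: B_def)
  qed
  also have "\<dots> \<le> ennreal (packing_const / \<eta>) * emeasure lborel U"
    using c[OF subsetD[OF C(2) z]] U(1) by (intro mult_left_mono emeasure_mono) (auto simp: B_def split: if_splits)
  finally show ?thesis by (simp add: d_def)
qed

end

section \<open>Product structure and rotations\<close>

lemma zpart_0 [simp]: "zpart 0 = 0" and wpart_0 [simp]: "wpart 0 = 0"
  by (simp_all add: zpart_def wpart_def vec_eq_iff)

lemma inner_zpart_wpart: "\<zeta> \<bullet> \<xi> = zpart \<zeta> \<bullet> zpart \<xi> + wpart \<zeta> \<bullet> wpart \<xi>"
  unfolding inner_vec_def zpart_def wpart_def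
  by (subst UNIV_Plus_UNIV[symmetric], subst sum.Plus) auto

lemma norm_zpart_wpart: "(norm \<zeta>)\<^sup>2 = (norm (zpart \<zeta>))\<^sup>2 + (norm (wpart \<zeta>))\<^sup>2"
  by (simp add: power2_norm_eq_inner inner_zpart_wpart[of \<zeta> \<zeta>])

lemma norm_zpart_le: "norm (zpart \<zeta>) \<le> norm \<zeta>"
  by (rule power2_le_imp_le) (simp_all add: norm_zpart_wpart[of \<zeta>])

lemma zpart_diff: "zpart (\<zeta> - \<xi>) = zpart \<zeta> - zpart \<xi>"
  by (simp add: zpart_def vec_eq_iff)

lemma wpart_diff: "wpart (\<zeta> - \<xi>) = wpart \<zeta> - wpart \<xi>"
  by (simp add: wpart_def vec_eq_iff)

lemma dist_zpart_le: "dist (zpart \<zeta>) (zpart \<xi>) \<le> dist \<zeta> \<xi>"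
  using norm_zpart_le[of "\<zeta> - \<xi>"] by (simp add: dist_norm zpart_diff)

lemma join_add: "join (z + z') (w + w') = join z w + join z' w'"
  by (auto simp: join_def vec_eq_iff split: sum.split)

lemma join_scaleR: "join (c *\<^sub>R z) (c *\<^sub>R w) = c *\<^sub>R join z w"
  by (auto simp: join_def vec_eq_iff split: sum.split)

lemma join_smult: "join (c *s z) (c *s w) = c *s join z w"
  by (auto simp: join_def vec_eq_iff split: sum.split)

lemma bounded_linear_join: "bounded_linear (\<lambda>(z, w). join z w)"
  by (intro linear_conv_bounded_linear[THEN iffD1] linearI)
     (auto simp: join_add[symmetric] join_scaleR[symmetric])

lemma continuous_on_join [continuous_intros]:
  assumes "continuous_on A f" "continuous_on A g"
  shows "continuous_on A (\<lambda>x. join (f x) (g x))"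
  using bounded_linear.continuous_on[OF bounded_linear_join continuous_on_Pair[OF assms]] by simp

lemma borel_measurable_join [measurable]: "(\<lambda>(z, w). join z w) \<in> borel_measurable (borel \<Otimes>\<^sub>M borel)"
  unfolding borel_prod
  by (intro borel_measurable_continuous_onI linear_continuous_on bounded_linear_join)

lemma continuous_on_zpart [continuous_intros]: "continuous_on A f \<Longrightarrow> continuous_on A (\<lambda>x. zpart (f x))"
  by (rule bounded_linear.continuous_on[OF bounded_linear_zpart])

lemma continuous_on_wpart [continuous_intros]: "continuous_on A f \<Longrightarrow> continuous_on A (\<lambda>x. wpart (f x))"
  by (rule bounded_linear.continuous_on[OF bounded_linear_wpart])

lemma Basis_join:
  "(Basis :: (complex ^ ('n::finite + 'k::finite)) set) = (\<lambda>b. join b 0) ` Basis \<union> (\<lambda>b. join 0 b) ` Basis"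
proof -
  have 1: "join (axis i u) 0 = (axis (Inl i) u :: complex ^ ('n + 'k))" for i u
    by (auto simp: join_def axis_def vec_eq_iff split: sum.split)
  have 2: "join 0 (axis i u) = (axis (Inr i) u :: complex ^ ('n + 'k))" for i u
    by (auto simp: join_def axis_def vec_eq_iff split: sum.split)
  have "(Basis :: (complex ^ ('n + 'k)) set) = (\<Union>i\<in>UNIV <+> UNIV. \<Union>u\<in>Basis. {axis i u})"
    by (simp add: Basis_vec_def)
  also have "\<dots> = (\<lambda>b. join b 0) ` Basis \<union> (\<lambda>b. join 0 b) ` Basis"
    unfolding Plus_def UN_Un Basis_vec_def by (simp add: image_UN 1 2)
  finally show ?thesis .
qed

text \<open>Lebesgue measure is determined by its values on boxes, and the splitting of the basis
  makes a box in the joint space a product of two boxes.\<close>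

lemma lborel_join:
  "distr (lborel \<Otimes>\<^sub>M lborel) borel (\<lambda>(z, w). join z w) = (lborel :: (complex ^ ('n::finite + 'k::finite)) measure)"
proof (rule lborel_eqI[symmetric])
  fix l u :: "complex ^ ('n + 'k)"
  assume le: "\<And>b. b \<in> Basis \<Longrightarrow> l \<bullet> b \<le> u \<bullet> b"
  have inj: "inj_on (\<lambda>b. join b 0) Basis" "inj_on (\<lambda>b. join 0 b) Basis"
    by (auto intro: inj_on_inverseI[of _ zpart] inj_on_inverseI[of _ wpart])
  have disj: "(\<lambda>b. join b 0 :: complex ^ ('n + 'k)) ` Basis \<inter> (\<lambda>b. join 0 b) ` Basis = {}"
  proof -
    have False if "b \<in> Basis" "join b 0 = (join 0 b' :: complex ^ ('n + 'k))" for b b'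
    proof -
      have "b = 0" using arg_cong[OF that(2), of zpart] by simp
      then show False using that(1) by auto
    qed
    then show ?thesis by auto
  qed
  have le': "zpart l \<bullet> b \<le> zpart u \<bullet> b" if "b \<in> Basis" for b
    using le[of "join b 0"] that by (simp add: inner_zpart_wpart Basis_join)
  have le'': "wpart l \<bullet> b \<le> wpart u \<bullet> b" if "b \<in> Basis" for b
    using le[of "join 0 b"] that by (simp add: inner_zpart_wpart Basis_join)
  have vimage: "(\<lambda>(z, w). join z w) -` box l u = box (zpart l) (zpart u) \<times> box (wpart l) (wpart u)"
    by (auto simp: mem_box Basis_join inner_zpart_wpart ball_Un)
  have meas: "(\<lambda>(z, w). join z w) \<in> borel_measurable (lborel \<Otimes>\<^sub>M lborel)"
    by measurable
  have "emeasure (distr (lborel \<Otimes>\<^sub>M lborel) borel (\<lambda>(z, w). join z w)) (box l u) =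
      emeasure (lborel \<Otimes>\<^sub>M lborel) (box (zpart l) (zpart u) \<times> box (wpart l) (wpart u))"
    using meas by (subst emeasure_distr) (auto simp: vimage space_pair_measure)
  also have "\<dots> = ennreal (\<Prod>b\<in>Basis. (zpart u - zpart l) \<bullet> b) * ennreal (\<Prod>b\<in>Basis. (wpart u - wpart l) \<bullet> b)"
    using le' le'' by (subst lborel.emeasure_pair_measure_Times) auto
  also have "\<dots> = ennreal ((\<Prod>b\<in>Basis. (zpart u - zpart l) \<bullet> b) * (\<Prod>b\<in>Basis. (wpart u - wpart l) \<bullet> b))"
    using le' le'' by (subst ennreal_mult) (auto intro!: prod_nonneg simp: inner_simps)
  also have "(\<Prod>b\<in>Basis. (zpart u - zpart l) \<bullet> b) * (\<Prod>b\<in>Basis. (wpart u - wpart l) \<bullet> b) =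
      (\<Prod>b\<in>Basis. (u - l) \<bullet> b)"
    unfolding Basis_join using disj
    by (subst prod.union_disjoint)
       (simp_all add: prod.reindex[OF inj(1)] prod.reindex[OF inj(2)] inner_zpart_wpart zpart_diff wpart_diff)
  finally show "emeasure (distr (lborel \<Otimes>\<^sub>M lborel) borel (\<lambda>(z, w). join z w)) (box l u) =
      (\<Prod>b\<in>Basis. (u - l) \<bullet> b)" .
qed simp

lemma nn_integral_join:
  fixes f :: "complex ^ ('n::finite + 'k::finite) \<Rightarrow> ennreal"
  assumes [measurable]: "f \<in> borel_measurable borel"
  shows "(\<integral>\<^sup>+\<zeta>. f \<zeta> \<partial>lborel) = (\<integral>\<^sup>+z. \<integral>\<^sup>+w. f (join z w) \<partial>lborel \<partial>lborel)"
proof -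
  have meas: "(\<lambda>(z, w). join z w) \<in> (lborel \<Otimes>\<^sub>M lborel) \<rightarrow>\<^sub>M (borel :: (complex ^ ('n + 'k)) measure)"
    by measurable
  have "(\<integral>\<^sup>+\<zeta>. f \<zeta> \<partial>lborel) = (\<integral>\<^sup>+x. f (case x of (z, w) \<Rightarrow> join z w) \<partial>(lborel \<Otimes>\<^sub>M lborel))"
    unfolding lborel_join[symmetric, where 'n = 'n and 'k = 'k] using meas by (subst nn_integral_distr) auto
  also have "\<dots> = (\<integral>\<^sup>+z. \<integral>\<^sup>+w. f (join z w) \<partial>lborel \<partial>lborel)"
    using meas by (subst lborel.nn_integral_fst[symmetric]) auto
  finally show ?thesis .
qed

section \<open>Rotation invariance of Lebesgue measure\<close>

lemma nn_integral_lborel_translation: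
  fixes f :: "'a::euclidean_space \<Rightarrow> ennreal"
  assumes "f \<in> borel_measurable borel"
  shows "(\<integral>\<^sup>+x. f (c + x) \<partial>lborel) = (\<integral>\<^sup>+x. f x \<partial>lborel)"
  using assms by (subst (2) lborel_distr_plus[of c, symmetric]) (simp add: nn_integral_distr)

text \<open>Compare the two iterated integrals of \<open>f (U x + y)\<close> over \<open>norm y < 1\<close>.\<close>
lemma nn_integral_lborel_isometry:
  fixes U :: "'a::euclidean_space \<Rightarrow> 'a" and f :: "'a \<Rightarrow> ennreal"
  assumes U: "linear U" "\<And>x. norm (U x) = norm x" and V: "\<And>x. U (V x) = x"
    and f [measurable]: "f \<in> borel_measurable borel"
  shows "(\<integral>\<^sup>+x. f (U x) \<partial>lborel) = (\<integral>\<^sup>+x. f x \<partial>lborel)"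
proof -
  have [measurable]: "U \<in> borel_measurable borel"
    using U(1) by (intro borel_measurable_continuous_onI linear_continuous_on) (simp add: linear_conv_bounded_linear)
  define B where "B = ball (0::'a) 1"
  have [measurable]: "B \<in> sets borel" by (simp add: B_def)
  define \<beta> where "\<beta> = emeasure lborel B"
  have \<beta>: "\<beta> = ennreal (unit_ball_vol (real DIM('a)))"
    by (simp add: \<beta>_def B_def emeasure_ball)
  have "(\<integral>\<^sup>+y. \<integral>\<^sup>+x. f (U x + y) * indicator B y \<partial>lborel \<partial>lborel) = (\<integral>\<^sup>+y. (\<integral>\<^sup>+x. f (U x) \<partial>lborel) * indicator B y \<partial>lborel)"
  proof (rule nn_integral_cong)
    fix y
    have "(\<integral>\<^sup>+x. f (U x + y) \<partial>lborel) = (\<integral>\<^sup>+x. f (U (V y + x)) \<partial>lborel)"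
      by (simp add: linear_add[OF U(1)] V add.commute)
    also have "\<dots> = (\<integral>\<^sup>+x. f (U x) \<partial>lborel)"
      by (rule nn_integral_lborel_translation) measurable
    finally show "(\<integral>\<^sup>+x. f (U x + y) * indicator B y \<partial>lborel) = (\<integral>\<^sup>+x. f (U x) \<partial>lborel) * indicator B y"
      by (subst nn_integral_multc) auto
  qed
  also have "\<dots> = (\<integral>\<^sup>+x. f (U x) \<partial>lborel) * \<beta>"
    by (simp add: nn_integral_cmult \<beta>_def)
  finally have 1: "(\<integral>\<^sup>+y. \<integral>\<^sup>+x. f (U x + y) * indicator B y \<partial>lborel \<partial>lborel) = (\<integral>\<^sup>+x. f (U x) \<partial>lborel) * \<beta>" .
  have "(\<integral>\<^sup>+y. \<integral>\<^sup>+x. f (U x + y) * indicator B y \<partial>lborel \<partial>lborel) =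
      (\<integral>\<^sup>+x. \<integral>\<^sup>+y. f (U x + y) * indicator B y \<partial>lborel \<partial>lborel)"
    by (rule lborel_pair.Fubini') measurable
  also have "\<dots> = (\<integral>\<^sup>+x. \<integral>\<^sup>+y. f y * indicator B (y - U x) \<partial>lborel \<partial>lborel)"
  proof (rule nn_integral_cong)
    fix x
    show "(\<integral>\<^sup>+y. f (U x + y) * indicator B y \<partial>lborel) = (\<integral>\<^sup>+y. f y * indicator B (y - U x) \<partial>lborel)"
      using nn_integral_lborel_translation[of "\<lambda>y. f y * indicator B (y - U x)" "U x"] by simp
  qed
  also have "\<dots> = (\<integral>\<^sup>+y. \<integral>\<^sup>+x. f y * indicator B (y - U x) \<partial>lborel \<partial>lborel)"
    by (rule lborel_pair.Fubini') measurable
  also have "\<dots> = (\<integral>\<^sup>+y. f y * \<beta> \<partial>lborel)"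
  proof (rule nn_integral_cong)
    fix y
    \<comment> \<open>As a condition on \<open>x\<close>, that \<open>y - U x\<close> lies in the
      unit ball describes a unit ball about \<open>V y\<close>, whose volume does not depend on
      \<open>y\<close>.\<close>
    have "y - U x = U (V y - x)" for x by (simp add: linear_diff[OF U(1)] V)
    then have "indicator B (y - U x) = (indicator (ball (V y) 1) x :: ennreal)" for x
      by (simp add: B_def U(2) indicator_def dist_norm)
    then have "(\<integral>\<^sup>+x. f y * indicator B (y - U x) \<partial>lborel) = f y * emeasure lborel (ball (V y) 1)"
      by (simp add: nn_integral_cmult_indicator)
    then show "(\<integral>\<^sup>+x. f y * indicator B (y - U x) \<partial>lborel) = f y * \<beta>"
      by (simp add: \<beta> emeasure_ball)
  qed
  also have "\<dots> = (\<integral>\<^sup>+x. f x \<partial>lborel) * \<beta>"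
    by (simp add: nn_integral_multc)
  finally have "(\<integral>\<^sup>+x. f (U x) \<partial>lborel) * \<beta> = (\<integral>\<^sup>+x. f x \<partial>lborel) * \<beta>"
    using 1 by simp
  moreover have "\<beta> \<noteq> 0" "\<beta> \<noteq> \<infinity>" by (auto simp: \<beta> unit_ball_vol_pos ennreal_eq_0_iff not_le)
  ultimately show ?thesis
    by (metis ennreal_mult_cancel_left mult.commute infinity_ennreal_def)
qed

lemma norm_smult_vec: "norm (c *s (w :: complex ^ 'k::finite)) = norm c * norm w"
  by (simp add: norm_vec_def L2_set_def norm_mult power_mult_distrib sum_distrib_left[symmetric] real_sqrt_mult)

lemma bounded_bilinear_smult_vec: "bounded_bilinear (\<lambda>c (w :: complex ^ 'k::finite). c *s w)"
  by (rule bounded_bilinear.intro)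
     (auto simp: vec_eq_iff algebra_simps norm_smult_vec intro!: exI[of _ 1])

lemmas continuous_on_smult_vec [continuous_intros] = bounded_bilinear.continuous_on[OF bounded_bilinear_smult_vec]

lemma nn_integral_rotation:
  fixes f :: "complex ^ 'k::finite \<Rightarrow> ennreal"
  assumes "f \<in> borel_measurable borel" "norm c = 1"
  shows "(\<integral>\<^sup>+w. f (c *s w) \<partial>lborel) = (\<integral>\<^sup>+w. f w \<partial>lborel)"
proof (rule nn_integral_lborel_isometry)
  show "linear ((*s) c :: complex ^ 'k \<Rightarrow> _)"
    by (intro linearI) (auto simp: vec_eq_iff algebra_simps)
  have "c * cnj c = 1" using assms(2) by (simp add: complex_norm_square[symmetric])
  then show "c *s (cnj c *s w) = w" for w :: "complex ^ 'k"
    by (simp add: vector_smult_assoc)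
qed (use assms in \<open>auto simp: norm_smult_vec\<close>)

section \<open>Volumes and circular means of shells in the fibre variable\<close>

lemma power_increment_bounds:
  fixes a \<delta> :: real
  assumes "0 \<le> a" "0 \<le> \<delta>"
  shows "real (Suc j) * \<delta> * a ^ j \<le> (a + \<delta>) ^ Suc j - a ^ Suc j"
    and "(a + \<delta>) ^ Suc j - a ^ Suc j \<le> real (Suc j) * \<delta> * (a + \<delta>) ^ j"
proof -
  have eq: "(a + \<delta>) ^ Suc j - a ^ Suc j = \<delta> * (\<Sum>i<Suc j. a ^ (j - i) * (a + \<delta>) ^ i)"
    by (subst power_diff_sumr2) (auto intro!: sum.cong simp: mult.commute)
  have const: "(\<Sum>i<Suc j. x ^ (j - i) * x ^ i) = real (Suc j) * x ^ j" for x :: real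
    by (simp flip: power_add)
  have "(\<Sum>i<Suc j. a ^ (j - i) * a ^ i) \<le> (\<Sum>i<Suc j. a ^ (j - i) * (a + \<delta>) ^ i)"
    using assms by (intro sum_mono mult_left_mono power_mono) auto
  from mult_left_mono[OF this[unfolded const] assms(2)]
  show "real (Suc j) * \<delta> * a ^ j \<le> (a + \<delta>) ^ Suc j - a ^ Suc j"
    unfolding eq by (simp only: mult_ac)
  have "(\<Sum>i<Suc j. a ^ (j - i) * (a + \<delta>) ^ i) \<le> (\<Sum>i<Suc j. (a + \<delta>) ^ (j - i) * (a + \<delta>) ^ i)"
    using assms by (intro sum_mono mult_right_mono power_mono) auto
  from mult_left_mono[OF this[unfolded const] assms(2)]
  show "(a + \<delta>) ^ Suc j - a ^ Suc j \<le> real (Suc j) * \<delta> * (a + \<delta>) ^ j"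
    unfolding eq by (simp only: mult_ac)
qed

text \<open>Radii are given by their squares because the lift adds \<open>(norm w)\<^sup>2\<close>
  to \<open>r\<close>. A negative \<open>a\<close> is allowed and gives a ball, or nothing if
  \<open>b \<le> 0\<close> as well.\<close>

definition w_shell :: "real \<Rightarrow> real \<Rightarrow> (complex ^ 'k::finite) set" where
  "w_shell a b = {w. a < (norm w)\<^sup>2 \<and> (norm w)\<^sup>2 < b}"

lemma open_w_shell: "open (w_shell a b)"
  unfolding w_shell_def by (intro open_Collect_conj open_Collect_less continuous_intros)

lemma emeasure_w_shell:
  assumes "0 \<le> a" "0 < \<delta>"
  shows "emeasure lborel (w_shell a (a + \<delta>) :: (complex ^ 'k::finite) set) =
    ennreal (unit_ball_vol (real (2 * CARD('k))) * ((a + \<delta>) ^ CARD('k) - a ^ CARD('k)))"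
proof -
  let ?v = "unit_ball_vol (real (2 * CARD('k)))"
  have v: "0 \<le> ?v" by (simp add: less_imp_le unit_ball_vol_pos)
  have sq: "sqrt x ^ (2 * CARD('k)) = x ^ CARD('k)" if "0 \<le> x" for x
    using that by (simp add: power_mult)
  have 1: "(norm w)\<^sup>2 < x \<longleftrightarrow> norm w < sqrt x" for w :: "complex ^ 'k" and x
    using real_sqrt_less_iff[of "(norm w)\<^sup>2" x] by simp
  have 2: "x < (norm w)\<^sup>2 \<longleftrightarrow> sqrt x < norm w" for w :: "complex ^ 'k" and x
    using real_sqrt_less_iff[of x "(norm w)\<^sup>2"] by simp
  have sub: "cball (0::complex^'k) (sqrt a) \<subseteq> ball 0 (sqrt (a + \<delta>))"
    using assms real_sqrt_less_iff[of a "a + \<delta>"] by (auto simp del: real_sqrt_less_iff)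
  have "w_shell a (a + \<delta>) = ball (0::complex^'k) (sqrt (a + \<delta>)) - cball 0 (sqrt a)"
    by (auto simp: w_shell_def 1 2)
  also have "emeasure lborel \<dots> =
      emeasure lborel (ball (0::complex^'k) (sqrt (a + \<delta>))) - emeasure lborel (cball (0::complex^'k) (sqrt a))"
    using sub emeasure_lborel_cball_finite[of "0::complex^'k" "sqrt a"] by (intro emeasure_Diff) auto
  also have "\<dots> = ennreal (?v * (a + \<delta>) ^ CARD('k)) - ennreal (?v * a ^ CARD('k))"
    using assms by (simp add: emeasure_ball emeasure_cball sq mult.commute[of _ 2])
  also have "\<dots> = ennreal (?v * ((a + \<delta>) ^ CARD('k) - a ^ CARD('k)))"
    using assms v by (simp add: ennreal_minus right_diff_distrib)
  finally show ?thesis .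
qed

lemma emeasure_w_shell_ge:
  assumes "0 \<le> a" "0 < \<delta>"
  shows "ennreal (unit_ball_vol (real (2 * CARD('k))) * (real CARD('k) * \<delta> * a ^ (CARD('k) - 1)))
    \<le> emeasure lborel (w_shell a (a + \<delta>) :: (complex ^ 'k::finite) set)"
  unfolding emeasure_w_shell[OF assms]
  using power_increment_bounds(1)[of a \<delta> "CARD('k) - 1"] assms
  by (intro ennreal_leI mult_left_mono) (simp_all add: less_imp_le unit_ball_vol_pos)

text \<open>Negative \<open>a\<close> occurs over points with \<open>r z > - \<epsilon>\<close>. The
  fibre is then a ball of squared radius \<open>a + \<delta> \<le> \<delta>\<close>, and one of the
  \<open>CARD('k)\<close> factors of its volume is absorbed by \<delta>. The maximum covers the
  empty fibres.\<close>

lemma emeasure_w_shell_le: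
  assumes "0 < \<delta>"
  shows "emeasure lborel (w_shell a (a + \<delta>) :: (complex ^ 'k::finite) set)
    \<le> ennreal (unit_ball_vol (real (2 * CARD('k))) * (real CARD('k) * \<delta> * (max 0 (a + \<delta>)) ^ (CARD('k) - 1)))"
proof -
  let ?v = "unit_ball_vol (real (2 * CARD('k)))"
  have v: "0 \<le> ?v" by (simp add: less_imp_le unit_ball_vol_pos)
  consider "0 \<le> a" | "a < 0" "0 < a + \<delta>" | "a + \<delta> \<le> 0" by linarith
  then show ?thesis
  proof cases
    case 1
    then show ?thesis
      unfolding emeasure_w_shell[OF 1 assms]
      using power_increment_bounds(2)[of a \<delta> "CARD('k) - 1"] assms v
      by (intro ennreal_leI mult_left_mono) (simp_all add: max_def)
  next
    case 2
    have "w_shell a (a + \<delta>) \<subseteq> ball (0::complex^'k) (sqrt (a + \<delta>))"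
      by (auto simp: w_shell_def intro: real_less_rsqrt)
    then have "emeasure lborel (w_shell a (a + \<delta>) :: (complex ^ 'k) set) \<le>
        emeasure lborel (ball (0::complex^'k) (sqrt (a + \<delta>)))"
      by (intro emeasure_mono) auto
    also have "\<dots> = ennreal (?v * (a + \<delta>) ^ CARD('k))"
      using 2 by (simp add: emeasure_ball power_mult mult.commute[of _ 2])
    also have "\<dots> \<le> ennreal (?v * (real CARD('k) * \<delta> * (max 0 (a + \<delta>)) ^ (CARD('k) - 1)))"
    proof (intro ennreal_leI mult_left_mono v)
      have "(a + \<delta>) ^ CARD('k) = (a + \<delta>) * (a + \<delta>) ^ (CARD('k) - 1)"
        by (simp flip: power_Suc)
      also have "\<dots> \<le> (real CARD('k) * \<delta>) * (a + \<delta>) ^ (CARD('k) - 1)"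
      proof (rule mult_right_mono)
        have "1 * \<delta> \<le> real CARD('k) * \<delta>"
          using assms by (intro mult_right_mono) (auto simp: Suc_le_eq)
        then show "a + \<delta> \<le> real CARD('k) * \<delta>" using 2 by linarith
      qed (use 2 in simp)
      finally show "(a + \<delta>) ^ CARD('k) \<le> real CARD('k) * \<delta> * (max 0 (a + \<delta>)) ^ (CARD('k) - 1)"
        using 2 by simp
    qed
    finally show ?thesis .
  next
    case 3
    then have "w_shell a (a + \<delta>) = ({} :: (complex ^ 'k) set)"
      by (auto simp: w_shell_def) (metis less_le_trans not_less zero_le_power2)
    then show ?thesis by simp
  qed
qed

text \<open>The shell and Lebesgue measure are invariant under multiplication of \<open>w\<close> by
  a unimodular scalar, so the integral may be averaged over these rotations. For fixed
  \<open>w\<close> the average runs over a circle and dominates the value at its centre. The centre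
  0 may lie outside the shell; holomorphy is required on the whole disc bounded by the circle
  through \<open>w\<close>.\<close>

lemma submean_w_shell:
  fixes h :: "complex ^ 'k::finite \<Rightarrow> complex"
  assumes \<Phi>: "submean_gauge \<Phi>"
    and cont: "continuous_on (w_shell a b) h"
    and holo: "\<And>w. w \<in> w_shell a b \<Longrightarrow> \<exists>R>1. (\<lambda>c. h (c *s w)) holomorphic_on ball 0 R"
  shows "ennreal (\<Phi> (norm (h 0))) * emeasure lborel (w_shell a b :: (complex ^ 'k) set)
    \<le> (\<integral>\<^sup>+w\<in>w_shell a b. ennreal (\<Phi> (norm (h w))) \<partial>lborel)"
proof -
  let ?S = "w_shell a b :: (complex ^ 'k) set"
  define f where "f w = ennreal (\<Phi> (norm (h w))) * indicator ?S w" for w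
  have S [measurable]: "?S \<in> sets borel" by (intro borel_open open_w_shell)
  have f_meas [measurable]: "f \<in> borel_measurable borel"
  proof -
    have "(\<lambda>w. indicator ?S w *\<^sub>R \<Phi> (norm (h w))) \<in> borel_measurable borel"
      by (intro borel_measurable_continuous_on_indicator S submean_gauge_continuous[OF \<Phi>] cont)
    then have "(\<lambda>w. ennreal (indicator ?S w *\<^sub>R \<Phi> (norm (h w)))) \<in> borel_measurable borel"
      by measurable
    moreover have "ennreal (indicator ?S w *\<^sub>R \<Phi> (norm (h w))) = f w" for w
      by (simp add: f_def indicator_def)
    ultimately show ?thesis by simp
  qed
  have S_rot: "unit_circle t *s w \<in> ?S \<longleftrightarrow> w \<in> ?S" for t w
    by (simp add: w_shell_def norm_smult_vec)
  have rot_meas [measurable]: "(\<lambda>(t, w). unit_circle t *s w) \<in> borel \<Otimes>\<^sub>M borel \<rightarrow>\<^sub>M (borel :: (complex ^ 'k) measure)"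
  proof -
    have "continuous_on UNIV (\<lambda>x::real \<times> (complex ^ 'k). unit_circle (fst x) *s snd x)"
      by (intro continuous_intros continuous_on_compose2[OF continuous_on_unit_circle[of UNIV]]) auto
    then show ?thesis unfolding borel_prod split_beta by (rule borel_measurable_continuous_onI)
  qed
  have "(\<integral>\<^sup>+w. f w \<partial>lborel) = (\<integral>\<^sup>+t. (\<integral>\<^sup>+w. f w \<partial>lborel) * indicator {0..1::real} t \<partial>lborel)"
    by (simp add: nn_integral_cmult)
  also have "\<dots> = (\<integral>\<^sup>+t. \<integral>\<^sup>+w. f (unit_circle t *s w) * indicator {0..1::real} t \<partial>lborel \<partial>lborel)"
  proof (rule nn_integral_cong)
    fix t :: real
    have "(\<lambda>w. f (unit_circle t *s w)) \<in> borel_measurable borel"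
      using measurable_compose[OF measurable_Pair1' rot_meas, of t] by (intro measurable_compose[OF _ f_meas]) auto
    then show "(\<integral>\<^sup>+w. f w \<partial>lborel) * indicator {0..1} t = (\<integral>\<^sup>+w. f (unit_circle t *s w) * indicator {0..1} t \<partial>lborel)"
      by (simp add: nn_integral_multc nn_integral_rotation)
  qed
  also have "\<dots> = (\<integral>\<^sup>+w. \<integral>\<^sup>+t. f (unit_circle t *s w) * indicator {0..1::real} t \<partial>lborel \<partial>lborel)"
  proof (rule lborel_pair.Fubini'[symmetric])
    have "(\<lambda>x. f (case x of (t, w) \<Rightarrow> unit_circle t *s w) * indicator {0..1} (fst x))
        \<in> borel_measurable (lborel \<Otimes>\<^sub>M (lborel :: (complex ^ 'k) measure))"
      by measurable
    then show "(\<lambda>(t, w). f (unit_circle t *s w) * indicator {0..1::real} t) \<in> borel_measurable (lborel \<Otimes>\<^sub>M lborel)"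
      by (simp add: split_beta)
  qed
  also have "\<dots> \<ge> (\<integral>\<^sup>+w. ennreal (\<Phi> (norm (h 0))) * indicator ?S w \<partial>lborel)"
  proof (rule nn_integral_mono)
    fix w
    show "ennreal (\<Phi> (norm (h 0))) * indicator ?S w \<le> (\<integral>\<^sup>+t. f (unit_circle t *s w) * indicator {0..1::real} t \<partial>lborel)"
    proof (cases "w \<in> ?S")
      case True
      obtain R where R: "1 < R" "(\<lambda>c. h (c *s w)) holomorphic_on ball 0 R" using holo[OF True] by auto
      have "continuous_on {0..1} (\<lambda>t. h (unit_circle t *s w))"
      proof (rule continuous_on_compose2[OF cont])
        show "(\<lambda>t. unit_circle t *s w) ` {0..1} \<subseteq> w_shell a b" using True S_rot by blast
      qed (intro continuous_intros)
      then have "((\<lambda>t. \<Phi> (norm (h (unit_circle t *s w)))) has_integral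
          integral {0..1} (\<lambda>t. \<Phi> (norm (h (unit_circle t *s w))))) {0..1}"
        by (intro integrable_integral integrable_continuous_real submean_gauge_continuous[OF \<Phi>])
      from nn_integral_has_integral_lebesgue[OF _ this]
      have "(\<integral>\<^sup>+t. ennreal (indicator {0..1} t * \<Phi> (norm (h (unit_circle t *s w)))) \<partial>lborel) =
          ennreal (integral {0..1} (\<lambda>t. \<Phi> (norm (h (unit_circle t *s w)))))"
        using submean_gauge_nonneg[OF \<Phi>] by simp
      moreover have "ennreal (indicator {0..1} t * \<Phi> (norm (h (unit_circle t *s w)))) =
          f (unit_circle t *s w) * indicator {0..1} t" for t
        using True S_rot by (simp add: f_def indicator_def)
      ultimately show ?thesis
        using submean_holomorphic[OF \<Phi> R(2,1)] True by (simp add: ennreal_leI)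
    qed simp
  qed
  finally show ?thesis
    by (simp add: f_def nn_integral_cmult S)
qed

section \<open>Geometry of the lift\<close>

lemma gderiv_unique:
  assumes "GDERIV s x :> D" "GDERIV s x :> E"
  shows "D = E"
proof -
  have "(\<lambda>h. h \<bullet> D) = (\<lambda>h. h \<bullet> E)"
    using assms has_derivative_unique unfolding gderiv_def by blast
  then have "(D - E) \<bullet> D = (D - E) \<bullet> E" by metis
  then have "(D - E) \<bullet> (D - E) = 0" by (simp add: inner_diff_right)
  then show ?thesis by simp
qed

lemma smooth_gradient:
  assumes "smooth r"
  obtains gr where "\<And>z. GDERIV r z :> gr z" "continuous_on UNIV gr"
proof
  let ?r' = "\<lambda>z. frechet_derivative r (at z)"
  have diff: "iterated_deriv vs r differentiable at x" for vs x
    using assms by (simp add: smooth_def)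
  have der: "(r has_derivative ?r' z) (at z)" for z
    using diff[of "[]"] by (simp add: frechet_derivative_works)
  have cont: "continuous_on UNIV (\<lambda>z. ?r' z v)" for v
    using diff[of "[v]"] by (simp add: differentiable_imp_continuous_within continuous_at_imp_continuous_on)
  show "GDERIV r z :> (\<Sum>b\<in>Basis. ?r' z b *\<^sub>R b)" for z
  proof -
    have "?r' z h = h \<bullet> (\<Sum>b\<in>Basis. ?r' z b *\<^sub>R b)" for h
    proof -
      have lin: "linear (?r' z)" using der has_derivative_linear by blast
      have "?r' z h = ?r' z (\<Sum>b\<in>Basis. (h \<bullet> b) *\<^sub>R b)"
        by (simp add: euclidean_representation)
      also have "\<dots> = (\<Sum>b\<in>Basis. (h \<bullet> b) *\<^sub>R ?r' z b)"
        using lin by (simp add: linear_sum linear_scale)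
      also have "\<dots> = h \<bullet> (\<Sum>b\<in>Basis. ?r' z b *\<^sub>R b)"
        by (simp add: inner_sum_right mult.commute)
      finally show ?thesis .
    qed
    then have "?r' z = (\<lambda>h. h \<bullet> (\<Sum>b\<in>Basis. ?r' z b *\<^sub>R b))" by blast
    then show ?thesis using der[of z] unfolding gderiv_def by simp
  qed
  show "continuous_on UNIV (\<lambda>z. \<Sum>b\<in>Basis. ?r' z b *\<^sub>R b)"
    by (intro continuous_intros cont)
qed

text \<open>Compactness of the closed layer turns the nonvanishing gradient into a lower bound, and
  uniform continuity of the gradient keeps half of the resulting slope up to a fixed distance
  \<rho>.\<close>

lemma regular_levels_exist:
  fixes s :: "'a::euclidean_space \<Rightarrow> real"
  assumes dim: "2 \<le> DIM('a)" and grad: "\<And>x. GDERIV s x :> g x" and cont: "continuous_on UNIV g"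
    and bdd: "bounded {x. - e0 \<le> s x \<and> s x < 0}"
    and nz: "\<And>x. x \<in> closure {x. - e0 \<le> s x \<and> s x < 0} \<Longrightarrow> g x \<noteq> 0"
  shows "\<exists>m L \<rho>. regular_levels s e0 m L \<rho>"
proof -
  let ?P = "{x. - e0 \<le> s x \<and> s x < 0}"
  have der: "(s has_derivative (\<lambda>h. h \<bullet> g x)) (at x)" for x
    using grad by (simp add: gderiv_def)
  have s_cont: "continuous_on UNIV s"
    using der has_derivative_continuous continuous_at_imp_continuous_on by blast
  have "compact (closure ?P)" using bdd by (simp add: compact_closure)
  have "\<exists>\<mu>>0. \<forall>x\<in>closure ?P. \<mu> \<le> norm (g x)"
  proof (cases "closure ?P = {}")
    case True
    show ?thesis
    proof (intro exI conjI ballI)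
      show "(0::real) < 1" by simp
      fix x assume "x \<in> closure ?P"
      then have "x \<in> {}" unfolding True .
      then show "1 \<le> norm (g x)" by simp
    qed
  next
    case False
    have "continuous_on (closure ?P) (\<lambda>x. norm (g x))"
      by (rule continuous_on_norm[OF continuous_on_subset[OF cont subset_UNIV]])
    from continuous_attains_inf[OF \<open>compact (closure ?P)\<close> False this]
    obtain x0 where x0: "x0 \<in> closure ?P" "\<And>x. x \<in> closure ?P \<Longrightarrow> norm (g x0) \<le> norm (g x)" by blast
    then show ?thesis using nz[OF x0(1)] by (intro exI[of _ "norm (g x0)"]) auto
  qed
  then obtain \<mu> where \<mu>: "0 < \<mu>" "\<And>x. x \<in> closure ?P \<Longrightarrow> \<mu> \<le> norm (g x)" by blast
  \<comment> \<open>A vector of norm at least \<mu> has a coordinate of absolute value at least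
    \<open>\<mu> / DIM('a) = 2 * m\<close>; one \<open>m\<close> is reserved for the variation of
    \<open>g\<close> within distance \<rho>.\<close>
  define m where "m = \<mu> / (2 * DIM('a))"
  have m: "0 < m" using \<mu>(1) by (simp add: m_def)
  obtain B where B: "\<And>x. x \<in> ?P \<Longrightarrow> norm x \<le> B" using bdd unfolding bounded_iff by blast
  \<comment> \<open>One unit larger than a ball containing the layer, so that segments of length at
    most \<open>\<rho> \<le> 1\<close> starting in the layer stay inside; its convexity serves the
    Lipschitz bound.\<close>
  let ?K = "cball (0::'a) (B + 1)"
  have near: "y \<in> ?K" if "x \<in> ?P" "dist x y \<le> 1" for x y
  proof -
    have "norm y \<le> norm x + dist x y"
      using norm_triangle_ineq2[of y x] by (simp add: dist_norm norm_minus_commute)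
    then show ?thesis using B[OF that(1)] that(2) by simp
  qed
  have "uniformly_continuous_on ?K g"
    using continuous_on_subset[OF cont subset_UNIV] compact_cball by (rule compact_uniformly_continuous)
  from this[unfolded uniformly_continuous_on_def, rule_format, OF m]
  obtain d where d: "0 < d" "\<And>x y. x \<in> ?K \<Longrightarrow> y \<in> ?K \<Longrightarrow> dist y x < d \<Longrightarrow> dist (g y) (g x) < m"
    by blast
  define \<rho> where "\<rho> = min 1 (d / 2)"
  have \<rho>: "0 < \<rho>" "\<rho> \<le> 1" "\<rho> < d" using d(1) by (auto simp: \<rho>_def)
  have "bounded (g ` ?K)"
    by (intro compact_imp_bounded compact_continuous_image compact_cball continuous_on_subset[OF cont subset_UNIV])
  then obtain L where L: "0 < L" "\<And>x. x \<in> ?K \<Longrightarrow> norm (g x) \<le> L"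
    unfolding bounded_pos by auto
  have "regular_levels s e0 m L \<rho>"
  proof
    fix x assume x: "- e0 \<le> s x" "s x < 0"
    have "\<exists>b\<in>Basis. 2 * m \<le> \<bar>g x \<bullet> b\<bar>"
    proof (rule ccontr)
      assume "\<not> ?thesis"
      then have "(\<Sum>b\<in>Basis. \<bar>g x \<bullet> b\<bar>) < (\<Sum>b\<in>(Basis::'a set). 2 * m)"
        by (intro sum_strict_mono) auto
      also have "\<dots> = \<mu>" by (simp add: m_def)
      finally have "norm (g x) < \<mu>" using norm_le_l1[of "g x"] by linarith
      have "x \<in> ?P" using x by simp
      then have "x \<in> closure ?P" using closure_subset[of ?P] by (rule rev_subsetD)
      with \<open>norm (g x) < \<mu>\<close> show False using \<mu>(2)[of x] by linarith
    qed
    then obtain b where b: "b \<in> Basis" "2 * m \<le> \<bar>g x \<bullet> b\<bar>" by blast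
    define v where "v = (if 0 \<le> g x \<bullet> b then b else - b)"
    have v: "v \<in> Basis \<or> - v \<in> Basis" "norm v = 1" "2 * m \<le> v \<bullet> g x"
      using b by (auto simp: v_def inner_commute)
    \<comment> \<open>Allowing both signs of the parameter makes one monotonicity statement yield
      both inequalities of the locale.\<close>
    have mono: "s (x + t1 *\<^sub>R v) - m * t1 \<le> s (x + t2 *\<^sub>R v) - m * t2"
      if t: "- \<rho> \<le> t1" "t1 \<le> t2" "t2 \<le> \<rho>" for t1 t2
    proof (rule DERIV_nonneg_imp_nondecreasing[of t1 t2 "\<lambda>t. s (x + t *\<^sub>R v) - m * t"])
      fix t assume "t1 \<le> t" "t \<le> t2"
      then have t: "\<bar>t\<bar> \<le> \<rho>" using t by linarith
      have "((\<lambda>t. s (x + t *\<^sub>R v)) has_derivative (\<lambda>h. (h *\<^sub>R v) \<bullet> g (x + t *\<^sub>R v))) (at t)"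
        by (rule has_derivative_compose[OF _ der]) (auto intro!: derivative_eq_intros)
      then have "((\<lambda>t. s (x + t *\<^sub>R v)) has_field_derivative (v \<bullet> g (x + t *\<^sub>R v))) (at t)"
        unfolding has_field_derivative_def by (rule has_derivative_eq_rhs) (auto simp: mult.commute)
      then have "((\<lambda>t. s (x + t *\<^sub>R v) - m * t) has_field_derivative (v \<bullet> g (x + t *\<^sub>R v) - m)) (at t)"
        by (auto intro!: derivative_eq_intros)
      moreover have "0 \<le> v \<bullet> g (x + t *\<^sub>R v) - m"
      proof -
        have "dist (x + t *\<^sub>R v) x \<le> \<rho>" using t v(2) by (simp add: dist_norm)
        then have "dist (g (x + t *\<^sub>R v)) (g x) < m"
          using x \<rho> by (intro d(2) near[of x]) (auto simp: dist_commute)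
        moreover have "\<bar>v \<bullet> (g (x + t *\<^sub>R v) - g x)\<bar> \<le> dist (g (x + t *\<^sub>R v)) (g x)"
          using Cauchy_Schwarz_ineq2[of v "g (x + t *\<^sub>R v) - g x"] v(2) by (simp add: dist_norm)
        ultimately show ?thesis using v(3) by (simp add: inner_diff_right)
      qed
      ultimately show "\<exists>y. ((\<lambda>t. s (x + t *\<^sub>R v) - m * t) has_real_derivative y) (at t) \<and> 0 \<le> y" by blast
    qed (use t in simp)
    have "\<forall>t\<in>{0..\<rho>}. s x + m * t \<le> s (x + t *\<^sub>R v) \<and> s (x - t *\<^sub>R v) \<le> s x - m * t"
    proof
      fix t assume "t \<in> {0..\<rho>}"
      then show "s x + m * t \<le> s (x + t *\<^sub>R v) \<and> s (x - t *\<^sub>R v) \<le> s x - m * t"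
        using mono[of 0 t] mono[of "- t" 0] by auto
    qed
    with v(1) show "\<exists>v. (v \<in> Basis \<or> - v \<in> Basis) \<and>
        (\<forall>t\<in>{0..\<rho>}. s x + m * t \<le> s (x + t *\<^sub>R v) \<and> s (x - t *\<^sub>R v) \<le> s x - m * t)" by blast
    fix y assume y: "dist x y \<le> \<rho>"
    have "norm (s y - s x) \<le> L * norm (y - x)"
    proof (rule differentiable_bound[of ?K])
      show "(s has_derivative (\<lambda>h. h \<bullet> g u)) (at u within ?K)" for u
        using der has_derivative_at_withinI by blast
      show "onorm (\<lambda>h. h \<bullet> g u) \<le> L" if "u \<in> ?K" for u
      proof (rule onorm_le)
        fix h
        have "norm (h \<bullet> g u) \<le> norm h * norm (g u)" using Cauchy_Schwarz_ineq2 by simp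
        also have "\<dots> \<le> norm h * L" using L(2)[OF that] by (intro mult_left_mono) auto
        finally show "norm (h \<bullet> g u) \<le> L * norm h" by (simp add: mult.commute)
      qed
      show "x \<in> ?K" "y \<in> ?K" using near[of x x] near[of x y] x y \<rho>(2) by auto
    qed simp
    then show "\<bar>s y - s x\<bar> \<le> L * dist x y" by (simp add: dist_norm norm_minus_commute)
  qed (use dim s_cont m L(1) \<rho>(1) in auto)
  then show ?thesis by blast
qed

locale lifted_domain =
  fixes r :: "complex ^ 'n::finite \<Rightarrow> real" and lr :: "complex ^ ('n + 'k::finite) \<Rightarrow> real" and e0 :: real
  assumes dom: "is_domain r" and lr: "lr = lift r" and small: "small_enough lr e0"
begin

abbreviation "\<Omega> \<equiv> sublevel r"

lemma lr_join: "lr (join z w) = r z + (norm w)\<^sup>2"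
  by (simp add: lr lift_def)

lemma lr_ge: "r (zpart \<zeta>) \<le> lr \<zeta>"
  by (simp add: lr lift_def)

lemma zpart_sublevel: "lr \<zeta> < 0 \<Longrightarrow> zpart \<zeta> \<in> \<Omega>"
  using lr_ge[of \<zeta>] by (simp add: sublevel_def)

lemma open_\<Omega>: "open \<Omega>" and bounded_\<Omega>: "bounded \<Omega>"
  using dom by (simp_all add: is_domain_def)

lemma e0_pos: "0 < e0"
  using small by (simp add: small_enough_def)

lemma continuous_r: "continuous_on UNIV r"
proof -
  have "smooth r" using dom by (simp add: is_domain_def)
  then have "r differentiable at z" for z
    unfolding smooth_def using iterated_deriv.simps(1)[of r] by metis
  then show ?thesis
    by (simp add: continuous_at_imp_continuous_on differentiable_imp_continuous_within)
qed

lemma continuous_lr: "continuous_on UNIV lr"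
  unfolding lr lift_def[abs_def] by (intro continuous_intros continuous_on_compose2[OF continuous_r]) auto

lemma r_lower: "\<exists>M\<ge>0. \<forall>z\<in>\<Omega>. - r z \<le> M"
proof -
  have "bounded (r ` closure \<Omega>)"
    using bounded_\<Omega> continuous_r
    by (intro compact_imp_bounded compact_continuous_image) (auto simp: compact_closure intro: continuous_on_subset)
  then obtain M where "0 < M" "\<And>z. z \<in> closure \<Omega> \<Longrightarrow> \<bar>r z\<bar> \<le> M"
    unfolding bounded_pos by auto
  then show ?thesis using closure_subset[of \<Omega>] by (intro exI[of _ M]) (auto simp: abs_le_iff)
qed

lemma bounded_sublevel_lr: "bounded (sublevel lr)"
proof -
  obtain M where M: "0 \<le> M" "\<And>z. z \<in> \<Omega> \<Longrightarrow> - r z \<le> M" using r_lower by blast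
  obtain B where B: "\<And>z. z \<in> \<Omega> \<Longrightarrow> norm z \<le> B" using bounded_\<Omega> unfolding bounded_iff by blast
  have "norm \<zeta> \<le> sqrt (B\<^sup>2 + M)" if "\<zeta> \<in> sublevel lr" for \<zeta>
  proof -
    have z: "zpart \<zeta> \<in> \<Omega>" using that zpart_sublevel by (simp add: sublevel_def)
    have "(norm (wpart \<zeta>))\<^sup>2 \<le> M"
      using that M(2)[OF z] by (simp add: sublevel_def lr lift_def)
    moreover have "(norm (zpart \<zeta>))\<^sup>2 \<le> B\<^sup>2" using B[OF z] by (intro power_mono) auto
    ultimately show ?thesis by (intro real_le_rsqrt) (simp add: norm_zpart_wpart[of \<zeta>])
  qed
  then show ?thesis unfolding bounded_iff by blast
qed

lemma compact_lr_le: assumes "c < 0" shows "compact {\<zeta>. lr \<zeta> \<le> c}"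
proof -
  have "{\<zeta>. lr \<zeta> \<le> c} \<subseteq> sublevel lr" using assms by (auto simp: sublevel_def)
  then show ?thesis
    unfolding compact_eq_bounded_closed
    using bounded_subset[OF bounded_sublevel_lr] continuous_lr
    by (auto intro!: closed_Collect_le continuous_intros)
qed

text \<open>The gradient of the lift is (grad r, 2 w), so a critical point has
  \<open>wpart \<zeta> = 0\<close>. Where \<open>lr \<zeta> < 0\<close> it is excluded by
  \<open>small_enough\<close>. The closed layer also contains points with
  \<open>lr \<zeta> = 0\<close>; there a critical point would project to a boundary point of
  \<Omega> at which the gradient of \<open>r\<close> vanishes.\<close>

lemma regular: "\<exists>m L \<rho>. regular_levels lr e0 m L \<rho>"
proof -
  have "smooth r" using dom by (simp add: is_domain_def)
  then obtain gr where gr: "\<And>z. GDERIV r z :> gr z" "continuous_on UNIV gr" using smooth_gradient by metis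
  define g where "g \<zeta> = join (gr (zpart \<zeta>)) (2 *\<^sub>R wpart \<zeta>)" for \<zeta> :: "complex ^ ('n + 'k)"
  let ?P = "{\<zeta>. - e0 \<le> lr \<zeta> \<and> lr \<zeta> < 0}"
  show ?thesis
  proof (rule regular_levels_exist)
    have "0 < CARD('n)" by simp
    then have "2 \<le> CARD('n) * 2 + CARD('k) * 2" by linarith
    then show "2 \<le> DIM(complex ^ ('n + 'k))" by simp
    show grad: "GDERIV lr \<zeta> :> g \<zeta>" for \<zeta>
    proof -
      have 1: "((\<lambda>\<zeta>. r (zpart \<zeta>)) has_derivative (\<lambda>h. zpart h \<bullet> gr (zpart \<zeta>))) (at \<zeta>)"
        using gr(1)[of "zpart \<zeta>"] unfolding gderiv_def
        by (rule has_derivative_compose[OF bounded_linear.has_derivative[OF bounded_linear_zpart has_derivative_ident]])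
      have 2: "((\<lambda>\<zeta>. wpart \<zeta> \<bullet> wpart \<zeta>) has_derivative
                 (\<lambda>h. wpart \<zeta> \<bullet> wpart h + wpart h \<bullet> wpart \<zeta>)) (at \<zeta>)"
        by (intro has_derivative_inner bounded_linear.has_derivative[OF bounded_linear_wpart]
              has_derivative_ident)
      show ?thesis
        using has_derivative_add[OF 1 2] unfolding gderiv_def
        by (simp add: lr lift_def[abs_def] power2_norm_eq_inner g_def inner_zpart_wpart inner_commute)
    qed
    show "continuous_on UNIV g"
      unfolding g_def[abs_def] by (intro continuous_intros continuous_on_compose2[OF gr(2)]) auto
    show "bounded ?P"
      by (rule bounded_subset[OF bounded_sublevel_lr]) (auto simp: sublevel_def)
    show "g \<zeta> \<noteq> 0" if \<zeta>: "\<zeta> \<in> closure ?P" for \<zeta>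
    proof
      assume g0: "g \<zeta> = 0"
      have "closed {\<zeta>. - e0 \<le> lr \<zeta> \<and> lr \<zeta> \<le> 0}"
        using continuous_lr by (intro closed_Collect_conj closed_Collect_le continuous_intros)
      then have "closure ?P \<subseteq> {\<zeta>. - e0 \<le> lr \<zeta> \<and> lr \<zeta> \<le> 0}" by (intro closure_minimal) auto
      then have lr_\<zeta>: "- e0 \<le> lr \<zeta>" "lr \<zeta> \<le> 0" using \<zeta> by auto
      have parts: "gr (zpart \<zeta>) = 0" "wpart \<zeta> = 0"
        using arg_cong[OF g0, of zpart] arg_cong[OF g0, of wpart] by (simp_all add: g_def)
      show False
      proof (cases "lr \<zeta> < 0")
        case True
        then have "grad_nonzero lr \<zeta>"
          using small lr_\<zeta> unfolding small_enough_def by (metis minus_le_iff minus_minus neg_0_less_iff_less)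
        then show False using gderiv_unique[OF grad] g0 unfolding grad_nonzero_def by metis
      next
        case False
        then have "r (zpart \<zeta>) = 0" using lr_\<zeta> parts(2) by (simp add: lr lift_def)
        moreover have "zpart \<zeta> \<in> closure \<Omega>"
        proof -
          have "zpart ` closure ?P \<subseteq> closure (zpart ` ?P)"
            by (intro image_closure_subset closure_subset closed_closure continuous_intros)
          also have "\<dots> \<subseteq> closure \<Omega>" using zpart_sublevel by (intro closure_mono) auto
          finally show ?thesis using \<zeta> by blast
        qed
        ultimately have "zpart \<zeta> \<in> frontier \<Omega>"
          using open_\<Omega> by (simp add: frontier_def interior_open sublevel_def)
        then have "grad_nonzero r (zpart \<zeta>)" using dom by (simp add: is_domain_def)
        then show False using gderiv_unique[OF gr(1)] parts(1) unfolding grad_nonzero_def by metis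
      qed
    qed
  qed
qed

end

section \<open>Restriction and extension\<close>

lemma holomorphic_continuous_on:
  assumes "holomorphic F D"
  shows "continuous_on D F"
proof (rule continuous_at_imp_continuous_on, rule ballI)
  fix z assume "z \<in> D"
  then obtain L where "(F has_derivative L) (at z)" using assms unfolding holomorphic_def by blast
  then show "isCont F z" by (rule has_derivative_continuous)
qed

text \<open>By complex linearity the derivative along the line spanned by \<open>w\<close> is
  multiplication by the number \<open>L (join 0 w)\<close>, which is differentiability in the
  one-variable sense.\<close>

lemma holomorphic_slice:
  fixes F :: "complex ^ ('n::finite + 'k::finite) \<Rightarrow> complex"
  assumes F: "holomorphic F D" and D: "\<And>c. c \<in> B \<Longrightarrow> join z (c *s w) \<in> D"
  shows "(\<lambda>c. F (join z (c *s w))) holomorphic_on B"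
proof -
  have diff: "(\<lambda>c. F (join z (c *s w))) field_differentiable (at c)" if c: "c \<in> B" for c
  proof -
    obtain L where L: "(F has_derivative L) (at (join z (c *s w)))" "\<And>c v. L (c *s v) = c * L v"
      using F D[OF c] unfolding holomorphic_def by blast
    have eq: "join z (c *s w) = join z 0 + c *s join 0 w" for c
      by (simp add: join_smult[symmetric] join_add[symmetric])
    have "bounded_linear (\<lambda>c. c *s join 0 w :: complex ^ ('n + 'k))"
      by (rule bounded_bilinear.bounded_linear_left[OF bounded_bilinear_smult_vec])
    then have "((\<lambda>c. join z 0 + c *s join 0 w) has_derivative (\<lambda>h. 0 + h *s join 0 w :: complex ^ ('n + 'k))) (at c)"
      by (intro has_derivative_add has_derivative_const bounded_linear_imp_has_derivative)
    then have "((\<lambda>c. join z (c *s w)) has_derivative (\<lambda>h. h *s join 0 w)) (at c)"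
      unfolding eq by simp
    from has_derivative_compose[OF this L(1)]
    have "((\<lambda>c. F (join z (c *s w))) has_derivative (\<lambda>h. L (join 0 w) * h)) (at c)"
      by (simp add: L(2) mult.commute)
    then show ?thesis
      unfolding field_differentiable_def has_field_derivative_def by blast
  qed
  have "(\<lambda>c. F (join z (c *s w))) field_differentiable (at c within B)" if "c \<in> B" for c
    by (rule field_differentiable_at_within[OF diff[OF that]])
  then show ?thesis by (rule holomorphic_onI)
qed

text \<open>The case \<open>j = 0\<close> is separate because the general formula would give there
  the area \<pi> of the unit disc instead of 1.\<close>

definition dm_const :: "nat \<Rightarrow> real" where
  "dm_const j = (if j = 0 then 1 else real (j + 1) * unit_ball_vol (real (2 * (j + 1))))"

lemma dm_const_pos: "0 < dm_const j"
  by (simp add: dm_const_def)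

section \<open>Comparison of the weight with surface measure on the levels\<close>

lemma nn_integral_dm:
  assumes r: "continuous_on UNIV r" and S: "open (sublevel r)"
    and h: "h \<in> borel_measurable (restrict_space lborel (sublevel r))"
  shows "(\<integral>\<^sup>+z. h z \<partial>dm r j) = ennreal (dm_const j) * (\<integral>\<^sup>+z\<in>sublevel r. ennreal ((- r z) ^ j) * h z \<partial>lborel)"
proof -
  have [measurable]: "r \<in> borel_measurable borel" using r by (rule borel_measurable_continuous_onI)
  let ?R = "restrict_space lborel (sublevel r)"
  have w: "(\<lambda>z. ennreal ((- r z) ^ j)) \<in> borel_measurable ?R"
    by (rule measurable_restrict_space1) measurable
  have wt: "(if j = 0 then 1 else real (j + 1) * unit_ball_vol (real (2 * (j + 1))) * (- r z) ^ j)
      = dm_const j * (- r z) ^ j" for z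
    by (simp add: dm_const_def)
  have "(\<integral>\<^sup>+z. h z \<partial>dm r j) = (\<integral>\<^sup>+z. ennreal (dm_const j * (- r z) ^ j) * h z \<partial>?R)"
    unfolding dm_def wt using h
    by (subst nn_integral_density) (auto intro!: measurable_restrict_space1)
  also have "\<dots> = (\<integral>\<^sup>+z. ennreal (dm_const j) * (ennreal ((- r z) ^ j) * h z) \<partial>?R)"
    using dm_const_pos[of j] by (simp add: ennreal_mult' mult.assoc)
  also have "\<dots> = ennreal (dm_const j) * (\<integral>\<^sup>+z. ennreal ((- r z) ^ j) * h z \<partial>?R)"
    by (rule nn_integral_cmult[OF borel_measurable_times_ennreal[OF w h]])
  also have "(\<integral>\<^sup>+z. ennreal ((- r z) ^ j) * h z \<partial>?R) = (\<integral>\<^sup>+z\<in>sublevel r. ennreal ((- r z) ^ j) * h z \<partial>lborel)"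
    using S by (intro nn_integral_restrict_space) auto
  finally show ?thesis .
qed

text \<open>The coefficient of \<open>\<delta> * a ^ (k - 1)\<close> in the volume of a thin shell.
  It equals \<open>dm_const (k - 1)\<close> for \<open>k \<ge> 2\<close>, but is \<pi> instead of 1
  for \<open>k = 1\<close>.\<close>

definition shell_const :: "'k::finite itself \<Rightarrow> real" where
  "shell_const _ = unit_ball_vol (real (2 * CARD('k))) * real CARD('k)"

lemma shell_const_pos: "0 < shell_const TYPE('k::finite)"
  by (simp add: shell_const_def)

text \<open>Unlike \<open>dm\<close>, which is restricted to \<Omega>, this measure lives on the
  whole space, with an indicator in its density, so that it can be compared as a measure with a
  push-forward along \<open>zpart\<close>. The normalising constant is left out.\<close>

definition weighted :: "(complex ^ 'n::finite \<Rightarrow> real) \<Rightarrow> nat \<Rightarrow> (complex ^ 'n) measure" where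
  "weighted r j = density lborel (\<lambda>z. ennreal ((- r z) ^ j) * indicator (sublevel r) z)"

lemma sets_weighted [simp, measurable_cong]: "sets (weighted r j) = sets borel"
  and space_weighted [simp]: "space (weighted r j) = UNIV"
  by (simp_all add: weighted_def)

context lifted_domain
begin

abbreviation "level \<epsilon> \<equiv> {\<zeta>. lr \<zeta> = - \<epsilon>}"
lemma borel_r [measurable]: "r \<in> borel_measurable borel" and borel_lr [measurable]: "lr \<in> borel_measurable borel"
  using continuous_r continuous_lr by (auto intro: borel_measurable_continuous_onI)

lemma borel_zpart [measurable]: "zpart \<in> borel_measurable borel"
  by (intro borel_measurable_continuous_onI continuous_intros)

lemma borel_\<Omega> [measurable]: "\<Omega> \<in> sets borel"
  using open_\<Omega> by simp

lemma emeasure_weighted: "B \<in> sets borel \<Longrightarrow>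
    emeasure (weighted r j) B = (\<integral>\<^sup>+z. ennreal ((- r z) ^ j) * indicator \<Omega> z * indicator B z \<partial>lborel)"
  unfolding weighted_def by (subst emeasure_density) auto

lemma weighted_finite: "emeasure (weighted r j) B < \<infinity>"
proof -
  obtain M where M: "0 \<le> M" "\<And>z. z \<in> \<Omega> \<Longrightarrow> - r z \<le> M" using r_lower by blast
  have "emeasure (weighted r j) B \<le> emeasure (weighted r j) UNIV"
    using emeasure_space[of "weighted r j" B] by simp
  also have "\<dots> = (\<integral>\<^sup>+z. ennreal ((- r z) ^ j) * indicator \<Omega> z * indicator UNIV z \<partial>lborel)"
    by (rule emeasure_weighted) simp
  also have "\<dots> \<le> (\<integral>\<^sup>+z. ennreal (M ^ j) * indicator \<Omega> z \<partial>lborel)"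
  proof (rule nn_integral_mono)
    fix z
    show "ennreal ((- r z) ^ j) * indicator \<Omega> z * indicator UNIV z \<le> ennreal (M ^ j) * indicator \<Omega> z"
      using M(2)[of z] by (cases "z \<in> \<Omega>") (auto simp: sublevel_def intro!: ennreal_leI power_mono)
  qed
  also have "\<dots> = ennreal (M ^ j) * emeasure lborel \<Omega>"
    by (simp add: nn_integral_cmult_indicator)
  also have "\<dots> < \<infinity>"
    using emeasure_bounded_finite[OF bounded_\<Omega>] by (simp add: ennreal_mult_less_top)
  finally show ?thesis .
qed

lemma join_in_shell: "- \<epsilon> < lr (join z w) \<and> lr (join z w) < - \<epsilon> + \<delta> \<longleftrightarrow>
    w \<in> w_shell (- \<epsilon> - r z) (- \<epsilon> - r z + \<delta>)"
  by (auto simp: lr_join w_shell_def)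

text \<open>Since \<open>\<delta> \<le> \<epsilon>\<close>, the outer squared radius
  \<open>- \<epsilon> - r z + \<delta>\<close> is at most \<open>- r z\<close>. So the fibres off
  \<Omega> are empty, and the weight bounds the fibre volume uniformly in \<epsilon>, also near the
  edge where the fibre is a ball.\<close>

lemma emeasure_shell_le:
  assumes "0 < \<delta>" "\<delta> \<le> \<epsilon>" and [measurable]: "B \<in> sets borel"
  shows "emeasure lborel {\<zeta>. - \<epsilon> < lr \<zeta> \<and> lr \<zeta> < - \<epsilon> + \<delta> \<and> zpart \<zeta> \<in> B}
    \<le> ennreal (shell_const TYPE('k) * \<delta>) * emeasure (weighted r (CARD('k) - 1)) B"
proof -
  let ?U = "{\<zeta>. - \<epsilon> < lr \<zeta> \<and> lr \<zeta> < - \<epsilon> + \<delta> \<and> zpart \<zeta> \<in> B}"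
  let ?W = "\<lambda>z. w_shell (- \<epsilon> - r z) (- \<epsilon> - r z + \<delta>) :: (complex ^ 'k) set"
  have U [measurable]: "?U \<in> sets borel" by measurable
  have "emeasure lborel ?U = (\<integral>\<^sup>+\<zeta>. indicator ?U \<zeta> \<partial>lborel)" by simp
  also have "\<dots> = (\<integral>\<^sup>+z. \<integral>\<^sup>+w. indicator ?U (join z w) \<partial>lborel \<partial>lborel)"
    by (rule nn_integral_join) measurable
  also have "\<dots> = (\<integral>\<^sup>+z. indicator B z * emeasure lborel (?W z) \<partial>lborel)"
  proof (rule nn_integral_cong)
    fix z
    have "indicator ?U (join z w) = indicator B z * (indicator (?W z) w :: ennreal)" for w
      using join_in_shell[of \<epsilon> z w \<delta>] by (auto simp: indicator_def)
    then show "(\<integral>\<^sup>+w. indicator ?U (join z w) \<partial>lborel) = indicator B z * emeasure lborel (?W z)"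
      by (simp add: nn_integral_cmult_indicator borel_open[OF open_w_shell])
  qed
  also have "\<dots> \<le> (\<integral>\<^sup>+z. ennreal (shell_const TYPE('k) * \<delta>) * (ennreal ((- r z) ^ (CARD('k) - 1)) * indicator \<Omega> z * indicator B z) \<partial>lborel)"
  proof (rule nn_integral_mono)
    fix z
    have "emeasure lborel (?W z) \<le> ennreal (shell_const TYPE('k) * \<delta>) * (ennreal ((- r z) ^ (CARD('k) - 1)) * indicator \<Omega> z)"
    proof (cases "z \<in> \<Omega>")
      case True
      then have rz: "r z < 0" by (simp add: sublevel_def)
      have "emeasure lborel (?W z) \<le> ennreal (unit_ball_vol (real (2 * CARD('k))) *
          (real CARD('k) * \<delta> * (max 0 (- \<epsilon> - r z + \<delta>)) ^ (CARD('k) - 1)))"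
        by (rule emeasure_w_shell_le[OF assms(1)])
      also have "\<dots> \<le> ennreal (unit_ball_vol (real (2 * CARD('k))) * (real CARD('k) * \<delta> * (- r z) ^ (CARD('k) - 1)))"
        using assms rz by (intro ennreal_leI mult_left_mono power_mono) auto
      also have "\<dots> = ennreal (shell_const TYPE('k) * \<delta>) * ennreal ((- r z) ^ (CARD('k) - 1))"
        using assms rz by (subst ennreal_mult[symmetric]) (auto simp: shell_const_def mult.assoc)
      finally show ?thesis using True by simp
    next
      case False
      then have "- \<epsilon> - r z + \<delta> \<le> 0" using assms by (simp add: sublevel_def)
      then have "w \<notin> ?W z" for w
        using zero_le_power2[of "norm w"] \<open>- \<epsilon> - r z + \<delta> \<le> 0\<close>
        unfolding w_shell_def mem_Collect_eq by linarith
      then have "?W z = {}" by blast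
      then show ?thesis by simp
    qed
    then show "indicator B z * emeasure lborel (?W z) \<le>
        ennreal (shell_const TYPE('k) * \<delta>) * (ennreal ((- r z) ^ (CARD('k) - 1)) * indicator \<Omega> z * indicator B z)"
      by (auto simp: indicator_def)
  qed
  also have "\<dots> = ennreal (shell_const TYPE('k) * \<delta>) * emeasure (weighted r (CARD('k) - 1)) B"
    unfolding emeasure_weighted[OF assms(3)] by (rule nn_integral_cmult) measurable
  finally show ?thesis .
qed

text \<open>Packing at scale \<tau> costs \<open>1 / \<tau>\<close> and a shell of height
  \<open>L * \<tau>\<close> has volume of order \<tau>, so \<tau> cancels; what remains is the
  weight of the neighbourhood \<open>Kt \<tau>\<close> instead of \<open>K\<close>. These
  neighbourhoods decrease to the closed set \<open>K\<close>, and the weight is finite, so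
  continuity from above gives the claim.\<close>

lemma surface_level_compact_le:
  assumes "regular_levels lr e0 m L \<rho>" and eps: "0 < \<epsilon>" "\<epsilon> \<le> e0" and K: "compact K"
  shows "emeasure surface_measure (level \<epsilon> \<inter> zpart -` K)
    \<le> ennreal (regular_levels.packing_const TYPE(complex ^ ('n + 'k)) m L * shell_const TYPE('k) * L) * emeasure (weighted r (CARD('k) - 1)) K"
\<comment> \<open>\<open>infdist z {}\<close> is 0, which would make every neighbourhood of the
  empty set the whole space.\<close>
proof (cases "K = {}")
  case False
  interpret regular_levels lr e0 m L \<rho> by fact
  let ?A = "level \<epsilon> \<inter> zpart -` K" and ?d = "DIM(complex ^ ('n + 'k)) - 1"
  let ?C = "ennreal (packing_const * shell_const TYPE('k) * L)"
  define Kt where "Kt \<tau> = {z. infdist z K \<le> \<tau>}" for \<tau>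
  have Kt [measurable]: "Kt \<tau> \<in> sets borel" for \<tau>
    unfolding Kt_def by (intro borel_closed closed_Collect_le continuous_intros)
  define \<tau>0 where "\<tau>0 = min \<rho> (\<epsilon> / L)"
  have \<tau>0: "0 < \<tau>0" using pos eps by (simp add: \<tau>0_def)
  have pre: "hausdorff_pre ?d (10 * \<tau>) ?A \<le> ?C * emeasure (weighted r (CARD('k) - 1)) (Kt \<tau>)" if \<tau>: "0 < \<tau>" "\<tau> \<le> \<tau>0" for \<tau>
  proof -
    have \<tau>': "\<tau> \<le> \<rho>" "L * \<tau> \<le> \<epsilon>" "0 < L * \<tau>" using \<tau> pos by (auto simp: \<tau>0_def field_simps)
    let ?U = "{\<zeta>. - \<epsilon> < lr \<zeta> \<and> lr \<zeta> < - \<epsilon> + L * \<tau> \<and> zpart \<zeta> \<in> Kt \<tau>}"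
    have "hausdorff_pre ?d (10 * \<tau>) ?A \<le> ennreal (packing_const / \<tau>) * emeasure lborel ?U"
    proof (rule hausdorff_pre_le_shell[OF eps \<tau>(1) \<tau>'(1,2)])
      show "?U \<in> sets borel" by measurable
      fix x y assume "- \<epsilon> < lr x" "lr x < - \<epsilon> + L * \<tau>" "y \<in> ?A" "dist y x \<le> \<tau>"
      moreover from this have "infdist (zpart x) K \<le> \<tau>"
        using infdist_le[of "zpart y" K "zpart x"] dist_zpart_le[of x y] by (simp add: dist_commute)
      ultimately show "x \<in> ?U" by (simp add: Kt_def)
    qed auto
    also have "\<dots> \<le> ennreal (packing_const / \<tau>) * (ennreal (shell_const TYPE('k) * (L * \<tau>)) * emeasure (weighted r (CARD('k) - 1)) (Kt \<tau>))"
      by (intro mult_left_mono emeasure_shell_le \<tau>' Kt) auto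
    also have "\<dots> = ?C * emeasure (weighted r (CARD('k) - 1)) (Kt \<tau>)"
      using \<tau> pos packing_const_pos shell_const_pos[where 'k = 'k]
      by (simp add: mult.assoc[symmetric] ennreal_mult[symmetric])
    finally show ?thesis .
  qed
  have "hausdorff_outer ?d ?A \<le> ?C * emeasure (weighted r (CARD('k) - 1)) K"
    unfolding hausdorff_outer_def
  proof (rule SUP_least)
    fix \<delta> :: real assume "\<delta> \<in> {0<..}"
    then have \<delta>: "0 < \<delta>" by simp
    \<comment> \<open>The packing bound at scale \<tau> has mesh \<open>10 * \<tau>\<close>, so
      scales below \<open>\<delta> / 10\<close> bound \<open>hausdorff_pre\<close> at mesh
      \<delta>.\<close>
    define \<tau> where "\<tau> n = min \<tau>0 (\<delta> / 10) / (real n + 1)" for n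
    have \<tau>_pos: "0 < \<tau> n" for n using \<tau>0 \<delta> by (simp add: \<tau>_def)
    have \<tau>_le: "\<tau> n \<le> min \<tau>0 (\<delta> / 10)" for n
      using \<tau>0 \<delta> unfolding \<tau>_def by (intro divide_le_eq_1[THEN iffD2] mult_imp_div_pos_le) (auto simp: algebra_simps)
    have \<tau>_lim: "\<tau> \<longlonglongrightarrow> 0"
      unfolding \<tau>_def by real_asymp
    have decr: "decseq (\<lambda>n. Kt (\<tau> n))"
      unfolding Kt_def \<tau>_def using \<tau>0 \<delta>
      by (intro decseq_SucI) (auto elim!: order_trans intro!: divide_left_mono)
    have Inter: "(\<Inter>n. Kt (\<tau> n)) = K"
    proof
      show "K \<subseteq> (\<Inter>n. Kt (\<tau> n))" using \<tau>_pos by (auto simp: Kt_def intro: less_imp_le)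
      show "(\<Inter>n. Kt (\<tau> n)) \<subseteq> K"
      proof
        fix z assume "z \<in> (\<Inter>n. Kt (\<tau> n))"
        then have "infdist z K \<le> \<tau> n" for n by (auto simp: Kt_def)
        then have "infdist z K \<le> 0" using LIMSEQ_le_const[OF \<tau>_lim] by blast
        then have "infdist z K = 0" using infdist_nonneg[of z K] by linarith
        then show "z \<in> K" using in_closed_iff_infdist_zero[OF compact_imp_closed[OF K] False] by blast
      qed
    qed
    have "(\<lambda>n. emeasure (weighted r (CARD('k) - 1)) (Kt (\<tau> n))) \<longlonglongrightarrow> emeasure (weighted r (CARD('k) - 1)) (\<Inter>n. Kt (\<tau> n))"
      using weighted_finite decr by (intro Lim_emeasure_decseq) (auto simp: less_top)
    then have "(\<lambda>n. ?C * emeasure (weighted r (CARD('k) - 1)) (Kt (\<tau> n))) \<longlonglongrightarrow> ?C * emeasure (weighted r (CARD('k) - 1)) K"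
      unfolding Inter by (intro ennreal_tendsto_cmult) auto
    moreover have "hausdorff_pre ?d \<delta> ?A \<le> ?C * emeasure (weighted r (CARD('k) - 1)) (Kt (\<tau> n))" for n
    proof -
      have "10 * \<tau> n \<le> \<delta>" using \<tau>_le[of n] by simp
      then have "hausdorff_pre ?d \<delta> ?A \<le> hausdorff_pre ?d (10 * \<tau> n) ?A" by (rule hausdorff_pre_antimono)
      also have "\<dots> \<le> ?C * emeasure (weighted r (CARD('k) - 1)) (Kt (\<tau> n))" using \<tau>_pos \<tau>_le[of n] by (intro pre) auto
      finally show ?thesis .
    qed
    ultimately show "hausdorff_pre ?d \<delta> ?A \<le> ?C * emeasure (weighted r (CARD('k) - 1)) K"
      by (intro LIMSEQ_le_const) auto
  qed
  moreover have "?A \<in> sets borel"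
    by (intro borel_closed closed_Int closed_Collect_eq continuous_lr continuous_on_const
          closed_vimage compact_imp_closed K continuous_on_zpart continuous_on_id)
  ultimately show ?thesis by (simp only: emeasure_surface_measure[OF dim])
qed simp

lemma closed_level: "closed (level \<epsilon>)"
  by (intro closed_Collect_eq continuous_lr continuous_on_const)

text \<open>Measures are compared rather than integrals. The surface measure on the level is pushed
  forward to a measure \<open>M\<close> in \<open>z\<close>; the bound on compact sets extends to
  Borel sets because the finite measure \<open>M\<close> is inner regular, and an inequality of
  measures gives one for the integrals of every Borel \<open>g\<close>.\<close>

lemma surface_integral_zpart_le:
  assumes reg: "regular_levels lr e0 m L \<rho>" and eps: "0 < \<epsilon>" "\<epsilon> \<le> e0"
    and g [measurable]: "g \<in> borel_measurable borel"
  shows "(\<integral>\<^sup>+\<zeta>\<in>level \<epsilon>. g (zpart \<zeta>) \<partial>surface_measure)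
    \<le> ennreal (regular_levels.packing_const TYPE(complex ^ ('n + 'k)) m L * shell_const TYPE('k) * L) *
      (\<integral>\<^sup>+z. g z \<partial>(weighted r (CARD('k) - 1)))"
    (is "_ \<le> ?C * (\<integral>\<^sup>+z. g z \<partial>?nu)")
proof -
  have level [measurable]: "level \<epsilon> \<in> sets borel" using closed_level by (rule borel_closed)
  define M where "M = distr (density surface_measure (indicator (level \<epsilon>))) borel zpart"
  have zp: "zpart \<in> density surface_measure (indicator (level \<epsilon>)) \<rightarrow>\<^sub>M borel" by measurable
  have sets_M: "sets M = sets borel" and space_M: "space M = UNIV" by (simp_all add: M_def)
  have emeasure_M: "emeasure M B = emeasure surface_measure (level \<epsilon> \<inter> zpart -` B)" if B [measurable]: "B \<in> sets borel" for B
  proof -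
    have B': "zpart -` B \<in> sets borel" using measurable_sets_borel[OF borel_zpart B] by simp
    have "emeasure M B = emeasure (density surface_measure (indicator (level \<epsilon>))) (zpart -` B)"
      unfolding M_def using zp B by (subst emeasure_distr) auto
    also have "\<dots> = (\<integral>\<^sup>+\<zeta>. indicator (level \<epsilon>) \<zeta> * indicator (zpart -` B) \<zeta> \<partial>surface_measure)"
      using level B' by (intro emeasure_density) auto
    also have "\<dots> = (\<integral>\<^sup>+\<zeta>. indicator (level \<epsilon> \<inter> zpart -` B) \<zeta> \<partial>surface_measure)"
      by (simp add: indicator_inter_arith)
    also have "\<dots> = emeasure surface_measure (level \<epsilon> \<inter> zpart -` B)"
      using level B' by (intro nn_integral_indicator) auto
    finally show ?thesis .
  qed
  have compact_le: "emeasure M K \<le> ?C * emeasure ?nu K" if "compact K" for K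
    using surface_level_compact_le[OF reg eps that] emeasure_M[of K] that
    by (simp add: borel_closed compact_imp_closed)
  have finite_M: "emeasure M UNIV < \<infinity>"
  proof -
    \<comment> \<open>The level projects into the compact set \<open>closure \<Omega>\<close>, so
      the compact case already bounds the total mass.\<close>
    have "zpart \<zeta> \<in> closure \<Omega>" if "\<zeta> \<in> level \<epsilon>" for \<zeta>
      using that zpart_sublevel[of \<zeta>] eps(1) closure_subset[of \<Omega>] by auto
    then have "level \<epsilon> \<inter> zpart -` UNIV = level \<epsilon> \<inter> zpart -` closure \<Omega>" by auto
    then have "emeasure M UNIV = emeasure M (closure \<Omega>)"
      by (simp add: emeasure_M del: vimage_UNIV)
    also have "\<dots> \<le> ?C * emeasure ?nu (closure \<Omega>)"
      using bounded_\<Omega> by (intro compact_le) (simp add: compact_closure)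
    also have "\<dots> < \<infinity>"
      using weighted_finite by (simp add: ennreal_mult_less_top)
    finally show ?thesis .
  qed
  have "emeasure M B \<le> ?C * emeasure ?nu B" if B: "B \<in> sets borel" for B
  proof -
    have "emeasure M B = (SUP K \<in> {K. K \<subseteq> B \<and> compact K}. emeasure M K)"
      using finite_M B by (intro inner_regular) (auto simp: sets_M space_M less_top)
    also have "\<dots> \<le> ?C * emeasure ?nu B"
    proof (rule SUP_least)
      fix K assume "K \<in> {K. K \<subseteq> B \<and> compact K}"
      then have K: "K \<subseteq> B" "compact K" by auto
      have "emeasure M K \<le> ?C * emeasure ?nu K" by (rule compact_le[OF K(2)])
      also have "\<dots> \<le> ?C * emeasure ?nu B"
        using K(1) B by (intro mult_left_mono emeasure_mono) auto
      finally show "emeasure M K \<le> ?C * emeasure ?nu B" .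
    qed
    finally show ?thesis .
  qed
  then have le: "M \<le> scale_measure ?C ?nu"
    by (subst le_measure) (auto simp: sets_M)
  have "(\<integral>\<^sup>+\<zeta>\<in>level \<epsilon>. g (zpart \<zeta>) \<partial>surface_measure) = (\<integral>\<^sup>+z. g z \<partial>M)"
    unfolding M_def using zp
    by (subst nn_integral_distr) (auto simp: nn_integral_density mult.commute)
  also have "\<dots> \<le> (\<integral>\<^sup>+z. g z \<partial>(scale_measure ?C ?nu))"
    using le by (intro nn_integral_mono_measure) (auto simp: sets_M)
  also have "\<dots> = ?C * (\<integral>\<^sup>+z. g z \<partial>?nu)"
    by (rule nn_integral_scale_measure) measurable
  finally show ?thesis .
qed

section \<open>Bounds for the restriction to w = 0\<close>

lemma surface_level_finite:
  assumes reg: "regular_levels lr e0 m L \<rho>" and eps: "0 < \<epsilon>" "\<epsilon> \<le> e0"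
  shows "emeasure surface_measure (level \<epsilon>) < \<infinity>"
proof -
  have "emeasure surface_measure (level \<epsilon>) = (\<integral>\<^sup>+\<zeta>\<in>level \<epsilon>. 1 \<partial>surface_measure)"
    using borel_closed[OF closed_level[of \<epsilon>]] by simp
  also have "\<dots> < \<infinity>"
    using surface_integral_zpart_le[OF reg eps, of "\<lambda>_. 1"] weighted_finite
    by (auto intro: le_less_trans simp: ennreal_mult_less_top)
  finally show ?thesis .
qed

text \<open>Over \<open>z\<close> with \<open>r z < - \<epsilon>\<close> the fibre of the solid
  shell is a spherical shell with \<open>a = - \<epsilon> - r z > 0\<close>, to which the circular
  mean inequality and the lower volume bound apply; the other fibres count only on the right. The
  indicator cuts off the values of \<open>F\<close> outside the lift, which are arbitrary.\<close>

lemma submean_shell_integral: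
  assumes \<Phi>: "submean_gauge \<Phi>" and F: "holomorphic F (sublevel lr)"
    and del: "0 < \<epsilon>" "0 < \<delta>" "\<delta> \<le> \<epsilon>"
  shows "ennreal (shell_const TYPE('k) * \<delta>) *
      (\<integral>\<^sup>+z\<in>{z. r z < - \<epsilon>}. ennreal (\<Phi> (norm (F (join z 0))) * (- \<epsilon> - r z) ^ (CARD('k) - 1)) \<partial>lborel)
    \<le> (\<integral>\<^sup>+\<zeta>\<in>{\<zeta>. - \<epsilon> < lr \<zeta> \<and> lr \<zeta> < - \<epsilon> + \<delta>}. ennreal (indicator (sublevel lr) \<zeta> * \<Phi> (norm (F \<zeta>))) \<partial>lborel)"
proof -
  let ?Sh = "{\<zeta>. - \<epsilon> < lr \<zeta> \<and> lr \<zeta> < - \<epsilon> + \<delta>}"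
  let ?G = "\<lambda>\<zeta>. indicator (sublevel lr) \<zeta> * \<Phi> (norm (F \<zeta>))"
  let ?W = "\<lambda>z. w_shell (- \<epsilon> - r z) (- \<epsilon> - r z + \<delta>) :: (complex ^ 'k) set"
  let ?B = "\<lambda>z. ennreal (\<Phi> (norm (F (join z 0))) * (- \<epsilon> - r z) ^ (CARD('k) - 1)) * indicator {z. r z < - \<epsilon>} z"
  note contF = holomorphic_continuous_on[OF F]
  have [measurable]: "sublevel lr \<in> sets borel" unfolding sublevel_def by measurable
  have G [measurable]: "?G \<in> borel_measurable borel"
  proof -
    have "(\<lambda>\<zeta>. indicator (sublevel lr) \<zeta> *\<^sub>R \<Phi> (norm (F \<zeta>))) \<in> borel_measurable borel"
      by (intro borel_measurable_continuous_on_indicator submean_gauge_continuous[OF \<Phi>] contF) measurable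
    then show ?thesis by simp
  qed
  have B_meas: "?B \<in> borel_measurable borel"
  proof -
    have op: "open {z. r z < - \<epsilon>}" by (intro open_Collect_less continuous_r continuous_on_const)
    have "continuous_on {z. r z < - \<epsilon>} (\<lambda>z. F (join z 0))"
      by (rule continuous_on_compose2[OF contF]) (use del in \<open>auto simp: sublevel_def lr_join intro!: continuous_intros\<close>)
    then have "continuous_on {z. r z < - \<epsilon>} (\<lambda>z. \<Phi> (norm (F (join z 0))) * (- \<epsilon> - r z) ^ (CARD('k) - 1))"
      by (intro continuous_intros submean_gauge_continuous[OF \<Phi>] continuous_on_subset[OF continuous_r subset_UNIV])
    then have "(\<lambda>z. indicator {z. r z < - \<epsilon>} z *\<^sub>R (\<Phi> (norm (F (join z 0))) * (- \<epsilon> - r z) ^ (CARD('k) - 1))) \<in> borel_measurable borel"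
      using op by (intro borel_measurable_continuous_on_indicator) auto
    then have "(\<lambda>z. ennreal (indicator {z. r z < - \<epsilon>} z *\<^sub>R (\<Phi> (norm (F (join z 0))) * (- \<epsilon> - r z) ^ (CARD('k) - 1)))) \<in> borel_measurable borel"
      by measurable
    moreover have "(\<lambda>z. ennreal (indicator {z. r z < - \<epsilon>} z *\<^sub>R (\<Phi> (norm (F (join z 0))) * (- \<epsilon> - r z) ^ (CARD('k) - 1)))) = ?B"
      by (auto simp: fun_eq_iff indicator_def)
    ultimately show ?thesis by simp
  qed
  have "ennreal (shell_const TYPE('k) * \<delta>) * (\<integral>\<^sup>+z. ?B z \<partial>lborel) = (\<integral>\<^sup>+z. ennreal (shell_const TYPE('k) * \<delta>) * ?B z \<partial>lborel)"
    using B_meas by (intro nn_integral_cmult[symmetric]) simp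
  also have "\<dots> \<le> (\<integral>\<^sup>+z. \<integral>\<^sup>+w. ennreal (?G (join z w)) * indicator ?Sh (join z w) \<partial>lborel \<partial>lborel)"
  proof (rule nn_integral_mono)
    fix z
    show "ennreal (shell_const TYPE('k) * \<delta>) * ?B z \<le> (\<integral>\<^sup>+w. ennreal (?G (join z w)) * indicator ?Sh (join z w) \<partial>lborel)"
    proof (cases "r z < - \<epsilon>")
      case True
      define a where "a = - \<epsilon> - r z"
      have a: "0 < a" using True by (simp add: a_def)
      have in_lr: "join z w \<in> sublevel lr" if "w \<in> w_shell a (a + \<delta>)" for w
        using that del by (simp add: w_shell_def a_def sublevel_def lr_join)
      have "ennreal (shell_const TYPE('k) * \<delta>) * ?B z =
          ennreal (\<Phi> (norm (F (join z 0)))) * ennreal (unit_ball_vol (real (2 * CARD('k))) * (real CARD('k) * \<delta> * a ^ (CARD('k) - 1)))"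
        using True del a submean_gauge_nonneg[OF \<Phi>, of "norm (F (join z 0))"]
        by (simp add: shell_const_def a_def[symmetric] ennreal_mult[symmetric] mult_ac)
      also have "\<dots> \<le> ennreal (\<Phi> (norm (F (join z 0)))) * emeasure lborel (w_shell a (a + \<delta>) :: (complex ^ 'k) set)"
        using a del by (intro mult_left_mono emeasure_w_shell_ge) auto
      also have "\<dots> \<le> (\<integral>\<^sup>+w\<in>w_shell a (a + \<delta>). ennreal (\<Phi> (norm (F (join z w)))) \<partial>lborel)"
      proof (rule submean_w_shell[OF \<Phi>])
        show "continuous_on (w_shell a (a + \<delta>)) (\<lambda>w. F (join z w))"
          by (rule continuous_on_compose2[OF contF]) (use in_lr in \<open>auto intro!: continuous_intros\<close>)
        fix w :: "complex ^ 'k" assume w: "w \<in> w_shell a (a + \<delta>)"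
        then have w0: "0 < norm w" using a by (auto simp: w_shell_def)
        have wr: "(norm w)\<^sup>2 < - r z" using in_lr[OF w] by (simp add: sublevel_def lr_join)
        \<comment> \<open>The point \<open>join z (c *s w)\<close> lies in the lift exactly for
          \<open>norm c < R\<close>, and \<open>R\<close> exceeds 1 because \<open>w\<close> itself
          lies in the open fibre over \<open>z\<close>.\<close>
        define R where "R = sqrt (- r z) / norm w"
        have "norm w < sqrt (- r z)" using wr by (rule real_less_rsqrt)
        then have R: "1 < R" using w0 by (simp add: R_def)
        have "join z (c *s w) \<in> sublevel lr" if "c \<in> ball 0 R" for c
        proof -
          have "norm c * norm w < sqrt (- r z)" using that w0 by (simp add: R_def field_simps)
          then have "(norm c * norm w)\<^sup>2 < (sqrt (- r z))\<^sup>2" by (intro power_strict_mono) auto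
          then show ?thesis using True del by (simp add: sublevel_def lr_join norm_smult_vec)
        qed
        then show "\<exists>R>1. (\<lambda>c. F (join z (c *s w))) holomorphic_on ball 0 R"
          using R by (intro exI[of _ R] conjI holomorphic_slice[OF F])
      qed
      also have "\<dots> = (\<integral>\<^sup>+w. ennreal (?G (join z w)) * indicator ?Sh (join z w) \<partial>lborel)"
      proof (rule nn_integral_cong)
        fix w
        show "ennreal (\<Phi> (norm (F (join z w)))) * indicator (w_shell a (a + \<delta>)) w =
            ennreal (?G (join z w)) * indicator ?Sh (join z w)"
          using in_lr[of w] join_in_shell[of \<epsilon> z w \<delta>]
          by (cases "w \<in> w_shell a (a + \<delta>)") (auto simp: a_def)
      qed
      finally show ?thesis .
    qed simp
  qed
  also have "\<dots> = (\<integral>\<^sup>+\<zeta>. ennreal (?G \<zeta>) * indicator ?Sh \<zeta> \<partial>lborel)"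
    by (rule nn_integral_join[symmetric]) measurable
  finally show ?thesis .
qed

text \<open>The lower bound for the shell integral and its upper bound by the level integral both
  carry the factor \<delta>, so one small \<delta> suffices and is cancelled. The oscillation of
  \<open>\<Phi> (norm (F \<zeta>))\<close> over distances up to \<open>\<delta> / m\<close> adds an
  error proportional to the finite surface area \<open>q\<close>, which is kept below
  \<open>e\<close>.\<close>

lemma restriction_level_le:
  assumes reg: "regular_levels lr e0 m L \<rho>" and \<Phi>: "submean_gauge \<Phi>"
    and F: "holomorphic F (sublevel lr)" and eps: "0 < \<epsilon>" "\<epsilon> \<le> e0"
  shows "ennreal (shell_const TYPE('k)) *
      (\<integral>\<^sup>+z\<in>{z. r z < - \<epsilon>}. ennreal (\<Phi> (norm (F (join z 0))) * (- \<epsilon> - r z) ^ (CARD('k) - 1)) \<partial>lborel)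
    \<le> ennreal (DIM(complex ^ ('n + 'k)) * sweep_const TYPE(complex ^ ('n + 'k)) / m) *
      (\<integral>\<^sup>+\<zeta>\<in>level \<epsilon>. ennreal (\<Phi> (norm (F \<zeta>))) \<partial>surface_measure)"
    (is "ennreal ?v * ?B \<le> ennreal ?C * ?I")
proof (rule ennreal_le_epsilon)
  interpret regular_levels lr e0 m L \<rho> by fact
  fix e :: real assume e: "0 < e"
  let ?G = "\<lambda>\<zeta>. indicator (sublevel lr) \<zeta> * \<Phi> (norm (F \<zeta>))"
  have C: "0 \<le> ?C" using pos(1) sweep_const_pos[where 'a = "complex ^ ('n + 'k)"] by simp
  define q where "q = enn2real (emeasure surface_measure (level \<epsilon>))"
  have q: "emeasure surface_measure (level \<epsilon>) = ennreal q" "0 \<le> q"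
    using surface_level_finite[OF reg eps] by (simp_all add: q_def)
  \<comment> \<open>Chosen to make the error \<open>?C * (2 * \<omega> * q)\<close> at most
    \<open>e\<close>; the added 1 keeps the denominator positive when \<open>q = 0\<close>.\<close>
  define \<omega> where "\<omega> = e / (2 * ?C * q + 1)"
  have den: "0 < 2 * ?C * q + 1" using C q(2) by (intro add_nonneg_pos mult_nonneg_nonneg) auto
  have \<omega>: "0 < \<omega>" using e den by (simp add: \<omega>_def)
  have \<omega>_e: "?C * (2 * \<omega> * q) \<le> e"
  proof -
    have "?C * (2 * \<omega> * q) = (2 * ?C * q) * \<omega>" by simp
    also have "\<dots> \<le> (2 * ?C * q + 1) * \<omega>" using \<omega> by (intro mult_right_mono) auto
    also have "\<dots> = e" using den unfolding \<omega>_def by simp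
    finally show ?thesis .
  qed
  let ?K = "{\<zeta>. lr \<zeta> \<le> - (\<epsilon> / 2)}"
  have K_sub: "?K \<subseteq> sublevel lr" using eps by (auto simp: sublevel_def)
  have contG: "continuous_on (sublevel lr) (\<lambda>\<zeta>. \<Phi> (norm (F \<zeta>)))"
    by (rule submean_gauge_continuous[OF \<Phi> holomorphic_continuous_on[OF F]])
  have "uniformly_continuous_on ?K (\<lambda>\<zeta>. \<Phi> (norm (F \<zeta>)))"
    using compact_lr_le[of "- (\<epsilon> / 2)"] eps
    by (intro compact_uniformly_continuous continuous_on_subset[OF contG K_sub]) auto
  from this[unfolded uniformly_continuous_on_def, rule_format, OF \<omega>]
  obtain d where d: "0 < d" "\<And>x y. x \<in> ?K \<Longrightarrow> y \<in> ?K \<Longrightarrow> dist y x < d \<Longrightarrow>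
      dist (\<Phi> (norm (F y))) (\<Phi> (norm (F x))) < \<omega>" by blast
  \<comment> \<open>\<open>\<epsilon> / 2\<close> keeps the shell in the compact set
    \<open>?K\<close>, \<open>m * \<rho>\<close> lets the sweep reach the level, and
    \<open>m * d / 2\<close> makes the sweep length \<open>\<delta> / m\<close> smaller than
    \<open>d\<close>.\<close>
  define \<delta> where "\<delta> = min (min (\<epsilon> / 2) (m * \<rho>)) (m * d / 2)"
  have \<delta>: "0 < \<delta>" "\<delta> \<le> \<epsilon> / 2" "\<delta> \<le> m * \<rho>" "\<delta> \<le> m * d / 2" using pos eps d(1) by (auto simp: \<delta>_def)
  have \<delta>_eps: "\<delta> \<le> \<epsilon>" using \<delta>(2) eps by simp
  have \<delta>_d: "\<delta> / m < d"
  proof -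
    have "\<delta> / m \<le> d / 2" using \<delta>(4) pos(1) by (simp add: field_simps)
    then show ?thesis using d(1) by linarith
  qed
  have [measurable]: "sublevel lr \<in> sets borel" unfolding sublevel_def by measurable
  have G_meas: "?G \<in> borel_measurable borel"
  proof -
    have "(\<lambda>\<zeta>. indicator (sublevel lr) \<zeta> *\<^sub>R \<Phi> (norm (F \<zeta>))) \<in> borel_measurable borel"
      by (intro borel_measurable_continuous_on_indicator contG) measurable
    then show ?thesis by simp
  qed
  have G_nonneg: "0 \<le> ?G \<zeta>" for \<zeta>
    using submean_gauge_nonneg[OF \<Phi>] by simp
  have level_sub: "\<zeta> \<in> sublevel lr" if "lr \<zeta> = - \<epsilon>" for \<zeta>
    using that eps by (simp add: sublevel_def)
  have "ennreal (?v * \<delta>) * ?B \<le> (\<integral>\<^sup>+\<zeta>\<in>{\<zeta>. - \<epsilon> < lr \<zeta> \<and> lr \<zeta> < - \<epsilon> + \<delta>}. ennreal (?G \<zeta>) \<partial>lborel)"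
    by (rule submean_shell_integral[OF \<Phi> F eps(1) \<delta>(1) \<delta>_eps])
  also have "\<dots> \<le> ennreal (DIM(complex ^ ('n + 'k)) * sweep_const TYPE(complex ^ ('n + 'k)) * (\<delta> / m)) *
      (\<integral>\<^sup>+\<zeta>\<in>level \<epsilon>. ennreal (?G \<zeta> + 2 * \<omega>) \<partial>surface_measure)"
  proof (rule shell_integral_le[OF eps \<delta>(1) \<delta>_eps \<delta>(3) G_nonneg G_meas \<omega>])
    fix x y assume x: "- \<epsilon> < lr x" "lr x < - \<epsilon> + \<delta>" and y: "lr y = - \<epsilon>" and xy: "dist x y \<le> \<delta> / m"
    have xK: "x \<in> ?K" and yK: "y \<in> ?K" using x(2) y \<delta>(2) eps by auto
    have "dist (\<Phi> (norm (F x))) (\<Phi> (norm (F y))) < \<omega>"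
      using xy \<delta>_d by (intro d(2) xK yK) auto
    then show "?G x \<le> ?G y + \<omega>"
      using subsetD[OF K_sub xK] subsetD[OF K_sub yK] by (simp add: dist_real_def abs_le_iff)
  qed
  also have "(\<integral>\<^sup>+\<zeta>\<in>level \<epsilon>. ennreal (?G \<zeta> + 2 * \<omega>) \<partial>surface_measure) = ?I + ennreal (2 * \<omega> * q)"
  proof -
    have lev: "level \<epsilon> \<in> sets surface_measure" using borel_closed[OF closed_level] by simp
    have G_surf: "?G \<in> borel_measurable surface_measure"
      using G_meas by (subst measurable_cong_sets[OF sets_surface_measure refl])
    have "(\<integral>\<^sup>+\<zeta>\<in>level \<epsilon>. ennreal (?G \<zeta> + 2 * \<omega>) \<partial>surface_measure) =
        (\<integral>\<^sup>+\<zeta>. ennreal (?G \<zeta>) * indicator (level \<epsilon>) \<zeta> + ennreal (2 * \<omega>) * indicator (level \<epsilon>) \<zeta> \<partial>surface_measure)"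
      using G_nonneg \<omega> by (intro nn_integral_cong) (simp add: distrib_right ennreal_plus)
    also have "\<dots> = (\<integral>\<^sup>+\<zeta>. ennreal (?G \<zeta>) * indicator (level \<epsilon>) \<zeta> \<partial>surface_measure) +
        (\<integral>\<^sup>+\<zeta>. ennreal (2 * \<omega>) * indicator (level \<epsilon>) \<zeta> \<partial>surface_measure)"
      by (intro nn_integral_add borel_measurable_times_ennreal measurable_compose[OF G_surf measurable_ennreal]
            borel_measurable_indicator lev borel_measurable_const)
    also have "(\<integral>\<^sup>+\<zeta>. ennreal (?G \<zeta>) * indicator (level \<epsilon>) \<zeta> \<partial>surface_measure) = ?I"
      using level_sub by (intro nn_integral_cong) (auto simp: indicator_def)
    also have "(\<integral>\<^sup>+\<zeta>. ennreal (2 * \<omega>) * indicator (level \<epsilon>) \<zeta> \<partial>surface_measure) = ennreal (2 * \<omega> * q)"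
      using lev \<omega> q by (simp add: nn_integral_cmult_indicator ennreal_mult)
    finally show ?thesis .
  qed
  finally have *: "ennreal (?v * \<delta>) * ?B \<le>
      ennreal (DIM(complex ^ ('n + 'k)) * sweep_const TYPE(complex ^ ('n + 'k)) * (\<delta> / m)) * (?I + ennreal (2 * \<omega> * q))" .
  have "ennreal (?v * \<delta>) = ennreal \<delta> * ennreal ?v"
    using \<delta>(1) shell_const_pos[where 'k = 'k] by (simp add: ennreal_mult[symmetric] mult.commute)
  moreover have "DIM(complex ^ ('n + 'k)) * sweep_const TYPE(complex ^ ('n + 'k)) * (\<delta> / m) = \<delta> * ?C"
    by simp
  then have "ennreal (DIM(complex ^ ('n + 'k)) * sweep_const TYPE(complex ^ ('n + 'k)) * (\<delta> / m)) = ennreal \<delta> * ennreal ?C"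
    using \<delta>(1) C by (simp only: ennreal_mult)
  ultimately have "ennreal \<delta> * (ennreal ?v * ?B) \<le> ennreal \<delta> * (ennreal ?C * (?I + ennreal (2 * \<omega> * q)))"
    using * by (simp only: mult.assoc)
  then have "ennreal ?v * ?B \<le> ennreal ?C * (?I + ennreal (2 * \<omega> * q))"
    using \<delta>(1) by (subst (asm) ennreal_mult_le_mult_iff) auto
  also have "\<dots> = ennreal ?C * ?I + ennreal (?C * (2 * \<omega> * q))"
    using C \<omega> q(2) by (simp only: distrib_left ennreal_mult mult_nonneg_nonneg less_imp_le zero_le_numeral)
  also have "\<dots> \<le> ennreal ?C * ?I + ennreal e"
    using \<omega>_e by (intro add_left_mono ennreal_leI)
  finally show "ennreal ?v * ?B \<le> ennreal ?C * ?I + ennreal e" .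
qed

lemma borel_gauge_restrict:
  assumes \<Phi>: "submean_gauge \<Phi>" and f: "continuous_on \<Omega> f"
  shows "(\<lambda>z. ennreal (\<Phi> (norm (f z)))) \<in> borel_measurable (restrict_space lborel \<Omega>)"
proof -
  have "(\<lambda>z. \<Phi> (norm (f z))) \<in> borel_measurable (restrict_space borel \<Omega>)"
    by (intro borel_measurable_continuous_on_restrict submean_gauge_continuous[OF \<Phi>] f)
  then have "(\<lambda>z. \<Phi> (norm (f z))) \<in> borel_measurable (restrict_space lborel \<Omega>)"
    by (simp add: measurable_cong_sets[OF sets_restrict_space_cong[OF sets_lborel] refl])
  then show ?thesis by measurable
qed

lemma continuous_restriction:
  assumes "holomorphic F (sublevel lr)"
  shows "continuous_on \<Omega> (\<lambda>z. F (join z 0))"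
  by (rule continuous_on_compose2[OF holomorphic_continuous_on[OF assms]])
     (auto simp: sublevel_def lr_join intro!: continuous_intros)

text \<open>Each single level controls only the smaller weight
  \<open>(- \<epsilon> - r z) ^ (k - 1)\<close> on the smaller set
  \<open>r z < - \<epsilon>\<close>. Both tend to the full weight on \<Omega> as \<epsilon> tends to
  0, and Fatou's lemma preserves the bound by the supremum over levels.\<close>

lemma restriction_le:
  assumes \<Phi>: "submean_gauge \<Phi>"
  shows "\<exists>C>0. \<forall>F. holomorphic F (sublevel lr) \<longrightarrow>
    (\<integral>\<^sup>+z. ennreal (\<Phi> (norm (F (join z 0)))) \<partial>dm r (CARD('k) - 1))
    \<le> ennreal C * (SUP \<epsilon>\<in>{0<..e0}. \<integral>\<^sup>+\<zeta>\<in>level \<epsilon>. ennreal (\<Phi> (norm (F \<zeta>))) \<partial>surface_measure)"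
proof -
  obtain m L \<rho> where reg: "regular_levels lr e0 m L \<rho>" using regular by blast
  interpret regular_levels lr e0 m L \<rho> by fact
  define j where "j = CARD('k) - 1"
  define C where "C = DIM(complex ^ ('n + 'k)) * sweep_const TYPE(complex ^ ('n + 'k)) / m"
  let ?v = "shell_const TYPE('k)"
  have v: "0 < ?v" by (rule shell_const_pos)
  have "0 < real DIM(complex ^ ('n + 'k))" by (rule of_nat_0_less_iff[THEN iffD2, OF DIM_positive])
  then have C: "0 < C" unfolding C_def by (intro divide_pos_pos mult_pos_pos pos(1) sweep_const_pos)
  have "(\<integral>\<^sup>+z. ennreal (\<Phi> (norm (F (join z 0)))) \<partial>dm r j)
    \<le> ennreal (dm_const j * (C / ?v)) * (SUP \<epsilon>\<in>{0<..e0}. \<integral>\<^sup>+\<zeta>\<in>level \<epsilon>. ennreal (\<Phi> (norm (F \<zeta>))) \<partial>surface_measure)"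
    if F: "holomorphic F (sublevel lr)" for F
  proof -
    let ?S = "SUP \<epsilon>\<in>{0<..e0}. \<integral>\<^sup>+\<zeta>\<in>level \<epsilon>. ennreal (\<Phi> (norm (F \<zeta>))) \<partial>surface_measure"
    note cont = continuous_restriction[OF F]
    define \<epsilon> where "\<epsilon> n = e0 / (real n + 1)" for n
    have \<epsilon>: "0 < \<epsilon> n" "\<epsilon> n \<le> e0" for n
      using e0_pos by (auto simp: \<epsilon>_def field_simps)
    have \<epsilon>_lim: "\<epsilon> \<longlonglongrightarrow> 0" unfolding \<epsilon>_def by real_asymp
    define f where "f n z = ennreal (\<Phi> (norm (F (join z 0))) * (- \<epsilon> n - r z) ^ j) * indicator {z. r z < - \<epsilon> n} z" for n z
    have f_meas: "f n \<in> borel_measurable borel" for n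
    proof -
      have op: "open {z. r z < - \<epsilon> n}" by (intro open_Collect_less continuous_r continuous_on_const)
      have sub: "{z. r z < - \<epsilon> n} \<subseteq> \<Omega>" using \<epsilon>(1)[of n] by (auto simp: sublevel_def)
      have "continuous_on {z. r z < - \<epsilon> n} (\<lambda>z. \<Phi> (norm (F (join z 0))) * (- \<epsilon> n - r z) ^ j)"
        by (intro continuous_on_mult submean_gauge_continuous[OF \<Phi>] continuous_on_subset[OF cont sub] continuous_on_power
              continuous_on_diff continuous_on_const continuous_on_subset[OF continuous_r subset_UNIV])
      then have "(\<lambda>z. indicator {z. r z < - \<epsilon> n} z *\<^sub>R (\<Phi> (norm (F (join z 0))) * (- \<epsilon> n - r z) ^ j)) \<in> borel_measurable borel"
        using op by (intro borel_measurable_continuous_on_indicator) auto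
      then have "(\<lambda>z. ennreal (indicator {z. r z < - \<epsilon> n} z *\<^sub>R (\<Phi> (norm (F (join z 0))) * (- \<epsilon> n - r z) ^ j))) \<in> borel_measurable borel"
        by measurable
      moreover have "(\<lambda>z. ennreal (indicator {z. r z < - \<epsilon> n} z *\<^sub>R (\<Phi> (norm (F (join z 0))) * (- \<epsilon> n - r z) ^ j))) = f n"
        by (auto simp: fun_eq_iff f_def indicator_def)
      ultimately show ?thesis by simp
    qed
    have int_f: "(\<integral>\<^sup>+z. f n z \<partial>lborel) \<le> ennreal (C / ?v) * ?S" for n
    proof -
      have "ennreal ?v * (\<integral>\<^sup>+z. f n z \<partial>lborel) \<le>
          ennreal C * (\<integral>\<^sup>+\<zeta>\<in>level (\<epsilon> n). ennreal (\<Phi> (norm (F \<zeta>))) \<partial>surface_measure)"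
        unfolding f_def j_def C_def by (rule restriction_level_le[OF reg \<Phi> F \<epsilon>])
      also have "\<dots> \<le> ennreal C * ?S"
        using \<epsilon>[of n] by (intro mult_left_mono SUP_upper) auto
      also have "ennreal C = ennreal ?v * ennreal (C / ?v)"
        using v C by (subst ennreal_mult[symmetric]) auto
      finally have "ennreal ?v * (\<integral>\<^sup>+z. f n z \<partial>lborel) \<le> ennreal ?v * (ennreal (C / ?v) * ?S)"
        by (simp only: mult.assoc)
      then show ?thesis using v by (subst (asm) ennreal_mult_le_mult_iff) auto
    qed
    have lim: "(\<lambda>n. f n z) \<longlonglongrightarrow> ennreal (\<Phi> (norm (F (join z 0))) * (- r z) ^ j) * indicator \<Omega> z" for z
    proof (cases "z \<in> \<Omega>")
      case True
      then have "0 < - r z" by (simp add: sublevel_def)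
      then have "\<forall>\<^sub>F n in sequentially. \<epsilon> n < - r z" by (rule order_tendstoD(2)[OF \<epsilon>_lim])
      then have ev: "\<forall>\<^sub>F n in sequentially. ennreal (\<Phi> (norm (F (join z 0))) * (- \<epsilon> n - r z) ^ j) = f n z"
        by (rule eventually_mono) (simp add: f_def)
      have "(\<lambda>n. ennreal (\<Phi> (norm (F (join z 0))) * (- \<epsilon> n - r z) ^ j)) \<longlonglongrightarrow> ennreal (\<Phi> (norm (F (join z 0))) * (- 0 - r z) ^ j)"
        by (intro tendsto_ennrealI tendsto_intros \<epsilon>_lim)
      then show ?thesis using True Lim_transform_eventually[OF _ ev] by simp
    next
      case False
      then have "f n z = 0" for n using \<epsilon>(1)[of n] by (auto simp: f_def sublevel_def)
      then show ?thesis using False by simp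
    qed
    have "(\<integral>\<^sup>+z\<in>\<Omega>. ennreal ((- r z) ^ j) * ennreal (\<Phi> (norm (F (join z 0)))) \<partial>lborel) = (\<integral>\<^sup>+z. liminf (\<lambda>n. f n z) \<partial>lborel)"
    proof (rule nn_integral_cong)
      fix z
      have "liminf (\<lambda>n. f n z) = ennreal (\<Phi> (norm (F (join z 0))) * (- r z) ^ j) * indicator \<Omega> z"
        by (rule lim_imp_Liminf[OF _ lim]) simp
      then show "ennreal ((- r z) ^ j) * ennreal (\<Phi> (norm (F (join z 0)))) * indicator \<Omega> z = liminf (\<lambda>n. f n z)"
        using submean_gauge_nonneg[OF \<Phi>, of "norm (F (join z 0))"]
        by (cases "z \<in> \<Omega>") (auto simp: ennreal_mult'' mult.commute)
    qed
    also have "\<dots> \<le> liminf (\<lambda>n. \<integral>\<^sup>+z. f n z \<partial>lborel)"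
      using f_meas by (intro nn_integral_liminf) simp
    also have "\<dots> \<le> ennreal (C / ?v) * ?S"
      using int_f by (intro Liminf_le) (auto intro: always_eventually)
    finally have *: "(\<integral>\<^sup>+z\<in>\<Omega>. ennreal ((- r z) ^ j) * ennreal (\<Phi> (norm (F (join z 0)))) \<partial>lborel) \<le> ennreal (C / ?v) * ?S" .
    have "(\<integral>\<^sup>+z. ennreal (\<Phi> (norm (F (join z 0)))) \<partial>dm r j) = ennreal (dm_const j) *
        (\<integral>\<^sup>+z\<in>\<Omega>. ennreal ((- r z) ^ j) * ennreal (\<Phi> (norm (F (join z 0)))) \<partial>lborel)"
      by (rule nn_integral_dm[OF continuous_r open_\<Omega> borel_gauge_restrict[OF \<Phi> cont]])
    also have "\<dots> \<le> ennreal (dm_const j) * (ennreal (C / ?v) * ?S)"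
      using * by (intro mult_left_mono) auto
    also have "\<dots> = ennreal (dm_const j * (C / ?v)) * ?S"
    proof -
      have "ennreal (dm_const j * (C / ?v)) = ennreal (dm_const j) * ennreal (C / ?v)"
        using dm_const_pos[of j] C v by (intro ennreal_mult) auto
      then show ?thesis by (simp only: mult.assoc)
    qed
    finally show ?thesis .
  qed
  moreover have "0 < dm_const j * (C / ?v)" using dm_const_pos C v by simp
  ultimately show ?thesis unfolding j_def by blast
qed

text \<open>For a function of \<open>z\<close> alone the level integral is an integral against the
  projected surface measure, which is dominated by the weight with a constant independent of the
  level. Extension by 0 off \<Omega> makes the integrand Borel on the whole space and changes
  nothing on the level, which projects into \<Omega>.\<close>

lemma extension_le:
  assumes \<Phi>: "submean_gauge \<Phi>"
  shows "\<exists>C>0. \<forall>f. holomorphic f \<Omega> \<longrightarrow>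
    (SUP \<epsilon>\<in>{0<..e0}. \<integral>\<^sup>+\<zeta>\<in>level \<epsilon>. ennreal (\<Phi> (norm (f (zpart \<zeta>)))) \<partial>surface_measure)
    \<le> ennreal C * (\<integral>\<^sup>+z. ennreal (\<Phi> (norm (f z))) \<partial>dm r (CARD('k) - 1))"
proof -
  obtain m L \<rho> where reg: "regular_levels lr e0 m L \<rho>" using regular by blast
  interpret regular_levels lr e0 m L \<rho> by fact
  define j where "j = CARD('k) - 1"
  define C where "C = packing_const * shell_const TYPE('k) * L"
  have C: "0 < C" using packing_const_pos shell_const_pos[where 'k = 'k] pos by (simp add: C_def)
  note c = dm_const_pos[of j]
  have "(SUP \<epsilon>\<in>{0<..e0}. \<integral>\<^sup>+\<zeta>\<in>level \<epsilon>. ennreal (\<Phi> (norm (f (zpart \<zeta>)))) \<partial>surface_measure)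
    \<le> ennreal (C / dm_const j) * (\<integral>\<^sup>+z. ennreal (\<Phi> (norm (f z))) \<partial>dm r j)"
    if f: "holomorphic f \<Omega>" for f
  proof (rule SUP_least)
    fix \<epsilon> assume "\<epsilon> \<in> {0<..e0}"
    then have eps: "0 < \<epsilon>" "\<epsilon> \<le> e0" by auto
    note cont = holomorphic_continuous_on[OF f]
    define g where "g z = ennreal (indicator \<Omega> z *\<^sub>R \<Phi> (norm (f z)))" for z
    have g [measurable]: "g \<in> borel_measurable borel"
    proof -
      have "(\<lambda>z. indicator \<Omega> z *\<^sub>R \<Phi> (norm (f z))) \<in> borel_measurable borel"
        by (intro borel_measurable_continuous_on_indicator submean_gauge_continuous[OF \<Phi>] cont) measurable
      then show ?thesis unfolding g_def by measurable
    qed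
    let ?W = "\<integral>\<^sup>+z\<in>\<Omega>. ennreal ((- r z) ^ j) * ennreal (\<Phi> (norm (f z))) \<partial>lborel"
    have "(\<integral>\<^sup>+\<zeta>\<in>level \<epsilon>. ennreal (\<Phi> (norm (f (zpart \<zeta>)))) \<partial>surface_measure) = (\<integral>\<^sup>+\<zeta>\<in>level \<epsilon>. g (zpart \<zeta>) \<partial>surface_measure)"
    proof (rule nn_integral_cong)
      fix \<zeta>
      show "ennreal (\<Phi> (norm (f (zpart \<zeta>)))) * indicator (level \<epsilon>) \<zeta> = g (zpart \<zeta>) * indicator (level \<epsilon>) \<zeta>"
        using zpart_sublevel[of \<zeta>] eps by (cases "lr \<zeta> = - \<epsilon>") (auto simp: g_def)
    qed
    also have "\<dots> \<le> ennreal C * (\<integral>\<^sup>+z. g z \<partial>(weighted r j))"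
      unfolding C_def j_def by (rule surface_integral_zpart_le[OF reg eps g])
    also have "(\<integral>\<^sup>+z. g z \<partial>(weighted r j)) = ?W"
      unfolding weighted_def
      by (subst nn_integral_density) (auto simp: g_def indicator_def intro!: nn_integral_cong)
    also have "ennreal C * ?W = ennreal (C / dm_const j) * (ennreal (dm_const j) * ?W)"
      using C c by (simp add: mult.assoc[symmetric] ennreal_mult[symmetric])
    also have "ennreal (dm_const j) * ?W = (\<integral>\<^sup>+z. ennreal (\<Phi> (norm (f z))) \<partial>dm r j)"
      by (rule nn_integral_dm[OF continuous_r open_\<Omega> borel_gauge_restrict[OF \<Phi> cont], symmetric])
    finally show "(\<integral>\<^sup>+\<zeta>\<in>level \<epsilon>. ennreal (\<Phi> (norm (f (zpart \<zeta>)))) \<partial>surface_measure)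
        \<le> ennreal (C / dm_const j) * (\<integral>\<^sup>+z. ennreal (\<Phi> (norm (f z))) \<partial>dm r j)" .
  qed
  moreover have "0 < C / dm_const j" using C c by simp
  ultimately show ?thesis unfolding j_def by blast
qed

section \<open>Holomorphy, finiteness and norms\<close>

lemma holomorphic_restriction:
  assumes "holomorphic F (sublevel lr)"
  shows "holomorphic (\<lambda>z. F (join z 0)) \<Omega>"
  unfolding holomorphic_def
proof
  fix z assume "z \<in> \<Omega>"
  then have "join z 0 \<in> sublevel lr" by (simp add: sublevel_def lr_join)
  then obtain D where D: "(F has_derivative D) (at (join z 0))" "\<And>c v. D (c *s v) = c * D v"
    using assms unfolding holomorphic_def by blast
  have "bounded_linear (\<lambda>z. join z 0 :: complex ^ ('n + 'k))"
    by (intro linear_conv_bounded_linear[THEN iffD1] linearI)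
       (simp_all add: join_add[symmetric] join_scaleR[symmetric])
  then have "((\<lambda>z. join z 0) has_derivative (\<lambda>h. join h 0 :: complex ^ ('n + 'k))) (at z)"
    by (rule bounded_linear_imp_has_derivative)
  from has_derivative_compose[OF this D(1)]
  have "((\<lambda>z. F (join z 0)) has_derivative (\<lambda>h. D (join h 0))) (at z)" .
  moreover have "join (c *s v) (0 :: complex ^ 'k) = c *s join v 0" for c and v :: "complex ^ 'n"
    using join_smult[of c v "0 :: complex ^ 'k"] by simp
  ultimately show "\<exists>L. ((\<lambda>z. F (join z 0)) has_derivative L) (at z) \<and> (\<forall>c v. L (c *s v) = c * L v)"
    using D(2) by (intro exI[of _ "\<lambda>h. D (join h 0)"]) simp
qed

lemma holomorphic_extension:
  assumes "holomorphic f \<Omega>"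
  shows "holomorphic (\<lambda>\<zeta>. f (zpart \<zeta>)) (sublevel lr)"
  unfolding holomorphic_def
proof
  fix \<zeta> assume "\<zeta> \<in> sublevel lr"
  then have "zpart \<zeta> \<in> \<Omega>" using zpart_sublevel by (simp add: sublevel_def)
  then obtain D where D: "(f has_derivative D) (at (zpart \<zeta>))" "\<And>c v. D (c *s v) = c * D v"
    using assms unfolding holomorphic_def by blast
  have "(zpart has_derivative zpart) (at \<zeta>)"
    by (rule bounded_linear_imp_has_derivative[OF bounded_linear_zpart])
  from has_derivative_compose[OF this D(1)]
  have "((\<lambda>\<zeta>. f (zpart \<zeta>)) has_derivative (\<lambda>h. D (zpart h))) (at \<zeta>)" .
  moreover have "zpart (c *s v) = c *s zpart v" for c and v :: "complex ^ ('n + 'k)"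
    by (simp add: zpart_def vec_eq_iff)
  ultimately show "\<exists>L. ((\<lambda>\<zeta>. f (zpart \<zeta>)) has_derivative L) (at \<zeta>) \<and> (\<forall>c v. L (c *s v) = c * L v)"
    using D(2) by (intro exI[of _ "\<lambda>h. D (zpart h)"]) simp
qed

end

text \<open>Finiteness of \<open>b\<close> is essential: \<open>enn2real \<infinity>\<close> is 0,
  so an infinite right side could make the real inequality false.\<close>

lemma enn2real_powr_le:
  assumes "a \<le> ennreal C * b" "b < \<infinity>" "0 \<le> C" "0 < q"
  shows "enn2real a powr q \<le> C powr q * enn2real b powr q"
proof -
  have "enn2real a \<le> enn2real (ennreal C * b)"
    using assms by (intro enn2real_mono) (auto simp: ennreal_mult_less_top)
  also have "\<dots> = C * enn2real b" using assms by (simp add: enn2real_mult)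
  finally have "enn2real a powr q \<le> (C * enn2real b) powr q"
    using assms by (intro powr_mono2) auto
  then show ?thesis using assms by (simp add: powr_mult)
qed

lemma le_finite: "a \<le> ennreal C * b \<Longrightarrow> b < \<infinity> \<Longrightarrow> a < \<infinity>"
  by (auto intro: le_less_trans simp: ennreal_mult_less_top)

theorem theorem1p2:
  fixes r :: "complex ^ 'n::finite \<Rightarrow> real"
    and lr :: "complex ^ ('n + 'k::finite) \<Rightarrow> real"
    and p e0 :: real
  assumes "is_domain r"
    and "lr = lift r"
    and "small_enough lr e0"
    and "0 < p"
  shows
    "(\<exists>C>0. \<forall>F\<in>hardy_space lr e0 p.
        (\<lambda>z. F (join z 0)) \<in> bergman_space r (CARD('k) - 1) p \<and>
        bergman_norm r (CARD('k) - 1) p (\<lambda>z. F (join z 0)) \<le> C * hardy_norm lr e0 p F)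
     \<and>
     (\<exists>C>0. \<forall>F\<in>nev_space lr e0.
        (\<lambda>z. F (join z 0)) \<in> nev_wt_space r (CARD('k) - 1) \<and>
        nev_wt_norm r (CARD('k) - 1) (\<lambda>z. F (join z 0)) \<le> C * nev_norm lr e0 F)
     \<and>
     (\<forall>f. holomorphic f (sublevel r) \<longrightarrow>
        (f \<in> bergman_space r (CARD('k) - 1) p \<longleftrightarrow> (\<lambda>\<zeta>. f (zpart \<zeta>)) \<in> hardy_space lr e0 p))
     \<and>
     (\<exists>C>0. \<forall>f\<in>bergman_space r (CARD('k) - 1) p.
        bergman_norm r (CARD('k) - 1) p f \<le> C * hardy_norm lr e0 p (\<lambda>\<zeta>. f (zpart \<zeta>)) \<and>
        hardy_norm lr e0 p (\<lambda>\<zeta>. f (zpart \<zeta>)) \<le> C * bergman_norm r (CARD('k) - 1) p f)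
     \<and>
     (\<forall>f. holomorphic f (sublevel r) \<longrightarrow>
        (f \<in> nev_wt_space r (CARD('k) - 1) \<longleftrightarrow> (\<lambda>\<zeta>. f (zpart \<zeta>)) \<in> nev_space lr e0))
     \<and>
     (\<exists>C>0. \<forall>f\<in>nev_wt_space r (CARD('k) - 1).
        nev_wt_norm r (CARD('k) - 1) f \<le> C * nev_norm lr e0 (\<lambda>\<zeta>. f (zpart \<zeta>)) \<and>
        nev_norm lr e0 (\<lambda>\<zeta>. f (zpart \<zeta>)) \<le> C * nev_wt_norm r (CARD('k) - 1) f)"
proof -
  interpret lifted_domain r lr e0
    using assms(1-3) by unfold_locales
  let ?j = "CARD('k) - 1"
  have q: "0 < 1 / p" using assms(4) by simp
  obtain C1 where C1: "0 < C1" "\<And>F. holomorphic F (sublevel lr) \<Longrightarrow>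
      bergman_int r ?j p (\<lambda>z. F (join z 0)) \<le> ennreal C1 * hardy_int lr e0 p F"
    using restriction_le[OF submean_gauge_powr[OF assms(4)]] unfolding bergman_int_def hardy_int_def by blast
  obtain C2 where C2: "0 < C2" "\<And>f. holomorphic f \<Omega> \<Longrightarrow>
      hardy_int lr e0 p (\<lambda>\<zeta>. f (zpart \<zeta>)) \<le> ennreal C2 * bergman_int r ?j p f"
    using extension_le[OF submean_gauge_powr[OF assms(4)]] unfolding bergman_int_def hardy_int_def by blast
  obtain C3 where C3: "0 < C3" "\<And>F. holomorphic F (sublevel lr) \<Longrightarrow>
      nev_wt_int r ?j (\<lambda>z. F (join z 0)) \<le> ennreal C3 * nev_int lr e0 F"
    using restriction_le[OF submean_gauge_log_plus] unfolding nev_wt_int_def nev_int_def log_plus_def by blast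
  obtain C4 where C4: "0 < C4" "\<And>f. holomorphic f \<Omega> \<Longrightarrow>
      nev_int lr e0 (\<lambda>\<zeta>. f (zpart \<zeta>)) \<le> ennreal C4 * nev_wt_int r ?j f"
    using extension_le[OF submean_gauge_log_plus] unfolding nev_wt_int_def nev_int_def log_plus_def by blast
  have restr_A: "(\<lambda>z. F (join z 0)) \<in> bergman_space r ?j p \<and>
      bergman_norm r ?j p (\<lambda>z. F (join z 0)) \<le> C1 powr (1 / p) * hardy_norm lr e0 p F"
    if "F \<in> hardy_space lr e0 p" for F
  proof -
    have F: "holomorphic F (sublevel lr)" "hardy_int lr e0 p F < \<infinity>" using that by (auto simp: hardy_space_def)
    show ?thesis
      using holomorphic_restriction[OF F(1)] le_finite[OF C1(2)[OF F(1)] F(2)]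
        enn2real_powr_le[OF C1(2)[OF F(1)] F(2) less_imp_le[OF C1(1)] q]
      by (simp add: bergman_space_def bergman_norm_def hardy_norm_def)
  qed
  have ext_A: "(\<lambda>\<zeta>. f (zpart \<zeta>)) \<in> hardy_space lr e0 p \<and>
      hardy_norm lr e0 p (\<lambda>\<zeta>. f (zpart \<zeta>)) \<le> C2 powr (1 / p) * bergman_norm r ?j p f"
    if "f \<in> bergman_space r ?j p" for f
  proof -
    have f: "holomorphic f \<Omega>" "bergman_int r ?j p f < \<infinity>" using that by (auto simp: bergman_space_def)
    show ?thesis
      using holomorphic_extension[OF f(1)] le_finite[OF C2(2)[OF f(1)] f(2)]
        enn2real_powr_le[OF C2(2)[OF f(1)] f(2) less_imp_le[OF C2(1)] q]
      by (simp add: hardy_space_def bergman_norm_def hardy_norm_def)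
  qed
  \<comment> \<open>The Nevanlinna quantities carry no root, so the conversion to real numbers is
    used with exponent 1 and the constant is unchanged.\<close>
  have restr_N: "(\<lambda>z. F (join z 0)) \<in> nev_wt_space r ?j \<and>
      nev_wt_norm r ?j (\<lambda>z. F (join z 0)) \<le> C3 * nev_norm lr e0 F"
    if "F \<in> nev_space lr e0" for F
  proof -
    have F: "holomorphic F (sublevel lr)" "nev_int lr e0 F < \<infinity>" using that by (auto simp: nev_space_def)
    show ?thesis
      using holomorphic_restriction[OF F(1)] le_finite[OF C3(2)[OF F(1)] F(2)]
        enn2real_powr_le[OF C3(2)[OF F(1)] F(2) less_imp_le[OF C3(1)] zero_less_one] C3(1)
      by (simp add: nev_wt_space_def nev_wt_norm_def nev_norm_def)
  qed
  have ext_N: "(\<lambda>\<zeta>. f (zpart \<zeta>)) \<in> nev_space lr e0 \<and>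
      nev_norm lr e0 (\<lambda>\<zeta>. f (zpart \<zeta>)) \<le> C4 * nev_wt_norm r ?j f"
    if "f \<in> nev_wt_space r ?j" for f
  proof -
    have f: "holomorphic f \<Omega>" "nev_wt_int r ?j f < \<infinity>" using that by (auto simp: nev_wt_space_def)
    show ?thesis
      using holomorphic_extension[OF f(1)] le_finite[OF C4(2)[OF f(1)] f(2)]
        enn2real_powr_le[OF C4(2)[OF f(1)] f(2) less_imp_le[OF C4(1)] zero_less_one] C4(1)
      by (simp add: nev_space_def nev_wt_norm_def nev_norm_def)
  qed
  \<comment> \<open>Restricting the extension to \<open>w = 0\<close> gives back \<open>f\<close> by
    \<open>zpart_join\<close>, so the restriction result applied to the extension is the converse
    implication.\<close>
  have iff_A: "f \<in> bergman_space r ?j p \<longleftrightarrow> (\<lambda>\<zeta>. f (zpart \<zeta>)) \<in> hardy_space lr e0 p" for f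
    using ext_A[of f] restr_A[of "\<lambda>\<zeta>. f (zpart \<zeta>)"] by auto
  have iff_N: "f \<in> nev_wt_space r ?j \<longleftrightarrow> (\<lambda>\<zeta>. f (zpart \<zeta>)) \<in> nev_space lr e0" for f
    using ext_N[of f] restr_N[of "\<lambda>\<zeta>. f (zpart \<zeta>)"] by auto
  \<comment> \<open>One constant has to serve both inequalities of an equivalence.\<close>
  define CA where "CA = max (C1 powr (1 / p)) (C2 powr (1 / p))"
  define CN where "CN = max C3 C4"
  have max_mono: "x \<le> max c c' * y" "x' \<le> max c c' * y'"
    if "x \<le> c * y" "x' \<le> c' * y'" "0 \<le> y" "0 \<le> y'" for x x' y y' c c' :: real
    using that mult_right_mono[of c "max c c'" y] mult_right_mono[of c' "max c c'" y'] by auto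
  have norms: "0 \<le> bergman_norm r ?j p f" "0 \<le> hardy_norm lr e0 p F" "0 \<le> nev_wt_norm r ?j f" "0 \<le> nev_norm lr e0 F" for f F
    by (simp_all add: bergman_norm_def hardy_norm_def nev_wt_norm_def nev_norm_def)
  have equiv_A: "bergman_norm r ?j p f \<le> CA * hardy_norm lr e0 p (\<lambda>\<zeta>. f (zpart \<zeta>)) \<and>
      hardy_norm lr e0 p (\<lambda>\<zeta>. f (zpart \<zeta>)) \<le> CA * bergman_norm r ?j p f"
    if f: "f \<in> bergman_space r ?j p" for f
  proof -
    have "bergman_norm r ?j p f \<le> C1 powr (1 / p) * hardy_norm lr e0 p (\<lambda>\<zeta>. f (zpart \<zeta>))"
      using restr_A[of "\<lambda>\<zeta>. f (zpart \<zeta>)"] ext_A[OF f] by simp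
    from max_mono[OF this conjunct2[OF ext_A[OF f]] norms(2,1)]
    show ?thesis by (simp add: CA_def)
  qed
  have equiv_N: "nev_wt_norm r ?j f \<le> CN * nev_norm lr e0 (\<lambda>\<zeta>. f (zpart \<zeta>)) \<and>
      nev_norm lr e0 (\<lambda>\<zeta>. f (zpart \<zeta>)) \<le> CN * nev_wt_norm r ?j f"
    if f: "f \<in> nev_wt_space r ?j" for f
  proof -
    have "nev_wt_norm r ?j f \<le> C3 * nev_norm lr e0 (\<lambda>\<zeta>. f (zpart \<zeta>))"
      using restr_N[of "\<lambda>\<zeta>. f (zpart \<zeta>)"] ext_N[OF f] by simp
    from max_mono[OF this conjunct2[OF ext_N[OF f]] norms(4,3)]
    show ?thesis by (simp add: CN_def)
  qed
  have pos: "0 < C1 powr (1 / p)" "0 < CA" "0 < CN"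
    using C1(1) C3(1) by (auto simp: CA_def CN_def less_max_iff_disj)
  show ?thesis
    using pos C3(1) restr_A restr_N iff_A iff_N equiv_A equiv_N
    by (intro conjI) (blast intro: exI)+
qed

end
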